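(* Let $G$ and $H$ be locally compact, locally Hausdorff, étale groupoids with locally compact Hausdorff unit spaces, let $Z$ be a groupoid correspondence from $G$ to $H$, and let $p\in[1,\infty]$. The algebraic action of $\mathcal C(G)$ on the Banach $F^p_{\mathrm{red}}(H)$-pair $(\mathsf X_Z,\mathsf Y_Z)$ extends continuously to $F^p_{\mathrm{red}}(G)$ in each of the following cases: 1. $p=1$; 2. $p=\infty$; 3. $1<p<\infty$ and the left $G$-action on $Z$ is proper.
   Context: **Groupoids.** For a locally compact, locally Hausdorff space $X$, $\mathcal C(X)=\mathrm{span}\{f\in C_c(U):U\subseteq X\text{ open Hausdorff}\}$ (extension by zero). For an étale groupoid $G$, $\mathcal C(G)$ is an algebra under $(f*g)(\gamma)=\sum_{r(\eta)=r(\gamma)}f(\eta)g(\eta^{-1}\gamma)$. With $G_u=s^{-1}(u)$, $F^p_{\mathrm{red}}(G)$ is the completion of $\mathcal C(G)$ in $\sup_{u\in G^{(0)}}\|\lambda_u(f)\|_{B(\ell^p(G_u))}$, where $\lambda_u(f)\xi(\gamma)=\sum_{r(\eta)=r(\gamma)}f(\eta)\xi(\eta^{-1}\gamma)$. **Correspondences.** A groupoid correspondence from $G$ to $H$ is a topological space $Z$ with commuting continuous left $G$-action (anchor $r_Z:Z\to G^{(0)}$, continuous, not necessarily open) and continuous right $H$-action (anchor $s_Z:Z\to H^{(0)}$) such that $s_Z$ is a local homeomorphism and the right $H$-action is free and proper. A left action is proper if $\{(\gamma,z):s(\gamma)=r_Z(z)\}\to Z\times Z$, $(\gamma,z)\mapsto(\gamma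 z,z)$, is a proper map (closed, with compact inverse images of compact sets); similarly for right actions. **The Banach pair.** Put $Z_v=s_Z^{-1}(v)$, $H_v=s^{-1}(v)$, $E_H^p=\bigoplus^p_{v\in H^{(0)}}\ell^p(H_v)$, $E_Z^p=\bigoplus^p_{v\in H^{(0)}}\ell^p(Z_v)$ ($\ell^\infty$-sums if $p=\infty$). Then $B=F^p_{\mathrm{red}}(H)$ is isometrically represented on $E_H^p$ by $\bigoplus_v\lambda_v$. Let $Z^{op}=\{\bar z:z\in Z\}$ be a homeomorphic copy of $Z$. For $\phi\in\mathcal C(Z)$, $\psi\in\mathcal C(Z^{op})$ define bounded operators $T_\phi:E_H^p\to E_Z^p$, $(T_\phi\xi)(z)=\sum_{h\in H_{s_Z(z)}}\phi(zh^{-1})\xi(h)$, and $S_\psi:E_Z^p\to E_H^p$, $(S_\psi\zeta)(h)=\sum_{z\in Z_{s(h)}}\psi(\overline{zh^{-1}})\zeta(z)$. These assignments are injective; $\mathsf Y_Z$, $\mathsf X_Z$ are the operator-norm closures of $\{T_\phi\}$, $\{S_\psi\}$, i.e. completions of $\mathcal C(Z)$, $\mathcal C(Z^{op})$. With operator composition as $B$-actions and pairing $\langle S,T\rangle_B=ST$, $(\mathsf X_Z,\mathsf Y_Z)$ is a Banach $B$-pair. $\mathcal L_B(\mathsf X_Z,\mathsf Y_Z)$ is the Banach algebra of pairs $T=(T^l,T^r)$ of bounded $B$-module maps $T^l:\mathsf X_Z\to\mathsf X_Z$, $T^r:\mathsf Y_Z\to\mathsf Y_Z$ with $\langle T^lx,y\rangle=\langle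 x,T^ry\rangle$, norm $\max(\|T^l\|,\|T^r\|)$, product $TS=(S^lT^l,T^rS^r)$. **The algebraic action.** $\mathcal C(G)$ acts by $(a\cdot\phi)(z)=\sum_{r(\gamma)=r_Z(z)}a(\gamma)\phi(\gamma^{-1}z)$ on $\mathcal C(Z)$ and $(\psi\cdot a)(\bar z)=\sum_{r(\gamma)=r_Z(z)}\psi(\overline{\gamma^{-1}z})a(\gamma^{-1})$ on $\mathcal C(Z^{op})$. "Extends continuously to $F^p_{\mathrm{red}}(G)$" means that there is a continuous homomorphism $F^p_{\mathrm{red}}(G)\to\mathcal L_B(\mathsf X_Z,\mathsf Y_Z)$ which on $\mathcal C(G)$ is given on the dense subspaces by these formulas. *)

theory Defs
  imports "HOL-Analysis.Analysis"
begin

section \<open>Topology\<close>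

definition local_homeomorphism :: "'a topology \<Rightarrow> 'b topology \<Rightarrow> ('a \<Rightarrow> 'b) \<Rightarrow> bool" where
  "local_homeomorphism X Y f \<longleftrightarrow>
     (\<forall>x\<in>topspace X. \<exists>U. openin X U \<and> x \<in> U \<and> openin Y (f ` U) \<and>
        homeomorphic_map (subtopology X U) (subtopology Y (f ` U)) f)"

definition locally_Hausdorff_space :: "'a topology \<Rightarrow> bool" where
  "locally_Hausdorff_space X \<longleftrightarrow>
     (\<forall>x\<in>topspace X. \<exists>U. openin X U \<and> x \<in> U \<and> Hausdorff_space (subtopology X U))"

text \<open>Elements of \<open>C\<^sub>c(U)\<close>, extended by zero to the whole type.\<close>

definition Cc :: "'a topology \<Rightarrow> 'a set \<Rightarrow> ('a \<Rightarrow> complex) set" where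
  "Cc X U = {f. continuous_map (subtopology X U) euclidean f \<and>
                compactin (subtopology X U) (subtopology X U closure_of {x \<in> U. f x \<noteq> 0}) \<and>
                (\<forall>x. x \<notin> U \<longrightarrow> f x = 0)}"

text \<open>The complex linear span of the \<open>C\<^sub>c(U)\<close>, \<open>U\<close> open and Hausdorff.\<close>

definition CC :: "'a topology \<Rightarrow> ('a \<Rightarrow> complex) set" where
  "CC X = {f. \<exists>(n::nat) c g.
       (\<forall>i<n. \<exists>U. openin X U \<and> Hausdorff_space (subtopology X U) \<and> g i \<in> Cc X U) \<and>
       f = (\<lambda>x. \<Sum>i<n. c i * g i x)}"

section \<open>Complex normed spaces and algebras on carrier sets\<close>

record 'a cnspace =
  carr :: "'a set"
  vadd :: "'a \<Rightarrow> 'a \<Rightarrow> 'a"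
  vscale :: "complex \<Rightarrow> 'a \<Rightarrow> 'a"
  vnorm :: "'a \<Rightarrow> real"

record 'a cnalg = "'a cnspace" +
  amult :: "'a \<Rightarrow> 'a \<Rightarrow> 'a"

definition vdist :: "('a, 'm) cnspace_scheme \<Rightarrow> 'a \<Rightarrow> 'a \<Rightarrow> real" where
  "vdist V x y = vnorm V (vadd V x (vscale V (-1) y))"

definition vclosure :: "('a, 'm) cnspace_scheme \<Rightarrow> 'a set \<Rightarrow> 'a set" where
  "vclosure V S = {x \<in> carr V. \<forall>e>0. \<exists>y\<in>S. vdist V x y < e}"

definition linear_between ::
    "('a, 'm) cnspace_scheme \<Rightarrow> ('b, 'n) cnspace_scheme \<Rightarrow> ('a \<Rightarrow> 'b) \<Rightarrow> bool" where
  "linear_between V W T \<longleftrightarrow> T \<in> carr V \<rightarrow> carr W \<and>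
     (\<forall>x\<in>carr V. \<forall>y\<in>carr V. T (vadd V x y) = vadd W (T x) (T y)) \<and>
     (\<forall>c. \<forall>x\<in>carr V. T (vscale V c x) = vscale W c (T x))"

text \<open>The space of bounded operators with the operator norm.  Operators are \<open>undefined\<close> outside
  the carrier of their domain, so that equality of operators is equality in the type.\<close>

definition bops ::
    "('a, 'm) cnspace_scheme \<Rightarrow> ('b, 'n) cnspace_scheme \<Rightarrow> ('a \<Rightarrow> 'b) cnspace" where
  "bops V W =
    \<lparr> carr = {T \<in> extensional (carr V). linear_between V W T \<and>
                (\<exists>C. \<forall>x\<in>carr V. vnorm W (T x) \<le> C * vnorm V x)},
      vadd = (\<lambda>S T. \<lambda>x\<in>carr V. vadd W (S x) (T x)),
      vscale = (\<lambda>c T. \<lambda>x\<in>carr V. vscale W c (T x)),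
      vnorm = (\<lambda>T. Sup {vnorm W (T x) | x. x \<in> carr V \<and> vnorm V x \<le> 1}) \<rparr>"

text \<open>Completion by classes of Cauchy sequences modulo null sequences.\<close>

definition cauchy_seqs :: "('a, 'm) cnspace_scheme \<Rightarrow> (nat \<Rightarrow> 'a) set" where
  "cauchy_seqs V = {f. range f \<subseteq> carr V \<and>
     (\<forall>e>0. \<exists>N. \<forall>m\<ge>N. \<forall>n\<ge>N. vdist V (f m) (f n) < e)}"

definition null_rel :: "('a, 'm) cnspace_scheme \<Rightarrow> ((nat \<Rightarrow> 'a) \<times> (nat \<Rightarrow> 'a)) set" where
  "null_rel V = {(f, g). f \<in> cauchy_seqs V \<and> g \<in> cauchy_seqs V \<and>
     (\<lambda>n. vdist V (f n) (g n)) \<longlonglongrightarrow> 0}"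

definition completion :: "'a cnalg \<Rightarrow> (nat \<Rightarrow> 'a) set cnalg" where
  "completion A =
    \<lparr> carr = cauchy_seqs A // null_rel A,
      vadd = (\<lambda>P Q. \<Union>f\<in>P. \<Union>g\<in>Q. null_rel A `` {\<lambda>n. vadd A (f n) (g n)}),
      vscale = (\<lambda>c P. \<Union>f\<in>P. null_rel A `` {\<lambda>n. vscale A c (f n)}),
      vnorm = (\<lambda>P. THE l. \<forall>f\<in>P. (\<lambda>n. vnorm A (f n)) \<longlonglongrightarrow> l),
      amult = (\<lambda>P Q. \<Union>f\<in>P. \<Union>g\<in>Q. null_rel A `` {\<lambda>n. amult A (f n) (g n)}) \<rparr>"

definition completion_embed :: "'a cnalg \<Rightarrow> 'a \<Rightarrow> (nat \<Rightarrow> 'a) set" where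
  "completion_embed A a = null_rel A `` {\<lambda>n. a}"

definition continuous_alg_hom :: "'a cnalg \<Rightarrow> 'b cnalg \<Rightarrow> ('a \<Rightarrow> 'b) \<Rightarrow> bool" where
  "continuous_alg_hom A B \<pi> \<longleftrightarrow> linear_between A B \<pi> \<and>
     (\<forall>a\<in>carr A. \<forall>b\<in>carr A. \<pi> (amult A a b) = amult B (\<pi> a) (\<pi> b)) \<and>
     (\<forall>a\<in>carr A. \<forall>e>0. \<exists>d>0. \<forall>b\<in>carr A. vdist A b a < d \<longrightarrow> vdist B (\<pi> b) (\<pi> a) < e)"

section \<open>Spaces of \<open>p\<close>-summable functions and their \<open>p\<close>-direct sums\<close>

definition cut :: "'a set \<Rightarrow> ('a \<Rightarrow> complex) \<Rightarrow> 'a \<Rightarrow> complex" where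
  "cut A f = (\<lambda>x. if x \<in> A then f x else 0)"

text \<open>Functions on \<open>X\<close> are extended by zero.  The \<open>0\<close> inserted in the supremum only matters when
  \<open>X\<close> is empty.\<close>

definition lp :: "ennreal \<Rightarrow> 'a set \<Rightarrow> ('a \<Rightarrow> complex) cnspace" where
  "lp p X =
    \<lparr> carr = {f. (\<forall>x. x \<notin> X \<longrightarrow> f x = 0) \<and>
               (if p = \<infinity> then bdd_above ((\<lambda>x. cmod (f x)) ` X)
                else (\<lambda>x. cmod (f x) powr enn2real p) summable_on X)},
      vadd = (\<lambda>f g x. f x + g x),
      vscale = (\<lambda>c f x. c * f x),
      vnorm = (\<lambda>f. if p = \<infinity> then Sup (insert 0 ((\<lambda>x. cmod (f x)) ` X))
                   else (\<Sum>\<^sub>\<infinity>x\<in>X. cmod (f x) powr enn2real p) powr (1 / enn2real p)) \<rparr>"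

text \<open>The direct sum over \<open>v \<in> I\<close> of the spaces \<open>lp p (X v)\<close>, for pairwise disjoint sets \<open>X v\<close>:
  a family is encoded as one function on the union, its component at \<open>v\<close> being the restriction
  to \<open>X v\<close>.\<close>

definition lp_fibre_norms ::
    "ennreal \<Rightarrow> 'i set \<Rightarrow> ('i \<Rightarrow> 'a set) \<Rightarrow> ('a \<Rightarrow> complex) \<Rightarrow> 'i \<Rightarrow> complex" where
  "lp_fibre_norms p I X f =
     cut I (\<lambda>v. complex_of_real (vnorm (lp p (X v)) (cut (X v) f)))"

definition lp_sum :: "ennreal \<Rightarrow> 'i set \<Rightarrow> ('i \<Rightarrow> 'a set) \<Rightarrow> ('a \<Rightarrow> complex) cnspace" where
  "lp_sum p I X =
    \<lparr> carr = {f. (\<forall>x. x \<notin> (\<Union>v\<in>I. X v) \<longrightarrow> f x = 0) \<and>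
               (\<forall>v\<in>I. cut (X v) f \<in> carr (lp p (X v))) \<and>
               lp_fibre_norms p I X f \<in> carr (lp p I)},
      vadd = (\<lambda>f g x. f x + g x),
      vscale = (\<lambda>c f x. c * f x),
      vnorm = (\<lambda>f. vnorm (lp p I) (lp_fibre_norms p I X f)) \<rparr>"

section \<open>Groupoids\<close>

text \<open>The units are identified with the identity arrows, so the unit space is a subspace of the
  space of arrows.\<close>

record 'g groupoid =
  gtop :: "'g topology"
  src :: "'g \<Rightarrow> 'g"
  rng :: "'g \<Rightarrow> 'g"
  gmult :: "'g \<Rightarrow> 'g \<Rightarrow> 'g"
  ginv :: "'g \<Rightarrow> 'g"

definition arrows :: "'g groupoid \<Rightarrow> 'g set" where
  "arrows G = topspace (gtop G)"

definition units :: "'g groupoid \<Rightarrow> 'g set" where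
  "units G = src G ` arrows G"

definition unit_space :: "'g groupoid \<Rightarrow> 'g topology" where
  "unit_space G = subtopology (gtop G) (units G)"

definition src_fibre :: "'g groupoid \<Rightarrow> 'g \<Rightarrow> 'g set" where
  "src_fibre G u = {\<gamma> \<in> arrows G. src G \<gamma> = u}"

definition rng_fibre :: "'g groupoid \<Rightarrow> 'g \<Rightarrow> 'g set" where
  "rng_fibre G u = {\<gamma> \<in> arrows G. rng G \<gamma> = u}"

locale topological_groupoid =
  fixes G :: "'g groupoid"
  assumes src_closed: "\<gamma> \<in> arrows G \<Longrightarrow> src G \<gamma> \<in> arrows G"
    and rng_closed: "\<gamma> \<in> arrows G \<Longrightarrow> rng G \<gamma> \<in> arrows G"
    and src_src: "\<gamma> \<in> arrows G \<Longrightarrow> src G (src G \<gamma>) = src G \<gamma>"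
    and rng_src: "\<gamma> \<in> arrows G \<Longrightarrow> rng G (src G \<gamma>) = src G \<gamma>"
    and src_rng: "\<gamma> \<in> arrows G \<Longrightarrow> src G (rng G \<gamma>) = rng G \<gamma>"
    and rng_rng: "\<gamma> \<in> arrows G \<Longrightarrow> rng G (rng G \<gamma>) = rng G \<gamma>"
    and mult_closed: "\<lbrakk>\<gamma> \<in> arrows G; \<eta> \<in> arrows G; src G \<gamma> = rng G \<eta>\<rbrakk>
          \<Longrightarrow> gmult G \<gamma> \<eta> \<in> arrows G"
    and src_mult: "\<lbrakk>\<gamma> \<in> arrows G; \<eta> \<in> arrows G; src G \<gamma> = rng G \<eta>\<rbrakk>
          \<Longrightarrow> src G (gmult G \<gamma> \<eta>) = src G \<eta>"
    and rng_mult: "\<lbrakk>\<gamma> \<in> arrows G; \<eta> \<in> arrows G; src G \<gamma> = rng G \<eta>\<rbrakk>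
          \<Longrightarrow> rng G (gmult G \<gamma> \<eta>) = rng G \<gamma>"
    and mult_assoc: "\<lbrakk>\<gamma> \<in> arrows G; \<eta> \<in> arrows G; \<zeta> \<in> arrows G;
            src G \<gamma> = rng G \<eta>; src G \<eta> = rng G \<zeta>\<rbrakk>
          \<Longrightarrow> gmult G (gmult G \<gamma> \<eta>) \<zeta> = gmult G \<gamma> (gmult G \<eta> \<zeta>)"
    and rng_unit: "\<gamma> \<in> arrows G \<Longrightarrow> gmult G (rng G \<gamma>) \<gamma> = \<gamma>"
    and src_unit: "\<gamma> \<in> arrows G \<Longrightarrow> gmult G \<gamma> (src G \<gamma>) = \<gamma>"
    and inv_closed: "\<gamma> \<in> arrows G \<Longrightarrow> ginv G \<gamma> \<in> arrows G"
    and src_inv: "\<gamma> \<in> arrows G \<Longrightarrow> src G (ginv G \<gamma>) = rng G \<gamma>"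
    and rng_inv: "\<gamma> \<in> arrows G \<Longrightarrow> rng G (ginv G \<gamma>) = src G \<gamma>"
    and inv_right: "\<gamma> \<in> arrows G \<Longrightarrow> gmult G \<gamma> (ginv G \<gamma>) = rng G \<gamma>"
    and inv_left: "\<gamma> \<in> arrows G \<Longrightarrow> gmult G (ginv G \<gamma>) \<gamma> = src G \<gamma>"
    and continuous_src: "continuous_map (gtop G) (gtop G) (src G)"
    and continuous_rng: "continuous_map (gtop G) (gtop G) (rng G)"
    and continuous_inv: "continuous_map (gtop G) (gtop G) (ginv G)"
    and continuous_mult:
      "continuous_map
         (subtopology (prod_topology (gtop G) (gtop G)) {(\<gamma>, \<eta>). src G \<gamma> = rng G \<eta>})
         (gtop G) (\<lambda>(\<gamma>, \<eta>). gmult G \<gamma> \<eta>)"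

locale etale_groupoid = topological_groupoid G for G :: "'g groupoid" +
  assumes etale_src: "local_homeomorphism (gtop G) (unit_space G) (src G)"
    and etale_rng: "local_homeomorphism (gtop G) (unit_space G) (rng G)"

locale lc_etale_groupoid = etale_groupoid G for G :: "'g groupoid" +
  assumes locally_compact: "locally_compact_space (gtop G)"
    and locally_Hausdorff: "locally_Hausdorff_space (gtop G)"
    and units_locally_compact: "locally_compact_space (unit_space G)"
    and units_Hausdorff: "Hausdorff_space (unit_space G)"

section \<open>Groupoid correspondences\<close>

record ('g, 'h, 'z) corr =
  ztop :: "'z topology"
  ranchor :: "'z \<Rightarrow> 'g"
  sanchor :: "'z \<Rightarrow> 'h"
  lact :: "'g \<Rightarrow> 'z \<Rightarrow> 'z"
  ract :: "'z \<Rightarrow> 'h \<Rightarrow> 'z"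

definition left_pairs :: "'g groupoid \<Rightarrow> ('g, 'h, 'z) corr \<Rightarrow> ('g \<times> 'z) topology" where
  "left_pairs G Z =
     subtopology (prod_topology (gtop G) (ztop Z)) {(\<gamma>, z). src G \<gamma> = ranchor Z z}"

definition right_pairs :: "'h groupoid \<Rightarrow> ('g, 'h, 'z) corr \<Rightarrow> ('z \<times> 'h) topology" where
  "right_pairs H Z =
     subtopology (prod_topology (ztop Z) (gtop H)) {(z, h). sanchor Z z = rng H h}"

definition left_action_proper :: "'g groupoid \<Rightarrow> ('g, 'h, 'z) corr \<Rightarrow> bool" where
  "left_action_proper G Z \<longleftrightarrow>
     proper_map (left_pairs G Z) (prod_topology (ztop Z) (ztop Z)) (\<lambda>(\<gamma>, z). (lact Z \<gamma> z, z))"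

definition right_action_proper :: "'h groupoid \<Rightarrow> ('g, 'h, 'z) corr \<Rightarrow> bool" where
  "right_action_proper H Z \<longleftrightarrow>
     proper_map (right_pairs H Z) (prod_topology (ztop Z) (ztop Z)) (\<lambda>(z, h). (ract Z z h, z))"

locale groupoid_correspondence =
  fixes G :: "'g groupoid" and H :: "'h groupoid" and Z :: "('g, 'h, 'z) corr"
  assumes ranchor_continuous: "continuous_map (ztop Z) (unit_space G) (ranchor Z)"
    and lact_closed: "\<lbrakk>\<gamma> \<in> arrows G; z \<in> topspace (ztop Z); src G \<gamma> = ranchor Z z\<rbrakk>
          \<Longrightarrow> lact Z \<gamma> z \<in> topspace (ztop Z)"
    and ranchor_lact: "\<lbrakk>\<gamma> \<in> arrows G; z \<in> topspace (ztop Z); src G \<gamma> = ranchor Z z\<rbrakk>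
          \<Longrightarrow> ranchor Z (lact Z \<gamma> z) = rng G \<gamma>"
    and lact_unit: "z \<in> topspace (ztop Z) \<Longrightarrow> lact Z (ranchor Z z) z = z"
    and lact_mult: "\<lbrakk>\<gamma> \<in> arrows G; \<eta> \<in> arrows G; z \<in> topspace (ztop Z);
            src G \<gamma> = rng G \<eta>; src G \<eta> = ranchor Z z\<rbrakk>
          \<Longrightarrow> lact Z (gmult G \<gamma> \<eta>) z = lact Z \<gamma> (lact Z \<eta> z)"
    and lact_continuous: "continuous_map (left_pairs G Z) (ztop Z) (\<lambda>(\<gamma>, z). lact Z \<gamma> z)"
    and sanchor_local_homeo: "local_homeomorphism (ztop Z) (unit_space H) (sanchor Z)"
    and ract_closed: "\<lbrakk>z \<in> topspace (ztop Z); h \<in> arrows H; sanchor Z z = rng H h\<rbrakk>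
          \<Longrightarrow> ract Z z h \<in> topspace (ztop Z)"
    and sanchor_ract: "\<lbrakk>z \<in> topspace (ztop Z); h \<in> arrows H; sanchor Z z = rng H h\<rbrakk>
          \<Longrightarrow> sanchor Z (ract Z z h) = src H h"
    and ract_unit: "z \<in> topspace (ztop Z) \<Longrightarrow> ract Z z (sanchor Z z) = z"
    and ract_mult: "\<lbrakk>z \<in> topspace (ztop Z); h \<in> arrows H; k \<in> arrows H;
            sanchor Z z = rng H h; src H h = rng H k\<rbrakk>
          \<Longrightarrow> ract Z z (gmult H h k) = ract Z (ract Z z h) k"
    and ract_continuous: "continuous_map (right_pairs H Z) (ztop Z) (\<lambda>(z, h). ract Z z h)"
    and ract_free: "\<lbrakk>z \<in> topspace (ztop Z); h \<in> arrows H; sanchor Z z = rng H h;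
            ract Z z h = z\<rbrakk> \<Longrightarrow> h = sanchor Z z"
    and ract_proper: "right_action_proper H Z"
    and sanchor_lact: "\<lbrakk>\<gamma> \<in> arrows G; z \<in> topspace (ztop Z); src G \<gamma> = ranchor Z z\<rbrakk>
          \<Longrightarrow> sanchor Z (lact Z \<gamma> z) = sanchor Z z"
    and ranchor_ract: "\<lbrakk>z \<in> topspace (ztop Z); h \<in> arrows H; sanchor Z z = rng H h\<rbrakk>
          \<Longrightarrow> ranchor Z (ract Z z h) = ranchor Z z"
    and actions_commute: "\<lbrakk>\<gamma> \<in> arrows G; z \<in> topspace (ztop Z); h \<in> arrows H;
            src G \<gamma> = ranchor Z z; sanchor Z z = rng H h\<rbrakk>
          \<Longrightarrow> ract Z (lact Z \<gamma> z) h = lact Z \<gamma> (ract Z z h)"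

section \<open>The reduced \<open>p\<close>-operator algebra of an etale groupoid\<close>

text \<open>All sums below have only finitely many nonzero terms when the functions \<open>f\<close>, \<open>a\<close>, \<open>\<phi>\<close>,
  \<open>\<psi>\<close> lie in the respective spaces \<open>CC\<close>.\<close>

definition conv :: "'g groupoid \<Rightarrow> ('g \<Rightarrow> complex) \<Rightarrow> ('g \<Rightarrow> complex) \<Rightarrow> 'g \<Rightarrow> complex" where
  "conv G f g = cut (arrows G)
     (\<lambda>\<gamma>. \<Sum>\<^sub>\<infinity>\<eta>\<in>rng_fibre G (rng G \<gamma>). f \<eta> * g (gmult G (ginv G \<eta>) \<gamma>))"

definition lreg :: "ennreal \<Rightarrow> 'g groupoid \<Rightarrow> 'g \<Rightarrow> ('g \<Rightarrow> complex)
    \<Rightarrow> ('g \<Rightarrow> complex) \<Rightarrow> ('g \<Rightarrow> complex)" where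
  "lreg p G u f = (\<lambda>\<xi>\<in>carr (lp p (src_fibre G u)). cut (src_fibre G u)
     (\<lambda>\<gamma>. \<Sum>\<^sub>\<infinity>\<eta>\<in>rng_fibre G (rng G \<gamma>). f \<eta> * \<xi> (gmult G (ginv G \<eta>) \<gamma>)))"

text \<open>The algebra \<open>CC (gtop G)\<close> with its reduced norm; the inserted \<open>0\<close> only matters for the
  empty groupoid.\<close>

definition CC_alg :: "ennreal \<Rightarrow> 'g groupoid \<Rightarrow> ('g \<Rightarrow> complex) cnalg" where
  "CC_alg p G =
    \<lparr> carr = CC (gtop G),
      vadd = (\<lambda>f g x. f x + g x),
      vscale = (\<lambda>c f x. c * f x),
      vnorm = (\<lambda>f. Sup (insert 0
         ((\<lambda>u. vnorm (bops (lp p (src_fibre G u)) (lp p (src_fibre G u))) (lreg p G u f))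
            ` units G))),
      amult = conv G \<rparr>"

definition Fred :: "ennreal \<Rightarrow> 'g groupoid \<Rightarrow> (nat \<Rightarrow> 'g \<Rightarrow> complex) set cnalg" where
  "Fred p G = completion (CC_alg p G)"

definition Fred_embed ::
    "ennreal \<Rightarrow> 'g groupoid \<Rightarrow> ('g \<Rightarrow> complex) \<Rightarrow> (nat \<Rightarrow> 'g \<Rightarrow> complex) set" where
  "Fred_embed p G = completion_embed (CC_alg p G)"

definition EH :: "ennreal \<Rightarrow> 'h groupoid \<Rightarrow> ('h \<Rightarrow> complex) cnspace" where
  "EH p H = lp_sum p (units H) (src_fibre H)"

text \<open>The direct sum of the operators \<open>lreg p H v f\<close> over all units \<open>v\<close>.\<close>

definition lreg_sum :: "ennreal \<Rightarrow> 'h groupoid \<Rightarrow> ('h \<Rightarrow> complex)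
    \<Rightarrow> ('h \<Rightarrow> complex) \<Rightarrow> ('h \<Rightarrow> complex)" where
  "lreg_sum p H f = (\<lambda>\<xi>\<in>carr (EH p H). cut (arrows H)
     (\<lambda>h. lreg p H (src H h) f (cut (src_fibre H (src H h)) \<xi>) h))"

text \<open>The extension of \<open>lreg_sum\<close> to the completion; it is isometric.\<close>

definition Fred_rep :: "ennreal \<Rightarrow> 'h groupoid \<Rightarrow> (nat \<Rightarrow> 'h \<Rightarrow> complex) set
    \<Rightarrow> ('h \<Rightarrow> complex) \<Rightarrow> ('h \<Rightarrow> complex)" where
  "Fred_rep p H b = (THE L. L \<in> carr (bops (EH p H) (EH p H)) \<and>
     (\<forall>f\<in>b. (\<lambda>n. vdist (bops (EH p H) (EH p H)) (lreg_sum p H (f n)) L) \<longlonglongrightarrow> 0))"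

section \<open>Banach pairs\<close>

record ('b, 'x, 'y) bpair =
  lmod :: "'x cnspace"
  rmod :: "'y cnspace"
  lmodact :: "'b \<Rightarrow> 'x \<Rightarrow> 'x"
  rmodact :: "'y \<Rightarrow> 'b \<Rightarrow> 'y"
  pairing :: "'x \<Rightarrow> 'y \<Rightarrow> 'b"

definition pair_ops ::
    "'b cnalg \<Rightarrow> ('b, 'x, 'y) bpair \<Rightarrow> (('x \<Rightarrow> 'x) \<times> ('y \<Rightarrow> 'y)) cnalg" where
  "pair_ops B P =
    (let X = lmod P; Y = rmod P; LX = bops X X; LY = bops Y Y in
    \<lparr> carr = {(Tl, Tr). Tl \<in> carr LX \<and> Tr \<in> carr LY \<and>
        (\<forall>b\<in>carr B. \<forall>x\<in>carr X. Tl (lmodact P b x) = lmodact P b (Tl x)) \<and>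
        (\<forall>b\<in>carr B. \<forall>y\<in>carr Y. Tr (rmodact P y b) = rmodact P (Tr y) b) \<and>
        (\<forall>x\<in>carr X. \<forall>y\<in>carr Y. pairing P (Tl x) y = pairing P x (Tr y))},
      vadd = (\<lambda>S T. (vadd LX (fst S) (fst T), vadd LY (snd S) (snd T))),
      vscale = (\<lambda>c T. (vscale LX c (fst T), vscale LY c (snd T))),
      vnorm = (\<lambda>T. max (vnorm LX (fst T)) (vnorm LY (snd T))),
      amult = (\<lambda>T S. (compose (carr X) (fst S) (fst T), compose (carr Y) (snd T) (snd S))) \<rparr>)"

section \<open>The Banach pair of a correspondence\<close>

definition zfibre :: "('g, 'h, 'z) corr \<Rightarrow> 'h \<Rightarrow> 'z set" where
  "zfibre Z v = {z \<in> topspace (ztop Z). sanchor Z z = v}"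

definition EZ :: "ennreal \<Rightarrow> 'h groupoid \<Rightarrow> ('g, 'h, 'z) corr \<Rightarrow> ('z \<Rightarrow> complex) cnspace" where
  "EZ p H Z = lp_sum p (units H) (zfibre Z)"

definition Top :: "ennreal \<Rightarrow> 'h groupoid \<Rightarrow> ('g, 'h, 'z) corr \<Rightarrow> ('z \<Rightarrow> complex)
    \<Rightarrow> ('h \<Rightarrow> complex) \<Rightarrow> ('z \<Rightarrow> complex)" where
  "Top p H Z \<phi> = (\<lambda>\<xi>\<in>carr (EH p H). cut (topspace (ztop Z))
     (\<lambda>z. \<Sum>\<^sub>\<infinity>h\<in>src_fibre H (sanchor Z z). \<phi> (ract Z z (ginv H h)) * \<xi> h))"

text \<open>The homeomorphic copy \<open>Z\<^sup>o\<^sup>p\<close> of \<open>Z\<close> is taken to be \<open>Z\<close> itself, with \<open>z\<close> in the role of its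
  barred counterpart; so \<open>\<psi>\<close> ranges over \<open>CC (ztop Z)\<close> as well.\<close>

definition Sop :: "ennreal \<Rightarrow> 'h groupoid \<Rightarrow> ('g, 'h, 'z) corr \<Rightarrow> ('z \<Rightarrow> complex)
    \<Rightarrow> ('z \<Rightarrow> complex) \<Rightarrow> ('h \<Rightarrow> complex)" where
  "Sop p H Z \<psi> = (\<lambda>\<zeta>\<in>carr (EZ p H Z). cut (arrows H)
     (\<lambda>h. \<Sum>\<^sub>\<infinity>z\<in>zfibre Z (src H h). \<psi> (ract Z z (ginv H h)) * \<zeta> z))"

definition YZ :: "ennreal \<Rightarrow> 'h groupoid \<Rightarrow> ('g, 'h, 'z) corr
    \<Rightarrow> (('h \<Rightarrow> complex) \<Rightarrow> ('z \<Rightarrow> complex)) cnspace" where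
  "YZ p H Z = (bops (EH p H) (EZ p H Z))
     \<lparr> carr := vclosure (bops (EH p H) (EZ p H Z)) (Top p H Z ` CC (ztop Z)) \<rparr>"

definition XZ :: "ennreal \<Rightarrow> 'h groupoid \<Rightarrow> ('g, 'h, 'z) corr
    \<Rightarrow> (('z \<Rightarrow> complex) \<Rightarrow> ('h \<Rightarrow> complex)) cnspace" where
  "XZ p H Z = (bops (EZ p H Z) (EH p H))
     \<lparr> carr := vclosure (bops (EZ p H Z) (EH p H)) (Sop p H Z ` CC (ztop Z)) \<rparr>"

text \<open>The algebra \<open>Fred p H\<close> acts through the isometric representation \<open>Fred_rep p H\<close>, and the
  pairing of \<open>S\<close> and \<open>T\<close> is the element of \<open>Fred p H\<close> represented by \<open>S \<circ> T\<close>.\<close>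

definition corr_pair :: "ennreal \<Rightarrow> 'h groupoid \<Rightarrow> ('g, 'h, 'z) corr
    \<Rightarrow> ((nat \<Rightarrow> 'h \<Rightarrow> complex) set,
        ('z \<Rightarrow> complex) \<Rightarrow> ('h \<Rightarrow> complex),
        ('h \<Rightarrow> complex) \<Rightarrow> ('z \<Rightarrow> complex)) bpair" where
  "corr_pair p H Z =
    \<lparr> lmod = XZ p H Z,
      rmod = YZ p H Z,
      lmodact = (\<lambda>b S. compose (carr (EZ p H Z)) (Fred_rep p H b) S),
      rmodact = (\<lambda>T b. compose (carr (EH p H)) T (Fred_rep p H b)),
      pairing = (\<lambda>S T. THE b. b \<in> carr (Fred p H) \<and>
                    Fred_rep p H b = compose (carr (EH p H)) S T) \<rparr>"

section \<open>The algebraic action\<close>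

definition act_left :: "'g groupoid \<Rightarrow> ('g, 'h, 'z) corr
    \<Rightarrow> ('g \<Rightarrow> complex) \<Rightarrow> ('z \<Rightarrow> complex) \<Rightarrow> ('z \<Rightarrow> complex)" where
  "act_left G Z a \<phi> = cut (topspace (ztop Z))
     (\<lambda>z. \<Sum>\<^sub>\<infinity>\<gamma>\<in>rng_fibre G (ranchor Z z). a \<gamma> * \<phi> (lact Z (ginv G \<gamma>) z))"

definition act_right :: "'g groupoid \<Rightarrow> ('g, 'h, 'z) corr
    \<Rightarrow> ('z \<Rightarrow> complex) \<Rightarrow> ('g \<Rightarrow> complex) \<Rightarrow> ('z \<Rightarrow> complex)" where
  "act_right G Z \<psi> a = cut (topspace (ztop Z))
     (\<lambda>z. \<Sum>\<^sub>\<infinity>\<gamma>\<in>rng_fibre G (ranchor Z z). \<psi> (lact Z (ginv G \<gamma>) z) * a (ginv G \<gamma>))"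

definition action_extends ::
    "ennreal \<Rightarrow> 'g groupoid \<Rightarrow> 'h groupoid \<Rightarrow> ('g, 'h, 'z) corr \<Rightarrow> bool" where
  "action_extends p G H Z \<longleftrightarrow>
     (\<exists>\<pi>. continuous_alg_hom (Fred p G) (pair_ops (Fred p H) (corr_pair p H Z)) \<pi> \<and>
        (\<forall>a\<in>CC (gtop G).
           (\<forall>\<psi>\<in>CC (ztop Z). fst (\<pi> (Fred_embed p G a)) (Sop p H Z \<psi>) = Sop p H Z (act_right G Z \<psi> a)) \<and>
           (\<forall>\<phi>\<in>CC (ztop Z). snd (\<pi> (Fred_embed p G a)) (Top p H Z \<phi>) = Top p H Z (act_left G Z a \<phi>))))"

end

theory Submission
  imports Defs
begin

text \<open>
The whole statement comes down to one estimate. For \<open>a\<close> in \<open>CC (gtop G)\<close> let \<open>\<Pi>(a)\<close> be the operator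
\<open>(\<Pi>(a) \<zeta>)(z) = \<Sum> a(\<gamma>) \<zeta>(\<gamma>\<^sup>-\<^sup>1 z)\<close>, the sum being over the arrows \<open>\<gamma>\<close> with range \<open>r(z)\<close>, on the
\<open>p\<close>-summable functions on \<open>Z\<close>. Substituting in finite sums gives
\<open>\<Pi>(a) T\<^sub>\<phi> = T\<^sub>a\<^sub>\<phi>\<close>, \<open>S\<^sub>\<psi> \<Pi>(a) = S\<^sub>\<psi>\<^sub>a\<close> and \<open>\<Pi>(a * b) = \<Pi>(a) \<Pi>(b)\<close>. So once
\<open>\<parallel>\<Pi>(a)\<parallel> \<le> \<parallel>a\<parallel>\<close> holds for the reduced norm, \<open>\<Pi>\<close> extends to the completion, and
\<open>P \<mapsto> (x \<mapsto> x \<Pi>(P), y \<mapsto> \<Pi>(P) y)\<close> is the required homomorphism. Compatibility with the pairing and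
with the module structures is the associativity of composition.

The estimate (\<open>convolve_bound\<close>) has a different reason in each case.

  \<^item> For \<open>p = 1\<close> an operator is bounded by its largest column sum. The column of \<open>\<Pi>(a)\<close> at \<open>w\<close> is a
    quotient of the family of the \<open>a(\<gamma>)\<close> with \<open>s(\<gamma>) = r(w)\<close>, which is what the regular
    representation makes of the point mass at the unit \<open>r(w)\<close>.
  \<^item> For \<open>p = \<infinity>\<close> it is bounded by its largest row sum. The regular representation attains the
    sum of the \<open>\<bar>a(\<gamma>)\<bar>\<close> over a range fibre on a function of conjugate phases.
  \<^item> For \<open>1 < p < \<infinity>\<close> a proper action has finite stabilizers. If \<open>w\<close> has a stabilizer with \<open>n\<close>
    elements, then \<open>\<gamma> \<mapsto> \<gamma> w\<close> is an \<open>n\<close>-to-one map from the source fibre at \<open>r(w)\<close> onto the orbit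
    of \<open>w\<close>. Pulling back along it multiplies \<open>p\<close>-norms by \<open>n\<close> to the power \<open>1/p\<close> and intertwines \<open>\<Pi>(a)\<close> with
    the regular representation. So \<open>\<Pi>(a)\<close> is contractive on each orbit, hence on \<open>Z\<close>.

Three things have to be supplied. First, \<open>\<Pi>(a)\<close> must preserve the dense subspaces, that is, \<open>a \<cdot> \<phi>\<close> must
again lie in \<open>CC (ztop Z)\<close> (\<open>CC_convolve\<close>). A partition of unity reduces this to functions \<open>a\<close> supported in
an open bisection, which acts by a homeomorphism between open subsets of \<open>Z\<close>. Second, \<open>T\<^sub>\<phi>\<close>, \<open>S\<^sub>\<psi>\<close> and the
regular representation must be bounded; their matrices have uniformly few nonzero entries in each row and column
(\<open>kernel_lp_le\<close>, \<open>orbit_kernel_bounded\<close>). Third, the modules must be stable under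
the completed algebra of \<open>H\<close>, which uses \<open>T\<^sub>\<phi> \<lambda>(f)\<close> and \<open>\<lambda>(f) S\<^sub>\<psi>\<close> as well as the
completeness of the spaces of summable functions.

Everything is done for one notion, a groupoid acting from the left on a space (\<open>left_action\<close>). It is
used for \<open>G\<close> acting on \<open>Z\<close>, for \<open>H\<close> acting on \<open>Z\<close> by \<open>h z = z h\<^sup>-\<^sup>1\<close>, and for \<open>G\<close> and \<open>H\<close> acting on
themselves; in the last case convolution is the product of the algebra.
\<close>

section \<open>Bounded operators between normed spaces on carrier sets\<close>

text \<open>Zero is not part of the signature; it is represented by \<open>vscale V 0 x\<close> for any \<open>x\<close>, which is why
\<open>zero_unique\<close> is an axiom.\<close>

locale cnormed =
  fixes V :: "('a, 'm) cnspace_scheme"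
  assumes nonempty: "carr V \<noteq> {}"
    and add_closed: "\<lbrakk>x \<in> carr V; y \<in> carr V\<rbrakk> \<Longrightarrow> vadd V x y \<in> carr V"
    and scale_closed: "x \<in> carr V \<Longrightarrow> vscale V c x \<in> carr V"
    and add_commute: "\<lbrakk>x \<in> carr V; y \<in> carr V\<rbrakk> \<Longrightarrow> vadd V x y = vadd V y x"
    and add_assoc: "\<lbrakk>x \<in> carr V; y \<in> carr V; z \<in> carr V\<rbrakk>
          \<Longrightarrow> vadd V (vadd V x y) z = vadd V x (vadd V y z)"
    and scale_add: "\<lbrakk>x \<in> carr V; y \<in> carr V\<rbrakk>
          \<Longrightarrow> vscale V c (vadd V x y) = vadd V (vscale V c x) (vscale V c y)"
    and add_scale: "x \<in> carr V \<Longrightarrow> vscale V (c + d) x = vadd V (vscale V c x) (vscale V d x)"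
    and scale_scale: "x \<in> carr V \<Longrightarrow> vscale V c (vscale V d x) = vscale V (c * d) x"
    and scale_one: "x \<in> carr V \<Longrightarrow> vscale V 1 x = x"
    and zero_unique: "\<lbrakk>x \<in> carr V; y \<in> carr V\<rbrakk> \<Longrightarrow> vscale V 0 x = vscale V 0 y"
    and norm_scale: "x \<in> carr V \<Longrightarrow> vnorm V (vscale V c x) = cmod c * vnorm V x"
    and norm_triangle: "\<lbrakk>x \<in> carr V; y \<in> carr V\<rbrakk>
          \<Longrightarrow> vnorm V (vadd V x y) \<le> vnorm V x + vnorm V y"
    and norm_zero_imp: "\<lbrakk>x \<in> carr V; vnorm V x = 0\<rbrakk> \<Longrightarrow> x = vscale V 0 x"
begin

lemma add_zero: "\<lbrakk>x \<in> carr V; y \<in> carr V\<rbrakk> \<Longrightarrow> vadd V x (vscale V 0 y) = x"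
  using add_scale[of x 1 0] by (simp add: scale_one zero_unique[of y x])

lemma zero_add: "\<lbrakk>x \<in> carr V; y \<in> carr V\<rbrakk> \<Longrightarrow> vadd V (vscale V 0 y) x = x"
  by (simp add: add_commute scale_closed add_zero)

lemma diff_self: "x \<in> carr V \<Longrightarrow> vadd V x (vscale V (-1) x) = vscale V 0 x"
  using add_scale[of x 1 "-1"] by (simp add: scale_one)

lemma norm_zero: "x \<in> carr V \<Longrightarrow> vnorm V (vscale V 0 x) = 0"
  by (simp add: norm_scale)

lemma norm_ge0: "x \<in> carr V \<Longrightarrow> 0 \<le> vnorm V x"
  using norm_triangle[of x "vscale V (-1) x"]
  by (simp add: diff_self norm_scale scale_closed)

lemma add_left_commute:
  "\<lbrakk>x \<in> carr V; y \<in> carr V; z \<in> carr V\<rbrakk> \<Longrightarrow> vadd V x (vadd V y z) = vadd V y (vadd V x z)"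
  by (metis add_assoc add_commute)

lemma diff_telescope:
  assumes "x \<in> carr V" "y \<in> carr V" "z \<in> carr V"
  shows "vadd V (vadd V x (vscale V (-1) y)) (vadd V y (vscale V (-1) z))
       = vadd V x (vscale V (-1) z)"
proof -
  have "vadd V (vadd V x (vscale V (-1) y)) (vadd V y (vscale V (-1) z))
      = vadd V x (vadd V (vadd V y (vscale V (-1) y)) (vscale V (-1) z))"
    using assms by (simp add: add_assoc add_closed scale_closed add_left_commute)
  then show ?thesis using assms by (simp add: diff_self zero_add scale_closed)
qed

lemma diff_add:
  assumes "x \<in> carr V" "y \<in> carr V" "x' \<in> carr V" "y' \<in> carr V"
  shows "vadd V (vadd V x x') (vscale V (-1) (vadd V y y'))
     = vadd V (vadd V x (vscale V (-1) y)) (vadd V x' (vscale V (-1) y'))"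
  using assms by (simp add: add_assoc add_closed scale_closed add_left_commute scale_add)

lemma dist_ge0: "\<lbrakk>x \<in> carr V; y \<in> carr V\<rbrakk> \<Longrightarrow> 0 \<le> vdist V x y"
  by (simp add: vdist_def norm_ge0 add_closed scale_closed)

lemma dist_self: "x \<in> carr V \<Longrightarrow> vdist V x x = 0"
  by (simp add: vdist_def diff_self norm_zero)

lemma dist_triangle:
  "\<lbrakk>x \<in> carr V; y \<in> carr V; z \<in> carr V\<rbrakk> \<Longrightarrow> vdist V x z \<le> vdist V x y + vdist V y z"
  unfolding vdist_def
  using norm_triangle[of "vadd V x (vscale V (-1) y)" "vadd V y (vscale V (-1) z)"]
  by (simp add: diff_telescope add_closed scale_closed)

lemma dist_commute: "\<lbrakk>x \<in> carr V; y \<in> carr V\<rbrakk> \<Longrightarrow> vdist V x y = vdist V y x"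
proof -
  assume a: "x \<in> carr V" "y \<in> carr V"
  have "vscale V (-1) (vadd V x (vscale V (-1) y)) = vadd V y (vscale V (-1) x)"
    using a by (simp add: scale_add scale_closed scale_scale scale_one add_commute)
  then show ?thesis
    unfolding vdist_def using norm_scale[of "vadd V x (vscale V (-1) y)" "-1"] a
    by (simp add: add_closed scale_closed)
qed

lemma dist_eq_0:
  assumes "x \<in> carr V" "y \<in> carr V" "vdist V x y = 0" shows "x = y"
proof -
  let ?d = "vadd V x (vscale V (-1) y)"
  have d: "?d \<in> carr V" using assms by (simp add: add_closed scale_closed)
  have "?d = vscale V 0 ?d" using assms(3) d norm_zero_imp by (simp add: vdist_def)
  then have "vadd V ?d y = y" using zero_add[OF assms(2) d] by simp
  moreover have "vadd V ?d y = vadd V x (vadd V y (vscale V (-1) y))"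
    using assms by (simp add: add_assoc scale_closed add_commute)
  ultimately show ?thesis using assms by (simp add: diff_self add_zero)
qed

lemma dist_add:
  "\<lbrakk>x \<in> carr V; y \<in> carr V; x' \<in> carr V; y' \<in> carr V\<rbrakk>
    \<Longrightarrow> vdist V (vadd V x x') (vadd V y y') \<le> vdist V x y + vdist V x' y'"
  unfolding vdist_def by (simp add: diff_add norm_triangle add_closed scale_closed)

lemma dist_scale:
  "\<lbrakk>x \<in> carr V; y \<in> carr V\<rbrakk> \<Longrightarrow> vdist V (vscale V c x) (vscale V c y) = cmod c * vdist V x y"
  unfolding vdist_def
  by (simp add: norm_scale[symmetric] scale_add add_closed scale_closed scale_scale mult.commute)

lemma norm_diff_le:
  assumes "x \<in> carr V" "y \<in> carr V" shows "\<bar>vnorm V x - vnorm V y\<bar> \<le> vdist V x y"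
proof -
  have *: "vnorm V u - vnorm V v \<le> vdist V u v" if "u \<in> carr V" "v \<in> carr V" for u v
  proof -
    have "vadd V (vadd V u (vscale V (-1) v)) v = vadd V u (vadd V v (vscale V (-1) v))"
      using that by (simp add: add_assoc scale_closed add_commute)
    also have "\<dots> = u" using that by (simp add: diff_self add_zero)
    finally show ?thesis
      using norm_triangle[of "vadd V u (vscale V (-1) v)" v] that
      by (simp add: vdist_def add_closed scale_closed)
  qed
  show ?thesis using *[of x y] *[of y x] assms by (simp add: dist_commute abs_le_iff)
qed

end

definition vtends :: "('a, 'm) cnspace_scheme \<Rightarrow> (nat \<Rightarrow> 'a) \<Rightarrow> 'a \<Rightarrow> bool" where
  "vtends V f x \<longleftrightarrow> (\<lambda>n. vdist V (f n) x) \<longlonglongrightarrow> 0"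

definition vcomplete :: "('a, 'm) cnspace_scheme \<Rightarrow> bool" where
  "vcomplete V \<longleftrightarrow> (\<forall>f\<in>cauchy_seqs V. \<exists>x\<in>carr V. vtends V f x)"

lemma cnormed_transfer:
  assumes "cnormed V" and c: "carr W = carr V" and a: "vadd W = vadd V" and s: "vscale W = vscale V"
    and n: "\<And>x. x \<in> carr V \<Longrightarrow> vnorm W x = vnorm V x"
  shows "cnormed W"
proof -
  interpret V: cnormed V by fact
  show ?thesis
    by unfold_locales
      (auto simp: c a s n V.nonempty V.add_closed V.scale_closed V.add_assoc V.scale_add
        V.add_scale V.scale_scale V.scale_one V.norm_scale V.norm_triangle
        intro: V.zero_unique V.norm_zero_imp V.add_commute)
qed

lemma vcomplete_transfer:
  assumes "cnormed V" and c: "carr W = carr V" and a: "vadd W = vadd V" and s: "vscale W = vscale V"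
    and n: "\<And>x. x \<in> carr V \<Longrightarrow> vnorm W x = vnorm V x" and "vcomplete V"
  shows "vcomplete W"
proof -
  interpret V: cnormed V by fact
  have d: "vdist W x y = vdist V x y" if "x \<in> carr V" "y \<in> carr V" for x y
    using that by (simp add: vdist_def a s n V.add_closed V.scale_closed)
  show ?thesis unfolding vcomplete_def
  proof
    fix f assume f: "f \<in> cauchy_seqs W"
    then have fV: "f n \<in> carr V" for n by (auto simp: cauchy_seqs_def c)
    then have "f \<in> cauchy_seqs V" using f by (auto simp: cauchy_seqs_def d)
    then obtain x where "x \<in> carr V" "vtends V f x" using assms(6) by (auto simp: vcomplete_def)
    then show "\<exists>x\<in>carr W. vtends W f x" using fV by (auto simp: c vtends_def d)
  qed
qed

context cnormed
begin

lemma vtends_unique: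
  assumes "\<And>n. f n \<in> carr V" "x \<in> carr V" "y \<in> carr V" "vtends V f x" "vtends V f y"
  shows "x = y"
proof -
  have "(\<lambda>n. vdist V (f n) x + vdist V (f n) y) \<longlonglongrightarrow> 0 + 0"
    using assms(4,5) unfolding vtends_def by (intro tendsto_add)
  moreover have "vdist V x y \<le> vdist V (f n) x + vdist V (f n) y" for n
    using dist_triangle[of x "f n" y] assms(1-3) by (simp add: dist_commute)
  ultimately have "vdist V x y \<le> 0"
    by (intro LIMSEQ_le_const[where X = "\<lambda>n. vdist V (f n) x + vdist V (f n) y"]) auto
  then show ?thesis using dist_eq_0 dist_ge0 assms(2,3) by (meson antisym)
qed

lemma vtends_norm:
  assumes "\<And>n. f n \<in> carr V" "x \<in> carr V" "vtends V f x"
  shows "(\<lambda>n. vnorm V (f n)) \<longlonglongrightarrow> vnorm V x"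
proof -
  have "(\<lambda>n. vnorm V (f n) - vnorm V x) \<longlonglongrightarrow> 0"
    by (rule Lim_null_comparison[OF _ assms(3)[unfolded vtends_def]])
      (use assms norm_diff_le in auto)
  then show ?thesis by (simp add: LIM_zero_iff)
qed

lemma vtends_add:
  assumes "\<And>n. f n \<in> carr V" "x \<in> carr V" "vtends V f x" "\<And>n. g n \<in> carr V" "y \<in> carr V" "vtends V g y"
  shows "vtends V (\<lambda>n. vadd V (f n) (g n)) (vadd V x y)"
proof -
  have "(\<lambda>n. vdist V (f n) x + vdist V (g n) y) \<longlonglongrightarrow> 0"
    using tendsto_add[OF assms(3,6)[unfolded vtends_def]] by simp
  then show ?thesis unfolding vtends_def
    by (rule Lim_null_comparison[rotated]) (use assms dist_add in \<open>simp add: dist_ge0 add_closed\<close>)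
qed

lemma vtends_scale:
  assumes "\<And>n. f n \<in> carr V" "x \<in> carr V" "vtends V f x"
  shows "vtends V (\<lambda>n. vscale V c (f n)) (vscale V c x)"
  using tendsto_mult_left[OF assms(3)[unfolded vtends_def], of "cmod c"] assms(1,2)
  by (simp add: vtends_def dist_scale)

lemma vtends_close:
  assumes "\<And>n. f n \<in> carr V" "\<And>n. g n \<in> carr V" "x \<in> carr V" "vtends V f x" 
    "(\<lambda>n. vdist V (f n) (g n)) \<longlonglongrightarrow> 0"
  shows "vtends V g x"
proof -
  have "(\<lambda>n. vdist V (f n) (g n) + vdist V (f n) x) \<longlonglongrightarrow> 0"
    using tendsto_add[OF assms(5) assms(4)[unfolded vtends_def]] by simp
  then show ?thesis unfolding vtends_def
  proof (rule Lim_null_comparison[rotated])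
    show "\<forall>\<^sub>F n in sequentially. norm (vdist V (g n) x) \<le> vdist V (f n) (g n) + vdist V (f n) x"
      using dist_triangle[of "g _" "f _" x] assms(1-3) by (simp add: dist_ge0 dist_commute[of "g _" "f _"])
  qed
qed

lemma vclosure_superset: "S \<subseteq> carr V \<Longrightarrow> S \<subseteq> vclosure V S"
  by (auto simp: vclosure_def intro!: bexI[rotated] simp: dist_self subset_iff)

lemma vclosure_seq:
  assumes "x \<in> vclosure V S" "S \<subseteq> carr V"
  obtains f where "\<And>n. f n \<in> S" "vtends V f x" "x \<in> carr V"
proof -
  have "\<forall>n::nat. \<exists>y\<in>S. vdist V x y < inverse (real (Suc n))"
    using assms(1) unfolding vclosure_def by simp
  then obtain f where f: "\<And>n. f n \<in> S" "\<And>n::nat. vdist V x (f n) < inverse (real (Suc n))" by metis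
  have x: "x \<in> carr V" using assms by (simp add: vclosure_def)
  have "vtends V f x"
    unfolding vtends_def
    by (rule Lim_null_comparison[OF _ LIMSEQ_inverse_real_of_nat])
      (use f x assms(2) in \<open>auto simp: dist_ge0 dist_commute[of _ x] subset_iff less_imp_le\<close>)
  then show ?thesis using f x that by blast
qed

lemma vclosureI_seq:
  assumes "\<And>n. f n \<in> vclosure V S" "x \<in> carr V" "vtends V f x" "S \<subseteq> carr V"
  shows "x \<in> vclosure V S"
  unfolding vclosure_def
proof (safe; (use assms in blast)?)
  fix e :: real assume "e > 0"
  then obtain n where n: "vdist V (f n) x < e / 2"
    using assms(3) order_tendstoD(2)[of _ 0 sequentially "e/2"]
    by (auto simp: vtends_def eventually_sequentially)
  have fn: "f n \<in> carr V" using assms(1) by (simp add: vclosure_def)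
  obtain y where y: "y \<in> S" "vdist V (f n) y < e / 2"
    using assms(1)[of n] \<open>e > 0\<close> unfolding vclosure_def by (auto dest!: spec[of _ "e/2"])
  then have "vdist V x y < e"
    using dist_triangle[of x "f n" y] n y assms(2,4) fn by (auto simp: dist_commute[of x])
  then show "\<exists>y\<in>S. vdist V x y < e" using y by blast
qed

lemma vclosure_add:
  assumes "S \<subseteq> carr V" "\<And>x y. \<lbrakk>x \<in> S; y \<in> S\<rbrakk> \<Longrightarrow> vadd V x y \<in> S" "x \<in> vclosure V S" "y \<in> vclosure V S"
  shows "vadd V x y \<in> vclosure V S"
proof -
  obtain f where f: "\<And>n. f n \<in> S" "vtends V f x" "x \<in> carr V" using vclosure_seq[OF assms(3,1)] by blast
  obtain g where g: "\<And>n. g n \<in> S" "vtends V g y" "y \<in> carr V" using vclosure_seq[OF assms(4,1)] by blast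
  show ?thesis
  proof (rule vclosureI_seq)
    show "vtends V (\<lambda>n. vadd V (f n) (g n)) (vadd V x y)"
      by (rule vtends_add) (use f g assms(1) in auto)
    show "vadd V (f n) (g n) \<in> vclosure V S" for n
      using assms(2) f g vclosure_superset[OF assms(1)] by blast
  qed (use f g assms(1) add_closed in auto)
qed

lemma vclosure_scale:
  assumes "S \<subseteq> carr V" "\<And>x. x \<in> S \<Longrightarrow> vscale V c x \<in> S" "x \<in> vclosure V S"
  shows "vscale V c x \<in> vclosure V S"
proof -
  obtain f where f: "\<And>n. f n \<in> S" "vtends V f x" "x \<in> carr V" using vclosure_seq[OF assms(3,1)] by blast
  show ?thesis
  proof (rule vclosureI_seq)
    show "vtends V (\<lambda>n. vscale V c (f n)) (vscale V c x)"
      by (rule vtends_scale) (use f assms(1) in auto)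
    show "vscale V c (f n) \<in> vclosure V S" for n
      using assms(2) f vclosure_superset[OF assms(1)] by blast
  qed (use f assms(1) scale_closed in auto)
qed

end

lemma bops_sel [simp]:
  "vadd (bops V W) = (\<lambda>S T. \<lambda>x\<in>carr V. vadd W (S x) (T x))"
  "vscale (bops V W) = (\<lambda>c T. \<lambda>x\<in>carr V. vscale W c (T x))"
  by (simp_all add: bops_def)

lemma bopsI:
  assumes "T \<in> extensional (carr V)" "\<And>x. x \<in> carr V \<Longrightarrow> T x \<in> carr W"
    "\<And>x y. \<lbrakk>x \<in> carr V; y \<in> carr V\<rbrakk> \<Longrightarrow> T (vadd V x y) = vadd W (T x) (T y)"
    "\<And>c x. x \<in> carr V \<Longrightarrow> T (vscale V c x) = vscale W c (T x)"
    "\<And>x. x \<in> carr V \<Longrightarrow> vnorm W (T x) \<le> C * vnorm V x"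
  shows "T \<in> carr (bops V W)"
  using assms(1-4) assms(5) unfolding bops_def linear_between_def by (auto intro!: exI[of _ C])

lemma bops_ext: "T \<in> carr (bops V W) \<Longrightarrow> T \<in> extensional (carr V)"
  by (simp add: bops_def)

lemma bops_eqI:
  "\<lbrakk>S \<in> carr (bops V W); T \<in> carr (bops V W); \<And>x. x \<in> carr V \<Longrightarrow> S x = T x\<rbrakk> \<Longrightarrow> S = T"
  by (meson bops_ext extensionalityI)

lemma bops_closed: "\<lbrakk>T \<in> carr (bops V W); x \<in> carr V\<rbrakk> \<Longrightarrow> T x \<in> carr W"
  and bops_add: "\<lbrakk>T \<in> carr (bops V W); x \<in> carr V; y \<in> carr V\<rbrakk> \<Longrightarrow> T (vadd V x y) = vadd W (T x) (T y)"
  and bops_scale: "\<lbrakk>T \<in> carr (bops V W); x \<in> carr V\<rbrakk> \<Longrightarrow> T (vscale V c x) = vscale W c (T x)"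
  by (auto simp: bops_def linear_between_def)

locale cnormed_pair = V: cnormed V + W: cnormed W
  for V :: "('a, 'm) cnspace_scheme" and W :: "('b, 'n) cnspace_scheme"
begin

lemma zero_map:
  "x \<in> carr V \<Longrightarrow> T \<in> carr (bops V W) \<Longrightarrow> vnorm V x = 0 \<Longrightarrow> vnorm W (T x) = 0"
  by (metis V.norm_zero_imp W.norm_zero bops_closed bops_scale)

lemma ball_bdd:
  assumes "T \<in> carr (bops V W)"
  shows "bdd_above {vnorm W (T x) | x. x \<in> carr V \<and> vnorm V x \<le> 1}"
proof -
  obtain C where C: "\<And>x. x \<in> carr V \<Longrightarrow> vnorm W (T x) \<le> C * vnorm V x"
    using assms by (auto simp: bops_def)
  have "vnorm W (T x) \<le> \<bar>C\<bar>" if "x \<in> carr V" "vnorm V x \<le> 1" for x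
  proof -
    have "C * vnorm V x \<le> \<bar>C\<bar> * vnorm V x"
      using V.norm_ge0[OF that(1)] by (intro mult_right_mono) auto
    also have "\<dots> \<le> \<bar>C\<bar> * 1" using that by (intro mult_left_mono) auto
    finally show ?thesis using C[OF that(1)] by simp
  qed
  then show ?thesis by (auto intro!: bdd_aboveI[of _ "\<bar>C\<bar>"])
qed

lemma opnorm_upper:
  "\<lbrakk>T \<in> carr (bops V W); x \<in> carr V; vnorm V x \<le> 1\<rbrakk> \<Longrightarrow> vnorm W (T x) \<le> vnorm (bops V W) T"
  using ball_bdd[of T] by (auto simp: bops_def intro!: cSup_upper)

lemma opnorm_ge0: "T \<in> carr (bops V W) \<Longrightarrow> 0 \<le> vnorm (bops V W) T"
proof -
  assume T: "T \<in> carr (bops V W)"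
  obtain x where x: "x \<in> carr V" using V.nonempty by blast
  have "vnorm V (vscale V 0 x) \<le> 1" using x by (simp add: V.norm_zero)
  then show ?thesis using opnorm_upper[OF T V.scale_closed[OF x, of 0]]
    by (meson T V.scale_closed W.norm_ge0 bops_closed order_trans x)
qed

lemma opnorm_bound:
  assumes T: "T \<in> carr (bops V W)" and x: "x \<in> carr V"
  shows "vnorm W (T x) \<le> vnorm (bops V W) T * vnorm V x"
proof (cases "vnorm V x = 0")
  case True then show ?thesis using zero_map[OF x T] by simp
next
  case False
  then have p: "vnorm V x > 0" using V.norm_ge0[OF x] by simp
  let ?c = "complex_of_real (inverse (vnorm V x))"
  have "vnorm V (vscale V ?c x) = 1" using p x by (simp add: V.norm_scale norm_inverse)
  then have "vnorm W (T (vscale V ?c x)) \<le> vnorm (bops V W) T"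
    using opnorm_upper[OF T V.scale_closed[OF x]] by simp
  moreover have "vnorm W (T (vscale V ?c x)) = inverse (vnorm V x) * vnorm W (T x)"
    using p T x by (simp add: bops_scale W.norm_scale bops_closed norm_inverse)
  ultimately have "inverse (vnorm V x) * vnorm W (T x) \<le> vnorm (bops V W) T" by simp
  then show ?thesis using p by (simp add: field_simps del: of_real_inverse)
qed

text \<open>The operator norm is a supremum over the unit ball. The ball contains zero, so a uniform bound does bound the
supremum, for any function on the carrier.\<close>

lemma opnorm_le:
  assumes "0 \<le> C" "\<And>x. x \<in> carr V \<Longrightarrow> vnorm W (T x) \<le> C * vnorm V x"
  shows "vnorm (bops V W) T \<le> C"
proof -
  obtain x where x: "x \<in> carr V" using V.nonempty by blast
  have "vnorm V (vscale V 0 x) \<le> 1" "vscale V 0 x \<in> carr V" using x by (simp_all add: V.norm_zero V.scale_closed)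
  then have ne: "{vnorm W (T x) | x. x \<in> carr V \<and> vnorm V x \<le> 1} \<noteq> {}" by blast
  have "vnorm W (T x) \<le> C" if "x \<in> carr V" "vnorm V x \<le> 1" for x
    using assms(2)[OF that(1)] mult_left_mono[OF that(2) assms(1)] by simp
  then show ?thesis using ne by (auto simp: bops_def intro!: cSup_least)
qed

lemma bops_add_closed:
  assumes S: "S \<in> carr (bops V W)" and T: "T \<in> carr (bops V W)"
  shows "vadd (bops V W) S T \<in> carr (bops V W)"
proof (rule bopsI)
  fix x y assume [simp]: "x \<in> carr V" "y \<in> carr V"
  show "vadd (bops V W) S T (vadd V x y) = vadd W (vadd (bops V W) S T x) (vadd (bops V W) S T y)"
    using S T by (simp add: V.add_closed bops_add bops_closed W.add_assoc W.add_left_commute W.add_closed)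
next
  fix x assume x [simp]: "x \<in> carr V"
  show "vnorm W (vadd (bops V W) S T x) \<le> (vnorm (bops V W) S + vnorm (bops V W) T) * vnorm V x"
    using W.norm_triangle[of "S x" "T x"] opnorm_bound[OF S x] opnorm_bound[OF T x] S T
    by (simp add: bops_closed algebra_simps)
qed (use S T in \<open>auto simp: bops_closed W.add_closed bops_scale V.scale_closed W.scale_add\<close>)

lemma bops_scale_closed:
  assumes S: "S \<in> carr (bops V W)"
  shows "vscale (bops V W) c S \<in> carr (bops V W)"
proof (rule bopsI)
  fix x assume x [simp]: "x \<in> carr V"
  show "vnorm W (vscale (bops V W) c S x) \<le> (cmod c * vnorm (bops V W) S) * vnorm V x"
    using opnorm_bound[OF S x] S mult_left_mono[of _ _ "cmod c"]
    by (simp add: bops_closed W.norm_scale mult.assoc)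
qed (use S in \<open>auto simp: bops_closed W.scale_closed bops_scale bops_add V.scale_closed V.add_closed W.scale_add W.scale_scale mult.commute\<close>)

lemma opnorm_scale_le:
  assumes S: "S \<in> carr (bops V W)"
  shows "vnorm (bops V W) (vscale (bops V W) c S) \<le> cmod c * vnorm (bops V W) S"
proof (rule opnorm_le)
  fix x assume x [simp]: "x \<in> carr V"
  show "vnorm W (vscale (bops V W) c S x) \<le> (cmod c * vnorm (bops V W) S) * vnorm V x"
    using opnorm_bound[OF S x] S mult_left_mono[of _ _ "cmod c"]
    by (simp add: bops_closed W.norm_scale mult.assoc)
qed (simp add: opnorm_ge0 S)

lemma cnormed_bops: "cnormed (bops V W)"
proof
  obtain x0 where x0: "x0 \<in> carr W" using W.nonempty by blast
  have "(\<lambda>x\<in>carr V. vscale W 0 x0) \<in> carr (bops V W)"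
    by (rule bopsI[where C = 0])
      (use x0 in \<open>auto simp: V.add_closed V.scale_closed W.scale_closed W.add_zero W.scale_scale W.norm_zero\<close>)
  then show "carr (bops V W) \<noteq> {}" by blast
next
  fix S T assume ST: "S \<in> carr (bops V W)" "T \<in> carr (bops V W)"
  show "vnorm (bops V W) (vadd (bops V W) S T) \<le> vnorm (bops V W) S + vnorm (bops V W) T"
  proof (rule opnorm_le)
    fix x assume x [simp]: "x \<in> carr V"
    show "vnorm W (vadd (bops V W) S T x) \<le> (vnorm (bops V W) S + vnorm (bops V W) T) * vnorm V x"
      using W.norm_triangle[of "S x" "T x"] opnorm_bound[OF ST(1) x] opnorm_bound[OF ST(2) x] ST
      by (simp add: bops_closed algebra_simps)
  qed (use ST opnorm_ge0 in auto)
  show "vscale (bops V W) 0 S = vscale (bops V W) 0 T"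
    using ST by (auto simp: bops_closed W.zero_unique intro!: restrict_ext)
next
  fix S c assume S: "S \<in> carr (bops V W)"
  show "vnorm (bops V W) (vscale (bops V W) c S) = cmod c * vnorm (bops V W) S"
  proof (rule antisym[OF opnorm_scale_le[OF S]])
    show "cmod c * vnorm (bops V W) S \<le> vnorm (bops V W) (vscale (bops V W) c S)"
    proof (cases "c = 0")
      case True then show ?thesis by (simp add: opnorm_ge0 bops_scale_closed S del: bops_sel)
    next
      case False
      have "vscale (bops V W) (inverse c) (vscale (bops V W) c S) = S"
        using False S bops_ext[OF S]
        by (auto simp: W.scale_scale bops_closed W.scale_one fun_eq_iff extensional_def)
      then show ?thesis
        using opnorm_scale_le[OF bops_scale_closed[OF S], of "inverse c" c] False
        by (simp add: norm_divide divide_inverse[symmetric] inverse_eq_divide field_simps del: bops_sel)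
    qed
  qed
next
  fix S assume S: "S \<in> carr (bops V W)" and 0: "vnorm (bops V W) S = 0"
  show "S = vscale (bops V W) 0 S"
  proof (rule bops_eqI[OF S bops_scale_closed[OF S]])
    fix x assume x: "x \<in> carr V"
    have "vnorm W (S x) = 0"
      using opnorm_bound[OF S x] 0 W.norm_ge0[OF bops_closed[OF S x]] by simp
    then show "S x = vscale (bops V W) 0 S x"
      using W.norm_zero_imp[OF bops_closed[OF S x]] x by simp
  qed
next
  fix S assume S: "S \<in> carr (bops V W)"
  show "vscale (bops V W) 1 S = S"
    by (rule bops_eqI[OF bops_scale_closed[OF S] S]) (use S in \<open>simp add: bops_closed W.scale_one\<close>)
next
  fix S T assume ST: "S \<in> carr (bops V W)" "T \<in> carr (bops V W)"
  show "vadd (bops V W) S T = vadd (bops V W) T S"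
    using ST by (auto simp: bops_closed intro!: restrict_ext W.add_commute)
  fix c
  show "vscale (bops V W) c (vadd (bops V W) S T)
      = vadd (bops V W) (vscale (bops V W) c S) (vscale (bops V W) c T)"
    using ST by (auto simp: bops_closed W.scale_add intro!: restrict_ext)
next
  fix S T R assume "S \<in> carr (bops V W)" "T \<in> carr (bops V W)" "R \<in> carr (bops V W)"
  then show "vadd (bops V W) (vadd (bops V W) S T) R = vadd (bops V W) S (vadd (bops V W) T R)"
    by (auto simp: bops_closed W.add_assoc intro!: restrict_ext)
next
  fix S c d assume "S \<in> carr (bops V W)"
  then show "vscale (bops V W) (c + d) S = vadd (bops V W) (vscale (bops V W) c S) (vscale (bops V W) d S)"
    by (auto simp: bops_closed W.add_scale intro!: restrict_ext)
next
  fix S c d assume "S \<in> carr (bops V W)"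
  then show "vscale (bops V W) c (vscale (bops V W) d S) = vscale (bops V W) (c * d) S"
    by (auto simp: bops_closed W.scale_scale intro!: restrict_ext)
qed (rule bops_add_closed bops_scale_closed, assumption+)+

sublocale B: cnormed "bops V W" by (rule cnormed_bops)

lemma dist_apply:
  assumes "S \<in> carr (bops V W)" "T \<in> carr (bops V W)" "x \<in> carr V"
  shows "vdist W (S x) (T x) \<le> vdist (bops V W) S T * vnorm V x"
proof -
  have D: "vadd (bops V W) S (vscale (bops V W) (-1) T) \<in> carr (bops V W)"
    using assms by (simp only: B.add_closed B.scale_closed)
  show ?thesis using opnorm_bound[OF D assms(3)] assms(3) by (simp add: vdist_def)
qed

lemma opdist_le:
  assumes "0 \<le> C" "\<And>x. x \<in> carr V \<Longrightarrow> vdist W (S x) (T x) \<le> C * vnorm V x"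
  shows "vdist (bops V W) S T \<le> C"
  unfolding vdist_def by (rule opnorm_le) (use assms in \<open>auto simp: vdist_def\<close>)

text \<open>The limit is taken pointwise; it is linear by uniqueness of limits, and the Cauchy estimate survives the limit
because it is uniform on the unit ball.\<close>

lemma vcomplete_bops:
  assumes "vcomplete W" shows "vcomplete (bops V W)"
  unfolding vcomplete_def
proof
  fix T assume T: "T \<in> cauchy_seqs (bops V W)"
  then have Tc: "T n \<in> carr (bops V W)" for n by (auto simp: cauchy_seqs_def)
  have Tcau: "\<exists>N. \<forall>m\<ge>N. \<forall>n\<ge>N. vdist (bops V W) (T m) (T n) < e" if "e > 0" for e
    using T that by (simp add: cauchy_seqs_def del: bops_sel)
  have Tx: "T n x \<in> carr W" if "x \<in> carr V" for n x by (rule bops_closed[OF Tc that])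
  have cau: "(\<lambda>n. T n x) \<in> cauchy_seqs W" if x: "x \<in> carr V" for x
    unfolding cauchy_seqs_def
  proof (intro CollectI conjI allI impI)
    show "range (\<lambda>n. T n x) \<subseteq> carr W" using bops_closed[OF Tc x] by blast
    fix e :: real assume e: "e > 0"
    \<comment> \<open>the summand 1 keeps the denominator positive at zero\<close>
    define e' where "e' = e / (vnorm V x + 1)"
    have p: "vnorm V x + 1 > 0" using V.norm_ge0[OF x] by simp
    have "e' > 0" using e p by (simp add: e'_def)
    then obtain N where N: "\<And>m n. \<lbrakk>m \<ge> N; n \<ge> N\<rbrakk> \<Longrightarrow> vdist (bops V W) (T m) (T n) < e'"
      using Tcau by meson
    have "vdist W (T m x) (T n x) < e" if "m \<ge> N" "n \<ge> N" for m n
    proof -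
      have "vdist W (T m x) (T n x) \<le> e' * vnorm V x"
        using dist_apply[OF Tc Tc x, of m n] N[OF that] V.norm_ge0[OF x]
        by (meson mult_right_mono order_trans less_imp_le)
      also have "\<dots> < e" using p e V.norm_ge0[OF x] by (simp add: e'_def field_simps)
      finally show ?thesis .
    qed
    then show "\<exists>N. \<forall>m\<ge>N. \<forall>n\<ge>N. vdist W (T m x) (T n x) < e" by blast
  qed
  then have "\<forall>x\<in>carr V. \<exists>y\<in>carr W. vtends W (\<lambda>n. T n x) y" using assms by (auto simp: vcomplete_def)
  then obtain L0 where L0: "\<And>x. x \<in> carr V \<Longrightarrow> L0 x \<in> carr W"
    "\<And>x. x \<in> carr V \<Longrightarrow> vtends W (\<lambda>n. T n x) (L0 x)" by metis
  define L where "L = restrict L0 (carr V)"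
  have Lc: "L x \<in> carr W" and Lt: "vtends W (\<lambda>n. T n x) (L x)" if "x \<in> carr V" for x
    using L0 that by (auto simp: L_def)
  have close: "\<exists>N. \<forall>n\<ge>N. \<forall>x\<in>carr V. vdist W (T n x) (L x) \<le> e * vnorm V x" if e: "e > 0" for e :: real
  proof -
    obtain N where N: "\<And>m n. \<lbrakk>m \<ge> N; n \<ge> N\<rbrakk> \<Longrightarrow> vdist (bops V W) (T m) (T n) < e"
      using Tcau e by meson
    have "vdist W (T n x) (L x) \<le> e * vnorm V x" if n: "n \<ge> N" and x: "x \<in> carr V" for n x
    proof -
      have "vdist W (T n x) (L x) \<le> e * vnorm V x + vdist W (T m x) (L x)" if m: "m \<ge> N" for m
      proof -
        have "vdist W (T n x) (T m x) \<le> e * vnorm V x"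
          using dist_apply[OF Tc Tc x, of n m] N[OF n m] V.norm_ge0[OF x]
          by (meson mult_right_mono order_trans less_imp_le)
        then show ?thesis
          using W.dist_triangle[of "T n x" "T m x" "L x"] bops_closed[OF Tc x] Lc[OF x] by auto
      qed
      moreover have "(\<lambda>m. e * vnorm V x + vdist W (T m x) (L x)) \<longlonglongrightarrow> e * vnorm V x + 0"
        using Lt[OF x] unfolding vtends_def by (intro tendsto_intros)
      ultimately show ?thesis by (intro LIMSEQ_le_const) auto
    qed
    then show ?thesis by blast
  qed
  obtain N1 where N1: "\<And>x. x \<in> carr V \<Longrightarrow> vdist W (T N1 x) (L x) \<le> 1 * vnorm V x"
    using close[of 1] by auto
  have Lb: "L \<in> carr (bops V W)"
  proof (rule bopsI)
    show "L \<in> extensional (carr V)" by (simp add: L_def)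
    fix x assume x: "x \<in> carr V"
    show "L x \<in> carr W" using Lc x by simp
    have "vnorm W (L x) \<le> vnorm W (T N1 x) + vdist W (T N1 x) (L x)"
      using W.norm_diff_le[OF bops_closed[OF Tc x] Lc[OF x], of N1] by linarith
    then show "vnorm W (L x) \<le> (vnorm (bops V W) (T N1) + 1) * vnorm V x"
      using opnorm_bound[OF Tc x, of N1] N1[OF x] by (simp add: algebra_simps)
    fix c
    show "L (vscale V c x) = vscale W c (L x)"
    proof (rule W.vtends_unique)
      show "vtends W (\<lambda>n. T n (vscale V c x)) (L (vscale V c x))" by (rule Lt[OF V.scale_closed[OF x]])
      show "vtends W (\<lambda>n. T n (vscale V c x)) (vscale W c (L x))"
        unfolding bops_scale[OF Tc x] by (rule W.vtends_scale) (use Tx Lc Lt x in auto)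
    qed (use Lc Tx x V.scale_closed W.scale_closed in auto)
  next
    fix x y assume x: "x \<in> carr V" and y: "y \<in> carr V"
    show "L (vadd V x y) = vadd W (L x) (L y)"
    proof (rule W.vtends_unique)
      show "vtends W (\<lambda>n. T n (vadd V x y)) (L (vadd V x y))" by (rule Lt[OF V.add_closed[OF x y]])
      show "vtends W (\<lambda>n. T n (vadd V x y)) (vadd W (L x) (L y))"
        unfolding bops_add[OF Tc x y] by (rule W.vtends_add) (use Tx Lc Lt x y in auto)
    qed (use Lc Tx x y V.add_closed W.add_closed in auto)
  qed
  have "vtends (bops V W) T L"
    unfolding vtends_def
  proof (rule LIMSEQ_I)
    fix r :: real assume "r > 0"
    then obtain N where N: "\<And>n x. \<lbrakk>n \<ge> N; x \<in> carr V\<rbrakk> \<Longrightarrow> vdist W (T n x) (L x) \<le> (r/2) * vnorm V x"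
      using close[of "r/2"] by (meson half_gt_zero)
    have "norm (vdist (bops V W) (T n) L - 0) < r" if "n \<ge> N" for n
    proof -
      have "vdist (bops V W) (T n) L \<le> r / 2" by (rule opdist_le) (use N[OF that] \<open>r > 0\<close> in auto)
      then show ?thesis using B.dist_ge0[OF Tc Lb, of n] \<open>r > 0\<close> by simp
    qed
    then show "\<exists>no. \<forall>n\<ge>no. norm (vdist (bops V W) (T n) L - 0) < r" by blast
  qed
  then show "\<exists>x\<in>carr (bops V W). vtends (bops V W) T x" using Lb by blast
qed

end

locale cnormed_triple = U: cnormed U + V: cnormed V + W: cnormed W
  for U :: "('a, 'l) cnspace_scheme" and V :: "('b, 'm) cnspace_scheme" and W :: "('c, 'n) cnspace_scheme"
begin

sublocale UV: cnormed_pair U V by unfold_locales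
sublocale VW: cnormed_pair V W by unfold_locales
sublocale UW: cnormed_pair U W by unfold_locales

lemma compose_bound:
  assumes S: "S \<in> carr (bops V W)" and T: "T \<in> carr (bops U V)" and x: "x \<in> carr U"
  shows "vnorm W (compose (carr U) S T x) \<le> (vnorm (bops V W) S * vnorm (bops U V) T) * vnorm U x"
proof -
  have "vnorm W (S (T x)) \<le> vnorm (bops V W) S * vnorm V (T x)"
    by (rule VW.opnorm_bound[OF S bops_closed[OF T x]])
  also have "\<dots> \<le> vnorm (bops V W) S * (vnorm (bops U V) T * vnorm U x)"
    by (rule mult_left_mono[OF UV.opnorm_bound[OF T x] VW.opnorm_ge0[OF S]])
  finally show ?thesis using x by (simp add: compose_def mult.assoc)
qed

lemma compose_closed:
  assumes S: "S \<in> carr (bops V W)" and T: "T \<in> carr (bops U V)"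
  shows "compose (carr U) S T \<in> carr (bops U W)"
  by (rule bopsI[OF compose_extensional _ _ _ compose_bound[OF S T]])
    (use S T in \<open>auto simp: compose_def bops_closed U.add_closed U.scale_closed bops_add bops_scale\<close>)

lemma compose_norm:
  assumes S: "S \<in> carr (bops V W)" and T: "T \<in> carr (bops U V)"
  shows "vnorm (bops U W) (compose (carr U) S T) \<le> vnorm (bops V W) S * vnorm (bops U V) T"
  by (rule UW.opnorm_le[OF _ compose_bound[OF S T]]) (simp add: S T VW.opnorm_ge0 UV.opnorm_ge0)

lemma compose_dist_left:
  assumes S: "S \<in> carr (bops V W)" "S' \<in> carr (bops V W)" and T: "T \<in> carr (bops U V)"
  shows "vdist (bops U W) (compose (carr U) S T) (compose (carr U) S' T)
           \<le> vdist (bops V W) S S' * vnorm (bops U V) T"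
proof (rule UW.opdist_le)
  fix x assume x: "x \<in> carr U"
  have "vdist W (S (T x)) (S' (T x)) \<le> vdist (bops V W) S S' * vnorm V (T x)"
    by (rule VW.dist_apply[OF S bops_closed[OF T x]])
  also have "\<dots> \<le> vdist (bops V W) S S' * (vnorm (bops U V) T * vnorm U x)"
    by (rule mult_left_mono[OF UV.opnorm_bound[OF T x] VW.B.dist_ge0[OF S]])
  finally show "vdist W (compose (carr U) S T x) (compose (carr U) S' T x)
      \<le> vdist (bops V W) S S' * vnorm (bops U V) T * vnorm U x"
    using x by (simp add: compose_def mult.assoc)
qed (simp add: S T VW.B.dist_ge0 UV.opnorm_ge0)

lemma compose_dist_right:
  assumes S: "S \<in> carr (bops V W)" and T: "T \<in> carr (bops U V)" "T' \<in> carr (bops U V)"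
  shows "vdist (bops U W) (compose (carr U) S T) (compose (carr U) S T')
           \<le> vnorm (bops V W) S * vdist (bops U V) T T'"
proof (rule UW.opdist_le)
  fix x assume x: "x \<in> carr U"
  have "vdist W (S (T x)) (S (T' x)) = vnorm W (S (vadd V (T x) (vscale V (-1) (T' x))))"
    using S T x by (simp add: vdist_def bops_add bops_scale bops_closed V.scale_closed)
  also have "\<dots> \<le> vnorm (bops V W) S * vdist V (T x) (T' x)"
    unfolding vdist_def by (rule VW.opnorm_bound[OF S]) (use T x in \<open>simp add: V.add_closed V.scale_closed bops_closed\<close>)
  also have "\<dots> \<le> vnorm (bops V W) S * (vdist (bops U V) T T' * vnorm U x)"
    by (rule mult_left_mono[OF UV.dist_apply[OF T x] VW.opnorm_ge0[OF S]])
  finally show "vdist W (compose (carr U) S T x) (compose (carr U) S T' x)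
      \<le> vnorm (bops V W) S * vdist (bops U V) T T' * vnorm U x"
    using x by (simp add: compose_def mult.assoc)
qed (simp add: S T VW.opnorm_ge0 UV.B.dist_ge0)

lemma vtends_compose_left:
  assumes "\<And>n. S n \<in> carr (bops V W)" "S' \<in> carr (bops V W)" "T \<in> carr (bops U V)" "vtends (bops V W) S S'"
  shows "vtends (bops U W) (\<lambda>n. compose (carr U) (S n) T) (compose (carr U) S' T)"
  unfolding vtends_def
proof (rule Lim_null_comparison)
  show "\<forall>\<^sub>F n in sequentially. norm (vdist (bops U W) (compose (carr U) (S n) T) (compose (carr U) S' T))
     \<le> vdist (bops V W) (S n) S' * vnorm (bops U V) T"
    using assms(1-3) compose_dist_left by (simp add: UW.B.dist_ge0 compose_closed)
  show "(\<lambda>n. vdist (bops V W) (S n) S' * vnorm (bops U V) T) \<longlonglongrightarrow> 0"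
    using tendsto_mult_right[OF assms(4)[unfolded vtends_def]] by simp
qed

lemma vtends_compose_right:
  assumes "S \<in> carr (bops V W)" "\<And>n. T n \<in> carr (bops U V)" "T' \<in> carr (bops U V)" "vtends (bops U V) T T'"
  shows "vtends (bops U W) (\<lambda>n. compose (carr U) S (T n)) (compose (carr U) S T')"
  unfolding vtends_def
proof (rule Lim_null_comparison)
  show "\<forall>\<^sub>F n in sequentially. norm (vdist (bops U W) (compose (carr U) S (T n)) (compose (carr U) S T'))
     \<le> vnorm (bops V W) S * vdist (bops U V) (T n) T'"
    using assms(1-3) compose_dist_right by (simp add: UW.B.dist_ge0 compose_closed)
  show "(\<lambda>n. vnorm (bops V W) S * vdist (bops U V) (T n) T') \<longlonglongrightarrow> 0"
    using tendsto_mult_left[OF assms(4)[unfolded vtends_def]] by simp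
qed

text \<open>Composition is separately continuous, so a product of two limits is reached by moving one factor at a time.
This is how relations between dense subspaces pass to the closures.\<close>

lemma compose_vclosure:
  assumes CS: "CS \<subseteq> carr (bops V W)" and CT: "CT \<subseteq> carr (bops U V)" and C: "C \<subseteq> carr (bops U W)"
    and st: "\<And>S T. \<lbrakk>S \<in> CS; T \<in> CT\<rbrakk> \<Longrightarrow> compose (carr U) S T \<in> C"
    and S: "S \<in> vclosure (bops V W) CS" and T: "T \<in> vclosure (bops U V) CT"
  shows "compose (carr U) S T \<in> vclosure (bops U W) C"
proof -
  obtain f where f: "\<And>n. f n \<in> CS" "vtends (bops V W) f S" "S \<in> carr (bops V W)"
    using VW.B.vclosure_seq[OF S CS] by blast
  obtain g where g: "\<And>n. g n \<in> CT" "vtends (bops U V) g T" "T \<in> carr (bops U V)"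
    using UV.B.vclosure_seq[OF T CT] by blast
  have "compose (carr U) (f n) T \<in> vclosure (bops U W) C" for n
  proof (rule UW.B.vclosureI_seq)
    show "vtends (bops U W) (\<lambda>k. compose (carr U) (f n) (g k)) (compose (carr U) (f n) T)"
      by (rule vtends_compose_right) (use f g CS CT in auto)
    show "compose (carr U) (f n) (g k) \<in> vclosure (bops U W) C" for k
      using st f g UW.B.vclosure_superset[OF C] by blast
  qed (use f(1)[of n] g(3) CS compose_closed C in auto)
  then show ?thesis
  proof (rule UW.B.vclosureI_seq)
    show "vtends (bops U W) (\<lambda>n. compose (carr U) (f n) T) (compose (carr U) S T)"
      by (rule vtends_compose_left) (use f g CS in auto)
  qed (use C f g compose_closed in auto)
qed

lemma compose_add_right:
  assumes "S \<in> carr (bops V W)" "T \<in> carr (bops U V)" "T' \<in> carr (bops U V)"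
  shows "compose (carr U) S (vadd (bops U V) T T') = vadd (bops U W) (compose (carr U) S T) (compose (carr U) S T')"
  using assms by (auto simp: compose_def bops_add bops_closed intro!: restrict_ext)

lemma compose_scale_right:
  assumes "S \<in> carr (bops V W)" "T \<in> carr (bops U V)"
  shows "compose (carr U) S (vscale (bops U V) c T) = vscale (bops U W) c (compose (carr U) S T)"
  using assms by (auto simp: compose_def bops_scale bops_closed intro!: restrict_ext)

lemma compose_add_left:
  assumes "T \<in> carr (bops U V)"
  shows "compose (carr U) (vadd (bops V W) S S') T = vadd (bops U W) (compose (carr U) S T) (compose (carr U) S' T)"
  using assms by (auto simp: compose_def bops_closed intro!: restrict_ext)

lemma compose_scale_left:
  assumes "T \<in> carr (bops U V)"
  shows "compose (carr U) (vscale (bops V W) c S) T = vscale (bops U W) c (compose (carr U) S T)"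
  using assms by (auto simp: compose_def bops_closed intro!: restrict_ext)

end

lemma compose_compose:
  assumes "T \<in> carr (bops U V)"
  shows "compose (carr U) (compose (carr V) R S) T = compose (carr U) R (compose (carr U) S T)"
  using assms by (auto simp: compose_def bops_closed intro!: restrict_ext)

lemma cnormed_subspace:
  fixes V :: "'a cnspace"
  assumes "cnormed V" "C \<subseteq> carr V" "C \<noteq> {}"
    "\<And>x y. \<lbrakk>x \<in> C; y \<in> C\<rbrakk> \<Longrightarrow> vadd V x y \<in> C" "\<And>c x. x \<in> C \<Longrightarrow> vscale V c x \<in> C"
  shows "cnormed (V\<lparr>carr := C\<rparr>)"
proof -
  interpret V: cnormed V by fact
  have C: "x \<in> carr V" if "x \<in> C" for x using that assms(2) by blast
  show ?thesis
    by unfold_locales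
      (use assms(3) in \<open>auto simp: assms(4,5) C V.add_assoc V.scale_add V.add_scale V.scale_scale V.scale_one
        V.norm_scale V.norm_triangle intro: V.add_commute V.zero_unique V.norm_zero_imp\<close>)
qed

text \<open>With \<open>left_mult_op\<close> this provides the two components of an element of \<open>pair_ops\<close>; boundedness is the
submultiplicativity of the operator norm.\<close>

lemma right_mult_op:
  assumes V: "cnormed V" and W: "cnormed W" and C: "C \<subseteq> carr (bops V W)" "C \<noteq> {}"
    "\<And>x y. \<lbrakk>x \<in> C; y \<in> C\<rbrakk> \<Longrightarrow> vadd (bops V W) x y \<in> C" "\<And>c x. x \<in> C \<Longrightarrow> vscale (bops V W) c x \<in> C"
    and L: "L \<in> carr (bops V V)" "\<And>x. x \<in> C \<Longrightarrow> compose (carr V) x L \<in> C"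
  defines "X \<equiv> (bops V W)\<lparr>carr := C\<rparr>"
  shows "(\<lambda>x\<in>C. compose (carr V) x L) \<in> carr (bops X X)"
    "vnorm (bops X X) (\<lambda>x\<in>C. compose (carr V) x L) \<le> vnorm (bops V V) L"
proof -
  interpret V: cnormed V by fact
  interpret W: cnormed W by fact
  interpret T: cnormed_triple V V W by unfold_locales
  interpret X: cnormed X unfolding X_def by (rule cnormed_subspace[OF cnormed_pair.cnormed_bops[OF cnormed_pair.intro[OF V W]] C])
  interpret XX: cnormed_pair X X by unfold_locales
  let ?T = "\<lambda>x\<in>C. compose (carr V) x L"
  have c: "carr X = C" "vadd X = vadd (bops V W)" "vscale X = vscale (bops V W)" "vnorm X = vnorm (bops V W)"
    by (simp_all add: X_def)
  have b: "vnorm X (?T x) \<le> vnorm (bops V V) L * vnorm X x" if "x \<in> carr X" for x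
    using T.compose_norm[OF subsetD[OF C(1)] L(1), of x] that by (simp add: c mult.commute)
  show "?T \<in> carr (bops X X)"
  proof (rule bopsI[OF _ _ _ _ b])
    fix x y assume "x \<in> carr X" "y \<in> carr X"
    then show "?T (vadd X x y) = vadd X (?T x) (?T y)"
      using C(3)[of x y] T.compose_add_left[OF L(1), of x y] by (simp only: c restrict_apply if_True)
  next
    fix d x assume "x \<in> carr X"
    then show "?T (vscale X d x) = vscale X d (?T x)"
      using C(4)[of x d] T.compose_scale_left[OF L(1), of d x] by (simp only: c restrict_apply if_True)
  qed (simp_all add: c(1) L(2) extensional_def)
  show "vnorm (bops X X) ?T \<le> vnorm (bops V V) L" by (rule XX.opnorm_le[OF T.UV.opnorm_ge0[OF L(1)] b])
qed

lemma left_mult_op: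
  assumes V: "cnormed V" and W: "cnormed W" and C: "C \<subseteq> carr (bops V W)" "C \<noteq> {}"
    "\<And>x y. \<lbrakk>x \<in> C; y \<in> C\<rbrakk> \<Longrightarrow> vadd (bops V W) x y \<in> C" "\<And>c x. x \<in> C \<Longrightarrow> vscale (bops V W) c x \<in> C"
    and L: "L \<in> carr (bops W W)" "\<And>y. y \<in> C \<Longrightarrow> compose (carr V) L y \<in> C"
  defines "Y \<equiv> (bops V W)\<lparr>carr := C\<rparr>"
  shows "(\<lambda>y\<in>C. compose (carr V) L y) \<in> carr (bops Y Y)"
    "vnorm (bops Y Y) (\<lambda>y\<in>C. compose (carr V) L y) \<le> vnorm (bops W W) L"
proof -
  interpret V: cnormed V by fact
  interpret W: cnormed W by fact
  interpret T: cnormed_triple V W W by unfold_locales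
  interpret Y: cnormed Y unfolding Y_def by (rule cnormed_subspace[OF cnormed_pair.cnormed_bops[OF cnormed_pair.intro[OF V W]] C])
  interpret YY: cnormed_pair Y Y by unfold_locales
  let ?T = "\<lambda>y\<in>C. compose (carr V) L y"
  have c: "carr Y = C" "vadd Y = vadd (bops V W)" "vscale Y = vscale (bops V W)" "vnorm Y = vnorm (bops V W)"
    by (simp_all add: Y_def)
  have b: "vnorm Y (?T x) \<le> vnorm (bops W W) L * vnorm Y x" if "x \<in> carr Y" for x
    using T.compose_norm[OF L(1) subsetD[OF C(1)], of x] that by (simp add: c)
  show "?T \<in> carr (bops Y Y)"
  proof (rule bopsI[OF _ _ _ _ b])
    fix x y assume a: "x \<in> carr Y" "y \<in> carr Y"
    then have "x \<in> carr (bops V W)" "y \<in> carr (bops V W)" using C(1) c by auto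
    then show "?T (vadd Y x y) = vadd Y (?T x) (?T y)"
      using a C(3)[of x y] T.compose_add_right[OF L(1), of x y] by (simp only: c restrict_apply if_True)
  next
    fix d x assume a: "x \<in> carr Y"
    then have "x \<in> carr (bops V W)" using C(1) c by auto
    then show "?T (vscale Y d x) = vscale Y d (?T x)"
      using a C(4)[of x d] T.compose_scale_right[OF L(1), of x d] by (simp only: c restrict_apply if_True)
  qed (simp_all add: c(1) L(2) extensional_def)
  show "vnorm (bops Y Y) ?T \<le> vnorm (bops W W) L" by (rule YY.opnorm_le[OF T.VW.opnorm_ge0[OF L(1)] b])
qed

section \<open>Extending contractive representations to completions\<close>

lemma eventually_prod_seq_iff:
  "eventually P (sequentially \<times>\<^sub>F sequentially) \<longleftrightarrow> (\<exists>N. \<forall>m\<ge>N. \<forall>n\<ge>N. P (m, n))"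
  unfolding eventually_prod_sequentially by blast

text \<open>As convergence along a product filter the Cauchy property is compatible with the usual limit calculus.\<close>

lemma cauchy_seqs_iff:
  assumes "\<And>x y. \<lbrakk>x \<in> carr V; y \<in> carr V\<rbrakk> \<Longrightarrow> 0 \<le> vdist V x y"
  shows "f \<in> cauchy_seqs V \<longleftrightarrow> (\<forall>n. f n \<in> carr V) \<and>
    ((\<lambda>(m, n). vdist V (f m) (f n)) \<longlongrightarrow> 0) (sequentially \<times>\<^sub>F sequentially)"
proof -
  have "((\<lambda>(m, n). vdist V (f m) (f n)) \<longlongrightarrow> 0) (sequentially \<times>\<^sub>F sequentially)
    \<longleftrightarrow> (\<forall>e>0. \<exists>N. \<forall>m\<ge>N. \<forall>n\<ge>N. vdist V (f m) (f n) < e)" if "\<forall>n. f n \<in> carr V"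
    using that assms unfolding tendsto_iff eventually_prod_seq_iff by (simp add: dist_real_def)
  then show ?thesis unfolding cauchy_seqs_def by auto
qed

text \<open>An algebra whose norm is the operator norm of a representation \<open>\<rho>0\<close>. All metric laws are pulled back along
\<open>\<rho>0\<close>, so they need not be proved for the algebra itself; only \<open>\<rho>0\<close> has to be isometric.\<close>

locale op_normed_alg = V0: cnormed V0
  for A :: "'a cnalg" and V0 :: "('v, 'm) cnspace_scheme" and \<rho>0 :: "'a \<Rightarrow> 'v \<Rightarrow> 'v" +
  assumes A_add: "\<lbrakk>a \<in> carr A; b \<in> carr A\<rbrakk> \<Longrightarrow> vadd A a b \<in> carr A"
    and A_scale: "a \<in> carr A \<Longrightarrow> vscale A c a \<in> carr A"
    and A_mult: "\<lbrakk>a \<in> carr A; b \<in> carr A\<rbrakk> \<Longrightarrow> amult A a b \<in> carr A"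
    and rho0_closed: "a \<in> carr A \<Longrightarrow> \<rho>0 a \<in> carr (bops V0 V0)"
    and rho0_add: "\<lbrakk>a \<in> carr A; b \<in> carr A\<rbrakk> \<Longrightarrow> \<rho>0 (vadd A a b) = vadd (bops V0 V0) (\<rho>0 a) (\<rho>0 b)"
    and rho0_scale: "a \<in> carr A \<Longrightarrow> \<rho>0 (vscale A c a) = vscale (bops V0 V0) c (\<rho>0 a)"
    and rho0_mult: "\<lbrakk>a \<in> carr A; b \<in> carr A\<rbrakk> \<Longrightarrow> \<rho>0 (amult A a b) = compose (carr V0) (\<rho>0 a) (\<rho>0 b)"
    and rho0_norm: "a \<in> carr A \<Longrightarrow> vnorm A a = vnorm (bops V0 V0) (\<rho>0 a)"
begin

sublocale T0: cnormed_triple V0 V0 V0 by unfold_locales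

abbreviation B0 where "B0 \<equiv> bops V0 V0"
abbreviation cls where "cls f \<equiv> null_rel A `` {f}"

lemma A_dist: "\<lbrakk>a \<in> carr A; b \<in> carr A\<rbrakk> \<Longrightarrow> vdist A a b = vdist B0 (\<rho>0 a) (\<rho>0 b)"
  unfolding vdist_def by (simp only: rho0_norm rho0_add rho0_scale A_add A_scale)

lemma A_dist_ge0: "\<lbrakk>a \<in> carr A; b \<in> carr A\<rbrakk> \<Longrightarrow> 0 \<le> vdist A a b"
  by (simp add: A_dist T0.UV.B.dist_ge0 rho0_closed)

lemma A_dist_self: "a \<in> carr A \<Longrightarrow> vdist A a a = 0"
  by (simp add: A_dist T0.UV.B.dist_self rho0_closed)

lemma A_dist_commute: "\<lbrakk>a \<in> carr A; b \<in> carr A\<rbrakk> \<Longrightarrow> vdist A a b = vdist A b a"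
  by (simp add: A_dist T0.UV.B.dist_commute rho0_closed)

lemma A_dist_triangle:
  "\<lbrakk>a \<in> carr A; b \<in> carr A; c \<in> carr A\<rbrakk> \<Longrightarrow> vdist A a c \<le> vdist A a b + vdist A b c"
  by (simp add: A_dist T0.UV.B.dist_triangle rho0_closed)

lemma A_norm_diff: "\<lbrakk>a \<in> carr A; b \<in> carr A\<rbrakk> \<Longrightarrow> \<bar>vnorm A a - vnorm A b\<bar> \<le> vdist A a b"
  by (simp add: A_dist rho0_norm T0.UV.B.norm_diff_le rho0_closed)

lemma A_norm_ge0: "a \<in> carr A \<Longrightarrow> 0 \<le> vnorm A a"
  by (simp add: rho0_norm T0.UV.B.norm_ge0 rho0_closed)

lemma A_dist_add:
  "\<lbrakk>a \<in> carr A; b \<in> carr A; a' \<in> carr A; b' \<in> carr A\<rbrakk>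
    \<Longrightarrow> vdist A (vadd A a a') (vadd A b b') \<le> vdist A a b + vdist A a' b'"
  by (simp add: A_dist A_add rho0_add T0.UV.B.dist_add rho0_closed del: bops_sel)

lemma A_dist_scale:
  "\<lbrakk>a \<in> carr A; b \<in> carr A\<rbrakk> \<Longrightarrow> vdist A (vscale A c a) (vscale A c b) = cmod c * vdist A a b"
  by (simp add: A_dist A_scale rho0_scale T0.UV.B.dist_scale rho0_closed del: bops_sel)

lemma A_dist_mult:
  assumes "a \<in> carr A" "b \<in> carr A" "a' \<in> carr A" "b' \<in> carr A"
  shows "vdist A (amult A a a') (amult A b b') \<le> vdist A a b * vnorm A a' + vnorm A b * vdist A a' b'"
proof -
  have "vdist B0 (compose (carr V0) (\<rho>0 a) (\<rho>0 a')) (compose (carr V0) (\<rho>0 b) (\<rho>0 b'))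
     \<le> vdist B0 (compose (carr V0) (\<rho>0 a) (\<rho>0 a')) (compose (carr V0) (\<rho>0 b) (\<rho>0 a'))
      + vdist B0 (compose (carr V0) (\<rho>0 b) (\<rho>0 a')) (compose (carr V0) (\<rho>0 b) (\<rho>0 b'))"
    using assms by (intro T0.UV.B.dist_triangle T0.compose_closed rho0_closed)
  also have "\<dots> \<le> vdist B0 (\<rho>0 a) (\<rho>0 b) * vnorm B0 (\<rho>0 a')
      + vnorm B0 (\<rho>0 b) * vdist B0 (\<rho>0 a') (\<rho>0 b')"
    using assms by (intro add_mono T0.compose_dist_left T0.compose_dist_right rho0_closed)
  finally show ?thesis using assms by (simp add: A_dist rho0_norm rho0_mult A_mult)
qed

lemma cauchyA_iff:
  "f \<in> cauchy_seqs A \<longleftrightarrow> (\<forall>n. f n \<in> carr A) \<and>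
    ((\<lambda>(m, n). vdist A (f m) (f n)) \<longlongrightarrow> 0) (sequentially \<times>\<^sub>F sequentially)"
  by (rule cauchy_seqs_iff) (rule A_dist_ge0)

lemma cauchyA_carr: "f \<in> cauchy_seqs A \<Longrightarrow> f n \<in> carr A"
  by (simp add: cauchyA_iff)

lemma null_relD: "(f, g) \<in> null_rel A \<Longrightarrow> f \<in> cauchy_seqs A \<and> g \<in> cauchy_seqs A \<and>
    (\<lambda>n. vdist A (f n) (g n)) \<longlonglongrightarrow> 0"
  by (simp add: null_rel_def)

lemma null_relI:
  assumes "f \<in> cauchy_seqs A" "g \<in> cauchy_seqs A" "d \<longlonglongrightarrow> 0" "\<And>n. vdist A (f n) (g n) \<le> d n"
  shows "(f, g) \<in> null_rel A"
proof -
  have "(\<lambda>n. vdist A (f n) (g n)) \<longlonglongrightarrow> 0"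
    by (rule Lim_null_comparison[OF _ assms(3)])
      (use assms(4) cauchyA_carr[OF assms(1)] cauchyA_carr[OF assms(2)] A_dist_ge0 in auto)
  then show ?thesis using assms(1,2) by (simp add: null_rel_def)
qed

lemma equiv_null_rel: "equiv (cauchy_seqs A) (null_rel A)"
proof (rule equivI)
  show "null_rel A \<subseteq> cauchy_seqs A \<times> cauchy_seqs A" by (auto simp: null_rel_def)
  show "refl_on (cauchy_seqs A) (null_rel A)"
    by (rule refl_onI) (auto simp: null_rel_def A_dist_self cauchyA_carr)
  show "sym (null_rel A)"
  proof (rule symI)
    fix f g assume "(f, g) \<in> null_rel A"
    then show "(g, f) \<in> null_rel A"
      using null_relD[of f g] by (auto intro!: null_relI[of g f "\<lambda>n. vdist A (f n) (g n)"] 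
          simp: A_dist_commute[OF cauchyA_carr cauchyA_carr])
  qed
  show "trans (null_rel A)"
  proof (rule transI)
    fix f g h assume 1: "(f, g) \<in> null_rel A" and 2: "(g, h) \<in> null_rel A"
    show "(f, h) \<in> null_rel A"
    proof (rule null_relI)
      show "(\<lambda>n. vdist A (f n) (g n) + vdist A (g n) (h n)) \<longlonglongrightarrow> 0"
        using tendsto_add[of "\<lambda>n. vdist A (f n) (g n)" 0 sequentially "\<lambda>n. vdist A (g n) (h n)" 0]
          null_relD[OF 1] null_relD[OF 2] by simp
    qed (use null_relD[OF 1] null_relD[OF 2] in \<open>auto intro!: A_dist_triangle cauchyA_carr\<close>)
  qed
qed

lemma cauchyA_comparison:
  assumes "\<And>n. h n \<in> carr A" "(d \<longlongrightarrow> 0) (sequentially \<times>\<^sub>F sequentially)"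
    "\<And>m n. vdist A (h m) (h n) \<le> d (m, n)"
  shows "h \<in> cauchy_seqs A"
  unfolding cauchyA_iff
  by (intro conjI allI assms(1) Lim_null_comparison[OF _ assms(2)])
    (use assms(1,3) A_dist_ge0 in \<open>auto intro!: always_eventually\<close>)

lemma cauchyA_norm_bound:
  assumes "f \<in> cauchy_seqs A" obtains K where "0 \<le> K" "\<And>n. vnorm A (f n) \<le> K"
   "convergent (\<lambda>n. vnorm A (f n))"
proof -
  have "Cauchy (\<lambda>n. vnorm A (f n))"
  proof (rule metric_CauchyI)
    fix e :: real assume "e > 0"
    then obtain N where "\<forall>m\<ge>N. \<forall>n\<ge>N. vdist A (f m) (f n) < e"
      using assms by (auto simp: cauchy_seqs_def)
    then show "\<exists>M. \<forall>m\<ge>M. \<forall>n\<ge>M. dist (vnorm A (f m)) (vnorm A (f n)) < e"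
      using A_norm_diff[OF cauchyA_carr[OF assms] cauchyA_carr[OF assms]]
      by (metis dist_real_def order_le_less_trans)
  qed
  then have c: "convergent (\<lambda>n. vnorm A (f n))" by (simp add: Cauchy_convergent_iff)
  then have "Bseq (\<lambda>n. vnorm A (f n))" by (rule convergent_imp_Bseq)
  then obtain K where "K > 0" "\<And>n. norm (vnorm A (f n)) \<le> K" by (auto elim!: BseqE)
  then have "0 \<le> K" "\<And>n. vnorm A (f n) \<le> K" by (auto simp: abs_le_iff)
  then show ?thesis using that c by blast
qed

lemma cauchyA_add:
  assumes f: "f \<in> cauchy_seqs A" and g: "g \<in> cauchy_seqs A"
  shows "(\<lambda>n. vadd A (f n) (g n)) \<in> cauchy_seqs A"
proof (rule cauchyA_comparison)
  show "((\<lambda>p. (\<lambda>(m, n). vdist A (f m) (f n)) p + (\<lambda>(m, n). vdist A (g m) (g n)) p) \<longlongrightarrow> 0)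
    (sequentially \<times>\<^sub>F sequentially)"
    using tendsto_add[of "\<lambda>(m, n). vdist A (f m) (f n)" 0 _ "\<lambda>(m, n). vdist A (g m) (g n)" 0] f g
    by (simp add: cauchyA_iff)
qed (use cauchyA_carr[OF f] cauchyA_carr[OF g] in \<open>auto intro!: A_dist_add A_add\<close>)

lemma cauchyA_scale:
  assumes f: "f \<in> cauchy_seqs A"
  shows "(\<lambda>n. vscale A c (f n)) \<in> cauchy_seqs A"
proof (rule cauchyA_comparison)
  show "((\<lambda>p. cmod c * (\<lambda>(m, n). vdist A (f m) (f n)) p) \<longlongrightarrow> 0) (sequentially \<times>\<^sub>F sequentially)"
    using tendsto_mult_left[of "\<lambda>(m, n). vdist A (f m) (f n)" 0 _ "cmod c"] f
    by (simp add: cauchyA_iff)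
qed (use f in \<open>auto simp: A_dist_scale cauchyA_carr intro!: A_scale\<close>)

lemma cauchyA_mult:
  assumes f: "f \<in> cauchy_seqs A" and g: "g \<in> cauchy_seqs A"
  shows "(\<lambda>n. amult A (f n) (g n)) \<in> cauchy_seqs A"
proof -
  obtain K where K: "0 \<le> K" "\<And>n. vnorm A (f n) \<le> K" using cauchyA_norm_bound[OF f] by metis
  obtain M where M: "0 \<le> M" "\<And>n. vnorm A (g n) \<le> M" using cauchyA_norm_bound[OF g] by metis
  show ?thesis
  proof (rule cauchyA_comparison)
    show "((\<lambda>p. (\<lambda>(m, n). vdist A (f m) (f n)) p * M + K * (\<lambda>(m, n). vdist A (g m) (g n)) p) \<longlongrightarrow> 0)
      (sequentially \<times>\<^sub>F sequentially)"
      using tendsto_add[OF tendsto_mult_right[of "\<lambda>(m, n). vdist A (f m) (f n)" 0 _ M]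
          tendsto_mult_left[of "\<lambda>(m, n). vdist A (g m) (g n)" 0 _ K]] f g
      by (simp add: cauchyA_iff)
    fix m n
    have "vdist A (amult A (f m) (g m)) (amult A (f n) (g n))
       \<le> vdist A (f m) (f n) * vnorm A (g m) + vnorm A (f n) * vdist A (g m) (g n)"
      by (rule A_dist_mult) (use f g cauchyA_carr in auto)
    also have "\<dots> \<le> vdist A (f m) (f n) * M + K * vdist A (g m) (g n)"
      using K M f g cauchyA_carr A_dist_ge0 by (intro add_mono mult_mono) (auto simp: A_norm_ge0)
    finally show "vdist A (amult A (f m) (g m)) (amult A (f n) (g n))
       \<le> (\<lambda>(m, n). vdist A (f m) (f n)) (m, n) * M + K * (\<lambda>(m, n). vdist A (g m) (g n)) (m, n)" by simp
  qed (use cauchyA_carr[OF f] cauchyA_carr[OF g] in \<open>auto intro!: A_mult\<close>)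
qed

lemma carr_completion: "carr (completion A) = cauchy_seqs A // null_rel A"
  by (simp add: completion_def)

lemma completion_cases:
  assumes "P \<in> carr (completion A)"
  obtains f where "f \<in> cauchy_seqs A" "P = cls f"
  using assms by (auto simp: carr_completion elim!: quotientE)

lemma cls_closed: "f \<in> cauchy_seqs A \<Longrightarrow> cls f \<in> carr (completion A)"
  by (auto simp: carr_completion intro: quotientI)

lemma cls_self: "f \<in> cauchy_seqs A \<Longrightarrow> f \<in> cls f"
  using equiv_null_rel by (rule equiv_class_self)

lemma cls_eq: "(f, g) \<in> null_rel A \<Longrightarrow> cls f = cls g"
  by (rule equiv_class_eq[OF equiv_null_rel])

lemma null_rel_add:
  assumes 1: "(f, f') \<in> null_rel A" and 2: "(g, g') \<in> null_rel A"
  shows "(\<lambda>n. vadd A (f n) (g n), \<lambda>n. vadd A (f' n) (g' n)) \<in> null_rel A"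
proof (rule null_relI)
  show "(\<lambda>n. vdist A (f n) (f' n) + vdist A (g n) (g' n)) \<longlonglongrightarrow> 0"
    using tendsto_add[of "\<lambda>n. vdist A (f n) (f' n)" 0 sequentially "\<lambda>n. vdist A (g n) (g' n)" 0]
      null_relD[OF 1] null_relD[OF 2] by simp
qed (use null_relD[OF 1] null_relD[OF 2] in \<open>auto intro!: A_dist_add cauchyA_carr cauchyA_add\<close>)

lemma null_rel_scale:
  assumes 1: "(f, f') \<in> null_rel A"
  shows "(\<lambda>n. vscale A c (f n), \<lambda>n. vscale A c (f' n)) \<in> null_rel A"
proof (rule null_relI)
  show "(\<lambda>n. cmod c * vdist A (f n) (f' n)) \<longlonglongrightarrow> 0"
    using tendsto_mult_left[of "\<lambda>n. vdist A (f n) (f' n)" 0 sequentially "cmod c"] null_relD[OF 1] by simp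
qed (use null_relD[OF 1] in \<open>auto simp: A_dist_scale cauchyA_carr intro!: cauchyA_scale\<close>)

lemma null_rel_mult:
  assumes 1: "(f, f') \<in> null_rel A" and 2: "(g, g') \<in> null_rel A"
  shows "(\<lambda>n. amult A (f n) (g n), \<lambda>n. amult A (f' n) (g' n)) \<in> null_rel A"
proof -
  note D = null_relD[OF 1] null_relD[OF 2]
  obtain K where K: "0 \<le> K" "\<And>n. vnorm A (f' n) \<le> K" using cauchyA_norm_bound[of f'] D by metis
  obtain M where M: "0 \<le> M" "\<And>n. vnorm A (g n) \<le> M" using cauchyA_norm_bound[of g] D by metis
  show ?thesis
  proof (rule null_relI)
    show "(\<lambda>n. vdist A (f n) (f' n) * M + K * vdist A (g n) (g' n)) \<longlonglongrightarrow> 0"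
      using tendsto_add[OF tendsto_mult_right[of "\<lambda>n. vdist A (f n) (f' n)" 0 sequentially M]
          tendsto_mult_left[of "\<lambda>n. vdist A (g n) (g' n)" 0 sequentially K]] D by simp
    fix n
    have "vdist A (amult A (f n) (g n)) (amult A (f' n) (g' n))
       \<le> vdist A (f n) (f' n) * vnorm A (g n) + vnorm A (f' n) * vdist A (g n) (g' n)"
      by (rule A_dist_mult) (use D cauchyA_carr in auto)
    also have "\<dots> \<le> vdist A (f n) (f' n) * M + K * vdist A (g n) (g' n)"
      using K M D cauchyA_carr A_dist_ge0 by (intro add_mono mult_mono) (auto simp: A_norm_ge0)
    finally show "vdist A (amult A (f n) (g n)) (amult A (f' n) (g' n))
       \<le> vdist A (f n) (f' n) * M + K * vdist A (g n) (g' n)" .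
  qed (use D in \<open>auto intro!: cauchyA_mult\<close>)
qed

lemma UN_cls:
  assumes "f \<in> cauchy_seqs A" "\<And>f'. (f, f') \<in> null_rel A \<Longrightarrow> F f' = Q"
  shows "(\<Union>f'\<in>cls f. F f') = Q"
proof -
  have "F ` cls f = {Q}" using assms cls_self[OF assms(1)] by auto
  then show ?thesis by simp
qed

lemma completion_add:
  "\<lbrakk>f \<in> cauchy_seqs A; g \<in> cauchy_seqs A\<rbrakk>
    \<Longrightarrow> vadd (completion A) (cls f) (cls g) = cls (\<lambda>n. vadd A (f n) (g n))"
  unfolding completion_def by (auto intro!: UN_cls cls_eq[symmetric] null_rel_add)

lemma completion_scale:
  "f \<in> cauchy_seqs A \<Longrightarrow> vscale (completion A) c (cls f) = cls (\<lambda>n. vscale A c (f n))"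
  unfolding completion_def by (auto intro!: UN_cls cls_eq[symmetric] null_rel_scale)

lemma completion_mult:
  "\<lbrakk>f \<in> cauchy_seqs A; g \<in> cauchy_seqs A\<rbrakk>
    \<Longrightarrow> amult (completion A) (cls f) (cls g) = cls (\<lambda>n. amult A (f n) (g n))"
  unfolding completion_def by (auto intro!: UN_cls cls_eq[symmetric] null_rel_mult)

text \<open>The limit exists because norms of a Cauchy sequence form a Cauchy sequence of reals, and equivalent sequences
have the same limit.\<close>

lemma completion_norm:
  assumes f: "f \<in> cauchy_seqs A"
  shows "(\<lambda>n. vnorm A (f n)) \<longlonglongrightarrow> vnorm (completion A) (cls f)"
proof -
  obtain l where l: "(\<lambda>n. vnorm A (f n)) \<longlonglongrightarrow> l"
    using cauchyA_norm_bound[OF f] by (metis convergent_def)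
  have "(\<lambda>n. vnorm A (g n)) \<longlonglongrightarrow> l" if "g \<in> cls f" for g
  proof -
    have D: "f \<in> cauchy_seqs A" "g \<in> cauchy_seqs A" "(\<lambda>n. vdist A (f n) (g n)) \<longlonglongrightarrow> 0"
      using that null_relD by auto
    have "(\<lambda>n. vnorm A (g n) - vnorm A (f n)) \<longlonglongrightarrow> 0"
      by (rule Lim_null_comparison[OF _ D(3)])
        (use A_norm_diff D(1,2) cauchyA_carr in \<open>auto simp: abs_minus_commute\<close>)
    from tendsto_add[OF this l] show ?thesis by simp
  qed
  then have "(THE l. \<forall>g\<in>cls f. (\<lambda>n. vnorm A (g n)) \<longlonglongrightarrow> l) = l"
    by (intro the_equality) (use cls_self[OF f] LIMSEQ_unique in blast)+
  then show ?thesis using l by (simp add: completion_def)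
qed

lemma const_cauchy: "a \<in> carr A \<Longrightarrow> (\<lambda>n. a) \<in> cauchy_seqs A"
  by (simp add: cauchyA_iff A_dist_self case_prod_unfold)

end

text \<open>A second representation \<open>\<rho>\<close>, on a complete space, which is contractive for the norm defined by \<open>\<rho>0\<close>.\<close>

locale rep_extension = op_normed_alg A V0 \<rho>0 + V: cnormed V
  for A :: "'a cnalg" and V0 :: "('v, 'm) cnspace_scheme" and \<rho>0 :: "'a \<Rightarrow> 'v \<Rightarrow> 'v"
    and V :: "('w, 'n) cnspace_scheme" and \<rho> :: "'a \<Rightarrow> 'w \<Rightarrow> 'w" +
  assumes complete: "vcomplete V"
    and rho_closed: "a \<in> carr A \<Longrightarrow> \<rho> a \<in> carr (bops V V)"
    and rho_add: "\<lbrakk>a \<in> carr A; b \<in> carr A\<rbrakk> \<Longrightarrow> \<rho> (vadd A a b) = vadd (bops V V) (\<rho> a) (\<rho> b)"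
    and rho_scale: "a \<in> carr A \<Longrightarrow> \<rho> (vscale A c a) = vscale (bops V V) c (\<rho> a)"
    and rho_mult: "\<lbrakk>a \<in> carr A; b \<in> carr A\<rbrakk> \<Longrightarrow> \<rho> (amult A a b) = compose (carr V) (\<rho> a) (\<rho> b)"
    and rho_norm: "a \<in> carr A \<Longrightarrow> vnorm (bops V V) (\<rho> a) \<le> vnorm A a"
begin

sublocale T: cnormed_triple V V V by unfold_locales

abbreviation B where "B \<equiv> bops V V"

text \<open>The description has the form used for \<open>Fred_rep\<close>, so that for \<open>\<rho> = lreg_sum p H\<close> the two agree.\<close>

definition extension :: "(nat \<Rightarrow> 'a) set \<Rightarrow> 'w \<Rightarrow> 'w" where
  "extension P = (THE L. L \<in> carr B \<and> (\<forall>f\<in>P. vtends B (\<lambda>n. \<rho> (f n)) L))"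

lemma rho_dist: "\<lbrakk>a \<in> carr A; b \<in> carr A\<rbrakk> \<Longrightarrow> vdist B (\<rho> a) (\<rho> b) \<le> vdist A a b"
  unfolding vdist_def
  using rho_norm[of "vadd A a (vscale A (-1) b)"] by (simp only: rho_add rho_scale A_add A_scale)

lemma extension_cls:
  assumes f: "f \<in> cauchy_seqs A"
  shows "extension (cls f) \<in> carr B" "vtends B (\<lambda>n. \<rho> (f n)) (extension (cls f))"
proof -
  have fc: "f n \<in> carr A" for n using f by (rule cauchyA_carr)
  have "(\<lambda>n. \<rho> (f n)) \<in> cauchy_seqs B"
    
  proof (rule cauchy_seqs_iff[of B, OF T.UV.B.dist_ge0, THEN iffD2], assumption, assumption, intro conjI allI)
    show "\<rho> (f n) \<in> carr B" for n by (rule rho_closed[OF fc])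
    show "((\<lambda>(m, n). vdist B (\<rho> (f m)) (\<rho> (f n))) \<longlongrightarrow> 0) (sequentially \<times>\<^sub>F sequentially)"
      by (rule Lim_null_comparison[of _ "\<lambda>(m, n). vdist A (f m) (f n)"])
        (use f in \<open>auto simp: cauchyA_iff T.UV.B.dist_ge0 rho_closed intro!: rho_dist always_eventually\<close>)
  qed
  then obtain L where L: "L \<in> carr B" "vtends B (\<lambda>n. \<rho> (f n)) L"
    using T.UV.vcomplete_bops[OF complete] unfolding vcomplete_def by blast
  have "vtends B (\<lambda>n. \<rho> (g n)) L" if "g \<in> cls f" for g
  proof (rule T.UV.B.vtends_close[OF _ _ L])
    have D: "g \<in> cauchy_seqs A" "(\<lambda>n. vdist A (f n) (g n)) \<longlonglongrightarrow> 0" using that null_relD by auto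
    then show "\<rho> (g n) \<in> carr B" for n using rho_closed cauchyA_carr by blast
    show "\<rho> (f n) \<in> carr B" for n by (rule rho_closed[OF fc])
    show "(\<lambda>n. vdist B (\<rho> (f n)) (\<rho> (g n))) \<longlonglongrightarrow> 0"
      by (rule Lim_null_comparison[OF _ D(2)])
        (use D(1) fc cauchyA_carr in \<open>auto simp: T.UV.B.dist_ge0 rho_closed rho_dist\<close>)
  qed
  then have "extension (cls f) = L" unfolding extension_def
  proof (intro the_equality)
    fix M assume "M \<in> carr B \<and> (\<forall>f\<in>cls f. vtends B (\<lambda>n. \<rho> (f n)) M)"
    then show "M = L" using T.UV.B.vtends_unique[of "\<lambda>n. \<rho> (f n)" M L] L fc rho_closed cls_self[OF f] by blast
  qed (use L in blast)
  then show "extension (cls f) \<in> carr B" "vtends B (\<lambda>n. \<rho> (f n)) (extension (cls f))" using L by simp_all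
qed

lemma extension_closed: "P \<in> carr (completion A) \<Longrightarrow> extension P \<in> carr B"
  by (metis completion_cases extension_cls(1))

lemma extension_unique:
  assumes "f \<in> cauchy_seqs A" "L \<in> carr B" "vtends B (\<lambda>n. \<rho> (f n)) L"
  shows "extension (cls f) = L"
  using T.UV.B.vtends_unique[OF _ extension_cls(1)[OF assms(1)] assms(2) extension_cls(2)[OF assms(1)] assms(3)]
    assms(1) rho_closed cauchyA_carr by blast

lemma extension_add:
  assumes "P \<in> carr (completion A)" "Q \<in> carr (completion A)"
  shows "vadd (completion A) P Q \<in> carr (completion A)"
    "extension (vadd (completion A) P Q) = vadd B (extension P) (extension Q)"
proof -
  obtain f where f: "f \<in> cauchy_seqs A" "P = cls f" using assms(1) by (rule completion_cases)
  obtain g where g: "g \<in> cauchy_seqs A" "Q = cls g" using assms(2) by (rule completion_cases)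
  have S: "vadd (completion A) P Q = cls (\<lambda>n. vadd A (f n) (g n))"
    using f g completion_add by simp
  show "vadd (completion A) P Q \<in> carr (completion A)"
    unfolding S by (rule cls_closed[OF cauchyA_add[OF f(1) g(1)]])
  show "extension (vadd (completion A) P Q) = vadd B (extension P) (extension Q)"
    unfolding S
  proof (rule extension_unique[OF cauchyA_add[OF f(1) g(1)]])
    show "vadd B (extension P) (extension Q) \<in> carr B" using assms by (intro T.UV.B.add_closed extension_closed)
    have "vtends B (\<lambda>n. vadd B (\<rho> (f n)) (\<rho> (g n))) (vadd B (extension P) (extension Q))"
      using f g by (intro T.UV.B.vtends_add) (simp_all only: extension_cls rho_closed cauchyA_carr)
    then show "vtends B (\<lambda>n. \<rho> (vadd A (f n) (g n))) (vadd B (extension P) (extension Q))"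
      using rho_add[OF cauchyA_carr[OF f(1)] cauchyA_carr[OF g(1)]] by simp
  qed
qed

lemma extension_scale:
  assumes "P \<in> carr (completion A)"
  shows "vscale (completion A) c P \<in> carr (completion A)"
    "extension (vscale (completion A) c P) = vscale B c (extension P)"
proof -
  obtain f where f: "f \<in> cauchy_seqs A" "P = cls f" using assms(1) by (rule completion_cases)
  have S: "vscale (completion A) c P = cls (\<lambda>n. vscale A c (f n))"
    using f completion_scale by simp
  show "vscale (completion A) c P \<in> carr (completion A)"
    unfolding S by (rule cls_closed[OF cauchyA_scale[OF f(1)]])
  show "extension (vscale (completion A) c P) = vscale B c (extension P)"
    unfolding S
  proof (rule extension_unique[OF cauchyA_scale[OF f(1)]])
    show "vscale B c (extension P) \<in> carr B" using assms by (intro T.UV.B.scale_closed extension_closed)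
    have "vtends B (\<lambda>n. vscale B c (\<rho> (f n))) (vscale B c (extension P))"
      using f by (intro T.UV.B.vtends_scale) (simp_all only: extension_cls rho_closed cauchyA_carr)
    then show "vtends B (\<lambda>n. \<rho> (vscale A c (f n))) (vscale B c (extension P))"
      using rho_scale[OF cauchyA_carr[OF f(1)]] by simp
  qed
qed

text \<open>Products converge since one factor is bounded along a Cauchy sequence.\<close>

lemma extension_mult:
  assumes "P \<in> carr (completion A)" "Q \<in> carr (completion A)"
  shows "extension (amult (completion A) P Q) = compose (carr V) (extension P) (extension Q)"
proof -
  obtain f where f: "f \<in> cauchy_seqs A" "P = cls f" using assms(1) by (rule completion_cases)
  obtain g where g: "g \<in> cauchy_seqs A" "Q = cls g" using assms(2) by (rule completion_cases)
  have S: "amult (completion A) P Q = cls (\<lambda>n. amult A (f n) (g n))"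
    using f g completion_mult by simp
  have L: "extension P \<in> carr B" "extension Q \<in> carr B" using assms by (auto intro: extension_closed)
  have r: "\<rho> (f n) \<in> carr B" "\<rho> (g n) \<in> carr B" for n
    using f g rho_closed cauchyA_carr by blast+
  obtain K where K: "0 \<le> K" "\<And>n. vnorm A (g n) \<le> K" using cauchyA_norm_bound[OF g(1)] by metis
  show ?thesis
    unfolding S
  proof (rule extension_unique[OF cauchyA_mult[OF f(1) g(1)]])
    show c: "compose (carr V) (extension P) (extension Q) \<in> carr B" by (rule T.compose_closed[OF L])
    have "vtends B (\<lambda>n. compose (carr V) (\<rho> (f n)) (\<rho> (g n))) (compose (carr V) (extension P) (extension Q))"
      unfolding vtends_def
    proof (rule Lim_null_comparison)
      show "(\<lambda>n. vdist B (\<rho> (f n)) (extension P) * K + vnorm B (extension P) * vdist B (\<rho> (g n)) (extension Q)) \<longlonglongrightarrow> 0"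
        using tendsto_add[OF tendsto_mult_right[of "\<lambda>n. vdist B (\<rho> (f n)) (extension P)" 0 sequentially K]
            tendsto_mult_left[of "\<lambda>n. vdist B (\<rho> (g n)) (extension Q)" 0 sequentially "vnorm B (extension P)"]]
          extension_cls(2)[OF f(1)] extension_cls(2)[OF g(1)] f(2) g(2) by (simp add: vtends_def)
      show "\<forall>\<^sub>F n in sequentially. norm (vdist B (compose (carr V) (\<rho> (f n)) (\<rho> (g n)))
          (compose (carr V) (extension P) (extension Q)))
        \<le> vdist B (\<rho> (f n)) (extension P) * K + vnorm B (extension P) * vdist B (\<rho> (g n)) (extension Q)"
      proof (rule always_eventually, rule allI)
        fix n
        let ?a = "compose (carr V) (\<rho> (f n)) (\<rho> (g n))" and ?b = "compose (carr V) (extension P) (\<rho> (g n))"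
          and ?c = "compose (carr V) (extension P) (extension Q)"
        have "vdist B ?a ?c \<le> vdist B ?a ?b + vdist B ?b ?c"
          using r L by (intro T.UV.B.dist_triangle T.compose_closed)
        also have "\<dots> \<le> vdist B (\<rho> (f n)) (extension P) * vnorm B (\<rho> (g n)) + vnorm B (extension P) * vdist B (\<rho> (g n)) (extension Q)"
          using r L by (intro add_mono T.compose_dist_left T.compose_dist_right)
        also have "\<dots> \<le> vdist B (\<rho> (f n)) (extension P) * K + vnorm B (extension P) * vdist B (\<rho> (g n)) (extension Q)"
          using rho_norm[OF cauchyA_carr[OF g(1)], of n] K(2)[of n] r L
          by (intro add_right_mono mult_left_mono) (auto simp: T.UV.B.dist_ge0)
        finally show "norm (vdist B ?a ?c)
            \<le> vdist B (\<rho> (f n)) (extension P) * K + vnorm B (extension P) * vdist B (\<rho> (g n)) (extension Q)"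
          using r L by (simp add: T.UV.B.dist_ge0 T.compose_closed)
      qed
    qed
    then show "vtends B (\<lambda>n. \<rho> (amult A (f n) (g n))) (compose (carr V) (extension P) (extension Q))"
      using rho_mult[OF cauchyA_carr[OF f(1)] cauchyA_carr[OF g(1)]] by simp
  qed
qed

lemma extension_norm:
  assumes "P \<in> carr (completion A)"
  shows "vnorm B (extension P) \<le> vnorm (completion A) P"
proof -
  obtain f where f: "f \<in> cauchy_seqs A" "P = cls f" using assms(1) by (rule completion_cases)
  have "(\<lambda>n. vnorm B (\<rho> (f n))) \<longlonglongrightarrow> vnorm B (extension P)"
    using f extension_cls rho_closed cauchyA_carr by (intro T.UV.B.vtends_norm) auto
  then show ?thesis
    by (rule LIMSEQ_le[OF _ completion_norm[OF f(1), folded f(2)]])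
      (use rho_norm cauchyA_carr[OF f(1)] in auto)
qed

lemma extension_embed: "a \<in> carr A \<Longrightarrow> extension (completion_embed A a) = \<rho> a"
  unfolding completion_embed_def
  by (rule extension_unique[OF const_cauchy])
    (simp_all add: rho_closed vtends_def T.UV.B.dist_self)

lemma extension_in_vclosure:
  assumes "P \<in> carr (completion A)"
  shows "extension P \<in> vclosure B (\<rho> ` carr A)"
proof -
  obtain f where f: "f \<in> cauchy_seqs A" "P = cls f" using assms(1) by (rule completion_cases)
  have sub: "\<rho> ` carr A \<subseteq> carr B" using rho_closed by blast
  show ?thesis
  proof (rule T.UV.B.vclosureI_seq[OF _ _ _ sub])
    show "\<rho> (f n) \<in> vclosure B (\<rho> ` carr A)" for n
      using T.UV.B.vclosure_superset[OF sub] cauchyA_carr[OF f(1)] by blast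
  qed (use f extension_cls in auto)
qed

end

section \<open>Spaces of summable functions\<close>

text \<open>Convexity on the open half line, together with the boundary cases, where it reads \<open>s\<^sup>p \<le> s\<close> on the unit
interval.\<close>

lemma convex_powr_nonneg:
  fixes x y t p :: real
  assumes "1 \<le> p" "0 \<le> x" "0 \<le> y" "0 \<le> t" "t \<le> 1"
  shows "(t * x + (1 - t) * y) powr p \<le> t * x powr p + (1 - t) * y powr p"
proof -
  have sub: "s powr p \<le> s" if "0 \<le> s" "s \<le> 1" for s :: real
    using powr_mono'[of 1 p s] that assms(1) by simp
  consider "x = 0" | "y = 0" | "x > 0" "y > 0" using assms by force
  then show ?thesis
  proof cases
    case 1
    then show ?thesis using assms sub[of "1 - t"] by (simp add: powr_mult mult_right_mono)
  next
    case 2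
    then show ?thesis using assms sub[of t] by (simp add: powr_mult mult_right_mono)
  next
    case 3
    then show ?thesis
      using convex_onD[OF powr_convex[OF assms(1)] assms(4,5), of y x] by (simp add: add.commute)
  qed
qed

text \<open>The function \<open>(f + g) / (a + b)\<close> is a convex combination of \<open>f / a\<close> and \<open>g / b\<close>, so convexity of the power
gives the claim termwise.\<close>

lemma minkowski_finite:
  fixes f g :: "'a \<Rightarrow> real"
  assumes p: "1 \<le> p" and fin: "finite F" and f0: "\<And>x. x \<in> F \<Longrightarrow> 0 \<le> f x" and g0: "\<And>x. x \<in> F \<Longrightarrow> 0 \<le> g x"
    and a: "0 \<le> a" and b: "0 \<le> b"
    and fa: "(\<Sum>x\<in>F. f x powr p) \<le> a powr p" and gb: "(\<Sum>x\<in>F. g x powr p) \<le> b powr p"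
  shows "(\<Sum>x\<in>F. (f x + g x) powr p) \<le> (a + b) powr p"
proof -
  have zero: "h x = 0" if "(\<Sum>x\<in>F. h x powr p) \<le> 0 powr p" "x \<in> F" for h :: "'a \<Rightarrow> real" and x
  proof -
    have "(\<Sum>x\<in>F. h x powr p) = 0" using that(1) by (simp add: sum_nonneg antisym)
    then show ?thesis using sum_nonneg_eq_0_iff[OF fin, of "\<lambda>x. h x powr p"] that(2) by simp
  qed
  consider "a = 0" | "b = 0" | "a > 0" "b > 0" using a b by force
  then show ?thesis
  proof cases
    case 1
    then have "\<And>x. x \<in> F \<Longrightarrow> f x = 0" using zero[of f] fa by simp
    then show ?thesis using gb 1 by simp
  next
    case 2
    then have "\<And>x. x \<in> F \<Longrightarrow> g x = 0" using zero[of g] gb by simp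
    then show ?thesis using fa 2 by simp
  next
    case 3
    \<comment> \<open>the weight that makes both terms of the convex combination have norm at most one\<close>
    define t where "t = a / (a + b)"
    have t: "0 \<le> t" "t \<le> 1" "1 - t = b / (a + b)" using 3 by (auto simp: t_def field_simps)
    have pt: "(f x + g x) powr p \<le> (a + b) powr p * (t * (f x powr p / a powr p) + (1 - t) * (g x powr p / b powr p))"
      if x: "x \<in> F" for x
    proof -
      have "f x + g x = (a + b) * (t * (f x / a) + (1 - t) * (g x / b))"
      proof -
        have "t * (f x / a) = f x / (a + b)" "(1 - t) * (g x / b) = g x / (a + b)"
          using t(3) 3 unfolding t_def by auto
        then show ?thesis using 3 by (simp add: add_divide_distrib[symmetric])
      qed
      then have "(f x + g x) powr p = (a + b) powr p * (t * (f x / a) + (1 - t) * (g x / b)) powr p"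
        using 3 t f0[OF x] g0[OF x] by (simp add: powr_mult)
      also have "\<dots> \<le> (a + b) powr p * (t * (f x / a) powr p + (1 - t) * (g x / b) powr p)"
        using 3 t f0[OF x] g0[OF x] p by (intro mult_left_mono convex_powr_nonneg) auto
      finally show ?thesis using 3 f0[OF x] g0[OF x] by (simp add: powr_divide)
    qed
    have "(\<Sum>x\<in>F. (f x + g x) powr p)
       \<le> (\<Sum>x\<in>F. (a + b) powr p * (t * (f x powr p / a powr p) + (1 - t) * (g x powr p / b powr p)))"
      by (rule sum_mono[OF pt])
    also have "\<dots> = (a + b) powr p * (t * ((\<Sum>x\<in>F. f x powr p) / a powr p) + (1 - t) * ((\<Sum>x\<in>F. g x powr p) / b powr p))"
      by (simp add: sum_distrib_left[symmetric] sum.distrib sum_divide_distrib[symmetric])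
    also have "\<dots> \<le> (a + b) powr p * (t * 1 + (1 - t) * 1)"
      using fa gb 3 t by (intro mult_left_mono add_mono) (auto simp: divide_le_eq)
    finally show ?thesis by simp
  qed
qed

text \<open>The bound \<open>\<parallel>f\<parallel>\<^sub>p \<le> C\<close> on \<open>X\<close>, expressed by finite sums. It says at once that \<open>f\<close> is \<open>p\<close>-summable and
that its norm is at most \<open>C\<close>, which avoids infinite sums and treats all exponents alike.\<close>

definition lp_le :: "ennreal \<Rightarrow> 'a set \<Rightarrow> ('a \<Rightarrow> complex) \<Rightarrow> real \<Rightarrow> bool" where
  "lp_le p X f C \<longleftrightarrow> (if p = \<infinity> then \<forall>x\<in>X. cmod (f x) \<le> C
     else \<forall>F. finite F \<and> F \<subseteq> X \<longrightarrow> (\<Sum>x\<in>F. cmod (f x) powr enn2real p) \<le> C powr enn2real p)"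

lemma enn2real_ge1: "1 \<le> p \<Longrightarrow> p \<noteq> \<infinity> \<Longrightarrow> 1 \<le> enn2real p"
  using enn2real_mono[of 1 p] by (simp add: less_top[symmetric])

lemma lp_le_point:
  assumes "1 \<le> p" "0 \<le> C" "lp_le p X f C" "x \<in> X" shows "cmod (f x) \<le> C"
proof (cases "p = \<infinity>")
  case True then show ?thesis using assms by (simp add: lp_le_def)
next
  case False
  then have "cmod (f x) powr enn2real p \<le> C powr enn2real p"
    using assms(3,4) unfolding lp_le_def by (auto dest!: spec[of _ "{x}"])
  then show ?thesis using enn2real_ge1[OF assms(1) False] assms(2)
    by (metis linorder_not_le norm_ge_zero powr_less_mono2 zero_less_one_class.zero_less_one less_le_trans)
qed

lemma lp_le_mono:
  assumes "1 \<le> p" "0 \<le> C" "C \<le> D" "lp_le p X f C" shows "lp_le p X f D"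
proof -
  have "C powr enn2real p \<le> D powr enn2real p" using assms by (intro powr_mono2) auto
  then show ?thesis using assms(3,4) unfolding lp_le_def by (smt (verit))
qed

lemma lp_le_subset: "lp_le p X f C \<Longrightarrow> Y \<subseteq> X \<Longrightarrow> lp_le p Y f C"
  unfolding lp_le_def by (auto split: if_splits)

lemma lp_le_cong: "(\<And>x. x \<in> X \<Longrightarrow> cmod (f x) = cmod (g x)) \<Longrightarrow> lp_le p X f C \<longleftrightarrow> lp_le p X g C"
  unfolding lp_le_def by (auto simp: subset_iff cong: sum.cong)

lemma cut_apply: "x \<in> A \<Longrightarrow> cut A f x = f x"
  by (simp add: cut_def)

lemma lp_le_cut: "lp_le p X (cut X f) C \<longleftrightarrow> lp_le p X f C"
  by (rule lp_le_cong) (simp add: cut_def)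

lemma lp_le_sumD:
  "\<lbrakk>lp_le p X f C; p \<noteq> \<infinity>; finite F; F \<subseteq> X\<rbrakk>
    \<Longrightarrow> (\<Sum>x\<in>F. cmod (f x) powr enn2real p) \<le> C powr enn2real p"
  by (simp add: lp_le_def)

lemma lp_le_extend:
  assumes Y: "Y \<subseteq> X" and 0: "\<And>x. x \<notin> Y \<Longrightarrow> f x = 0" and C: "0 \<le> C" and le: "lp_le p Y f C"
  shows "lp_le p X f C"
proof (cases "p = \<infinity>")
  case True
  have "cmod (f x) \<le> C" for x using le 0[of x] C True by (cases "x \<in> Y") (auto simp: lp_le_def)
  then show ?thesis using True by (simp add: lp_le_def)
next
  case False
  have "(\<Sum>x\<in>F. cmod (f x) powr enn2real p) \<le> C powr enn2real p" if F: "finite F" "F \<subseteq> X" for F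
  proof -
    have "(\<Sum>x\<in>F. cmod (f x) powr enn2real p) = (\<Sum>x\<in>F \<inter> Y. cmod (f x) powr enn2real p)"
      using F 0 by (intro sum.mono_neutral_right) auto
    also have "\<dots> \<le> C powr enn2real p" by (rule lp_le_sumD[OF le False]) (use F in auto)
    finally show ?thesis .
  qed
  then show ?thesis using False by (simp add: lp_le_def)
qed

lemma lp_le_add:
  assumes "1 \<le> p" "0 \<le> a" "0 \<le> b" "lp_le p X f a" "lp_le p X g b"
  shows "lp_le p X (\<lambda>x. f x + g x) (a + b)"
proof (cases "p = \<infinity>")
  case True
  then show ?thesis using assms unfolding lp_le_def
    by (auto intro: order_trans[OF norm_triangle_ineq] add_mono)
next
  case False
  have "(\<Sum>x\<in>F. cmod (f x + g x) powr enn2real p) \<le> (a + b) powr enn2real p" if F: "finite F" "F \<subseteq> X" for F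
  proof -
    have "(\<Sum>x\<in>F. cmod (f x + g x) powr enn2real p) \<le> (\<Sum>x\<in>F. (cmod (f x) + cmod (g x)) powr enn2real p)"
      using enn2real_ge1[OF assms(1) False] by (intro sum_mono powr_mono2) (auto simp: norm_triangle_ineq)
    also have "\<dots> \<le> (a + b) powr enn2real p"
      by (rule minkowski_finite[OF enn2real_ge1[OF assms(1) False] F(1)])
        (use assms F False in \<open>auto simp: lp_le_def\<close>)
    finally show ?thesis .
  qed
  then show ?thesis using False by (simp add: lp_le_def)
qed

lemma lp_le_scale:
  assumes "1 \<le> p" "0 \<le> a" "lp_le p X f a"
  shows "lp_le p X (\<lambda>x. c * f x) (cmod c * a)"
  using assms unfolding lp_le_def
  by (auto simp: norm_mult powr_mult sum_distrib_left[symmetric] intro!: mult_left_mono)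

lemma lp_le_limit:
  assumes "1 \<le> p" "\<And>n. n \<ge> N \<Longrightarrow> lp_le p X (h n) C" "\<And>x. x \<in> X \<Longrightarrow> (\<lambda>n. h n x) \<longlonglongrightarrow> g x"
  shows "lp_le p X g C"
proof (cases "p = \<infinity>")
  case True
  then show ?thesis using assms(2) unfolding lp_le_def
    by (auto intro!: LIMSEQ_le_const2[OF tendsto_norm[OF assms(3)]])
next
  case False
  have "(\<Sum>x\<in>F. cmod (g x) powr enn2real p) \<le> C powr enn2real p" if F: "finite F" "F \<subseteq> X" for F
  proof (rule LIMSEQ_le_const2)
    show "(\<lambda>n. \<Sum>x\<in>F. cmod (h n x) powr enn2real p) \<longlonglongrightarrow> (\<Sum>x\<in>F. cmod (g x) powr enn2real p)"
      using F assms(3) enn2real_ge1[OF assms(1) False]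
      by (intro tendsto_sum tendsto_powr' tendsto_norm tendsto_const) auto
    show "\<exists>N. \<forall>n\<ge>N. (\<Sum>x\<in>F. cmod (h n x) powr enn2real p) \<le> C powr enn2real p"
      using assms(2) F False unfolding lp_le_def by auto
  qed
  then show ?thesis using False by (simp add: lp_le_def)
qed

lemma lp_sel [simp]:
  "vadd (lp p X) = (\<lambda>f g x. f x + g x)" "vscale (lp p X) = (\<lambda>c f x. c * f x)"
  by (simp_all add: lp_def)

lemma lp_norm_ge0: "f \<in> carr (lp p X) \<Longrightarrow> 0 \<le> vnorm (lp p X) f"
  by (auto simp: lp_def intro!: cSup_upper)

lemma lp_mem_iff:
  assumes p: "1 \<le> p" and C: "0 \<le> C"
  shows "f \<in> carr (lp p X) \<and> vnorm (lp p X) f \<le> C \<longleftrightarrow> (\<forall>x. x \<notin> X \<longrightarrow> f x = 0) \<and> lp_le p X f C"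
proof (cases "p = \<infinity>")
  case True
  have "bdd_above ((\<lambda>x. cmod (f x)) ` X) \<and> Sup (insert 0 ((\<lambda>x. cmod (f x)) ` X)) \<le> C
    \<longleftrightarrow> (\<forall>x\<in>X. cmod (f x) \<le> C)"
  proof (intro iffI conjI ballI)
    fix x assume a: "bdd_above ((\<lambda>x. cmod (f x)) ` X) \<and> Sup (insert 0 ((\<lambda>x. cmod (f x)) ` X)) \<le> C" "x \<in> X"
    then have "cmod (f x) \<le> Sup (insert 0 ((\<lambda>x. cmod (f x)) ` X))" by (intro cSup_upper) auto
    then show "cmod (f x) \<le> C" using a by linarith
  next
    assume a: "\<forall>x\<in>X. cmod (f x) \<le> C"
    then show "bdd_above ((\<lambda>x. cmod (f x)) ` X)" by (intro bdd_aboveI[of _ C]) auto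
    show "Sup (insert 0 ((\<lambda>x. cmod (f x)) ` X)) \<le> C" using a C by (intro cSup_least) auto
  qed
  then show ?thesis using True by (simp add: lp_def lp_le_def)
next
  case False
  define r where "r = enn2real p"
  have r: "1 \<le> r" using enn2real_ge1[OF p False] by (simp add: r_def)
  let ?I = "\<Sum>\<^sub>\<infinity>x\<in>X. cmod (f x) powr r"
  have I0: "0 \<le> ?I" by (rule infsum_nonneg) simp
  have root: "?I powr (1 / r) \<le> C \<longleftrightarrow> ?I \<le> C powr r"
  proof
    assume "?I powr (1 / r) \<le> C"
    then have "(?I powr (1 / r)) powr r \<le> C powr r" using r by (intro powr_mono2) auto
    then show "?I \<le> C powr r" using r I0 by (simp add: powr_powr)
  next
    assume "?I \<le> C powr r"
    then have "?I powr (1 / r) \<le> (C powr r) powr (1 / r)" using r I0 by (intro powr_mono2) auto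
    then show "?I powr (1 / r) \<le> C" using r C by (simp add: powr_powr)
  qed
  have "(\<lambda>x. cmod (f x) powr r) summable_on X \<and> ?I \<le> C powr r
     \<longleftrightarrow> (\<forall>F. finite F \<and> F \<subseteq> X \<longrightarrow> (\<Sum>x\<in>F. cmod (f x) powr r) \<le> C powr r)"
  proof (intro iffI conjI allI impI)
    fix F assume "(\<lambda>x. cmod (f x) powr r) summable_on X \<and> ?I \<le> C powr r" "finite F \<and> F \<subseteq> X"
    then show "(\<Sum>x\<in>F. cmod (f x) powr r) \<le> C powr r"
      using finite_sum_le_infsum[of "\<lambda>x. cmod (f x) powr r" X F] by auto
  next
    assume a: "\<forall>F. finite F \<and> F \<subseteq> X \<longrightarrow> (\<Sum>x\<in>F. cmod (f x) powr r) \<le> C powr r"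
    then show s: "(\<lambda>x. cmod (f x) powr r) summable_on X"
      by (intro nonneg_bdd_above_summable_on bdd_aboveI[of _ "C powr r"]) auto
    show "?I \<le> C powr r" using a by (intro infsum_le_finite_sums[OF s]) auto
  qed
  then show ?thesis using False root by (simp add: lp_def lp_le_def r_def)
qed

text \<open>Equality of records would be too much to ask of \<open>lp_sum\<close>, because the norms of \<open>lp\<close> and \<open>lp_sum\<close> may disagree on functions outside the
carrier.\<close>

definition is_lp :: "ennreal \<Rightarrow> 'a set \<Rightarrow> ('a \<Rightarrow> complex) cnspace \<Rightarrow> bool" where
  "is_lp p X V \<longleftrightarrow> carr V = carr (lp p X) \<and> vadd V = vadd (lp p X) \<and> vscale V = vscale (lp p X) \<and>
     (\<forall>f\<in>carr (lp p X). vnorm V f = vnorm (lp p X) f)"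

lemma is_lp_lp: "is_lp p X (lp p X)" by (simp add: is_lp_def)

lemma is_lp_sel:
  assumes "is_lp p X V"
  shows "vadd V = (\<lambda>f g x. f x + g x)" "vscale V = (\<lambda>c f x. c * f x)"
  using assms by (simp_all add: is_lp_def)

lemma is_lp_iff:
  assumes "is_lp p X V" "1 \<le> p" "0 \<le> C"
  shows "f \<in> carr V \<and> vnorm V f \<le> C \<longleftrightarrow> (\<forall>x. x \<notin> X \<longrightarrow> f x = 0) \<and> lp_le p X f C"
  using lp_mem_iff[OF assms(2,3), of f X] assms(1) by (auto simp: is_lp_def)

lemma is_lp_ge0: "is_lp p X V \<Longrightarrow> f \<in> carr V \<Longrightarrow> 0 \<le> vnorm V f"
  by (simp add: is_lp_def lp_norm_ge0)

lemma is_lp_le: "is_lp p X V \<Longrightarrow> 1 \<le> p \<Longrightarrow> f \<in> carr V \<Longrightarrow> lp_le p X f (vnorm V f)"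
  using is_lp_iff[of p X V "vnorm V f" f] is_lp_ge0[of p X V f] by blast

lemma is_lp_zero: "is_lp p X V \<Longrightarrow> f \<in> carr V \<Longrightarrow> x \<notin> X \<Longrightarrow> f x = 0"
  by (auto simp: is_lp_def lp_def)

lemma is_lp_mem: "is_lp p X V \<Longrightarrow> 1 \<le> p \<Longrightarrow> 0 \<le> C \<Longrightarrow> (\<And>x. x \<notin> X \<Longrightarrow> f x = 0) \<Longrightarrow> lp_le p X f C
    \<Longrightarrow> f \<in> carr V"
  and is_lp_norm_le: "is_lp p X V \<Longrightarrow> 1 \<le> p \<Longrightarrow> 0 \<le> C \<Longrightarrow> (\<And>x. x \<notin> X \<Longrightarrow> f x = 0) \<Longrightarrow> lp_le p X f C
    \<Longrightarrow> vnorm V f \<le> C"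
  using is_lp_iff[of p X V C f] by blast+

lemma lp_zero_closed: "1 \<le> p \<Longrightarrow> (\<lambda>x. 0) \<in> carr (lp p X)"
  by (auto simp: lp_def)

lemma cnormed_lp:
  assumes p: "1 \<le> p" shows "cnormed (lp p X)"
proof -
  note L = is_lp_lp[of p X]
  have scale: "(\<lambda>x. c * f x) \<in> carr (lp p X)" "vnorm (lp p X) (\<lambda>x. c * f x) \<le> cmod c * vnorm (lp p X) f"
    if f: "f \<in> carr (lp p X)" for c f
  proof -
    have *: "lp_le p X (\<lambda>x. c * f x) (cmod c * vnorm (lp p X) f)"
      by (rule lp_le_scale[OF p lp_norm_ge0[OF f] is_lp_le[OF L p f]])
    show "(\<lambda>x. c * f x) \<in> carr (lp p X)"
      by (rule is_lp_mem[OF L p _ _ *]) (use lp_norm_ge0[OF f] is_lp_zero[OF L f] in auto)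
    show "vnorm (lp p X) (\<lambda>x. c * f x) \<le> cmod c * vnorm (lp p X) f"
      by (rule is_lp_norm_le[OF L p _ _ *]) (use lp_norm_ge0[OF f] is_lp_zero[OF L f] in auto)
  qed
  have add: "(\<lambda>x. f x + g x) \<in> carr (lp p X)"
      "vnorm (lp p X) (\<lambda>x. f x + g x) \<le> vnorm (lp p X) f + vnorm (lp p X) g"
    if f: "f \<in> carr (lp p X)" and g: "g \<in> carr (lp p X)" for f g
  proof -
    have *: "lp_le p X (\<lambda>x. f x + g x) (vnorm (lp p X) f + vnorm (lp p X) g)"
      by (rule lp_le_add[OF p lp_norm_ge0[OF f] lp_norm_ge0[OF g] is_lp_le[OF L p f] is_lp_le[OF L p g]])
    show "(\<lambda>x. f x + g x) \<in> carr (lp p X)"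
      by (rule is_lp_mem[OF L p _ _ *])
        (use lp_norm_ge0[OF f] lp_norm_ge0[OF g] is_lp_zero[OF L f] is_lp_zero[OF L g] in auto)
    show "vnorm (lp p X) (\<lambda>x. f x + g x) \<le> vnorm (lp p X) f + vnorm (lp p X) g"
      by (rule is_lp_norm_le[OF L p _ _ *])
        (use lp_norm_ge0[OF f] lp_norm_ge0[OF g] is_lp_zero[OF L f] is_lp_zero[OF L g] in auto)
  qed
  show ?thesis
  proof
    show "carr (lp p X) \<noteq> {}" using lp_zero_closed[OF p] by blast
  next
    fix f c assume f: "f \<in> carr (lp p X)"
    show "vnorm (lp p X) (vscale (lp p X) c f) = cmod c * vnorm (lp p X) f"
    proof (rule antisym)
      show "cmod c * vnorm (lp p X) f \<le> vnorm (lp p X) (vscale (lp p X) c f)"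
      proof (cases "c = 0")
        case True then show ?thesis using lp_norm_ge0[OF scale(1)[OF f, of 0]] by simp
      next
        case False
        then have "vnorm (lp p X) f \<le> cmod (1 / c) * vnorm (lp p X) (\<lambda>x. c * f x)"
          using scale(2)[OF scale(1)[OF f, of c], of "1 / c"] by simp
        then show ?thesis using False by (simp add: norm_divide field_simps)
      qed
    qed (use scale[OF f] in simp)
  next
    fix f assume f: "f \<in> carr (lp p X)" and 0: "vnorm (lp p X) f = 0"
    have "f x = 0" for x
      using lp_le_point[OF p _ is_lp_le[OF L p f]] is_lp_zero[OF L f] 0 by (cases "x \<in> X") auto
    then show "f = vscale (lp p X) 0 f" by auto
  qed (auto simp: algebra_simps scale add)
qed

text \<open>The limit is taken pointwise; the estimates by finite sums pass to pointwise limits.\<close>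

lemma vcomplete_lp:
  assumes p: "1 \<le> p" shows "vcomplete (lp p X)"
  unfolding vcomplete_def
proof
  interpret cnormed "lp p X" by (rule cnormed_lp[OF p])
  note L = is_lp_lp[of p X]
  fix f assume f: "f \<in> cauchy_seqs (lp p X)"
  then have fc: "f n \<in> carr (lp p X)" for n by (auto simp: cauchy_seqs_def)
  have dc: "(\<lambda>x. f m x - f n x) \<in> carr (lp p X)" "vdist (lp p X) (f m) (f n) = vnorm (lp p X) (\<lambda>x. f m x - f n x)" for m n
    using add_closed[OF fc[of m] scale_closed[OF fc[of n], of "-1"]] by (simp_all add: vdist_def)
  have cau: "\<exists>N. \<forall>m\<ge>N. \<forall>n\<ge>N. lp_le p X (\<lambda>x. f m x - f n x) e" if e: "e > 0" for e
  proof -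
    obtain N where "\<forall>m\<ge>N. \<forall>n\<ge>N. vdist (lp p X) (f m) (f n) < e"
      using f e unfolding cauchy_seqs_def mem_Collect_eq by meson
    then have "\<forall>m\<ge>N. \<forall>n\<ge>N. lp_le p X (\<lambda>x. f m x - f n x) e"
      using is_lp_le[OF L p dc(1)] lp_norm_ge0[OF dc(1)] dc(2) by (metis less_imp_le lp_le_mono p)
    then show ?thesis by blast
  qed
  have "convergent (\<lambda>n. f n x)" for x
  proof (cases "x \<in> X")
    case True
    have "Cauchy (\<lambda>n. f n x)"
    proof (rule metric_CauchyI)
      fix e :: real assume e: "e > 0"
      then obtain N where "\<forall>m\<ge>N. \<forall>n\<ge>N. lp_le p X (\<lambda>x. f m x - f n x) (e/2)"
        using cau[of "e/2"] by auto
      then have "\<forall>m\<ge>N. \<forall>n\<ge>N. cmod (f m x - f n x) \<le> e/2"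
        using lp_le_point[OF p _ _ True, of "e/2"] e by auto
      then show "\<exists>M. \<forall>m\<ge>M. \<forall>n\<ge>M. dist (f m x) (f n x) < e"
        unfolding dist_norm using e by (intro exI[of _ N]) fastforce
    qed
    then show ?thesis by (simp add: Cauchy_convergent_iff)
  next
    case False then show ?thesis using is_lp_zero[OF L fc] by (simp add: convergent_const)
  qed
  then obtain g where g: "\<And>x. (\<lambda>n. f n x) \<longlonglongrightarrow> g x" unfolding convergent_def by metis
  have g0: "g x = 0" if "x \<notin> X" for x
    using g[of x] is_lp_zero[OF L fc that] by (simp add: LIMSEQ_const_iff)
  have close: "\<exists>N. \<forall>m\<ge>N. lp_le p X (\<lambda>x. f m x - g x) e" if e: "e > 0" for e
  proof -
    obtain N where N: "\<forall>m\<ge>N. \<forall>n\<ge>N. lp_le p X (\<lambda>x. f m x - f n x) e" using cau[OF e] by blast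
    have "lp_le p X (\<lambda>x. f m x - g x) e" if "m \<ge> N" for m
      by (rule lp_le_limit[OF p, where N = N and h = "\<lambda>n x. f m x - f n x"])
        (use N that g in \<open>auto intro!: tendsto_intros\<close>)
    then show ?thesis by blast
  qed
  have mem: "(\<lambda>x. f m x - g x) \<in> carr (lp p X)" "vnorm (lp p X) (\<lambda>x. f m x - g x) \<le> e"
    if "lp_le p X (\<lambda>x. f m x - g x) e" "e > 0" for m e
    using is_lp_mem[OF L p _ _ that(1)] is_lp_norm_le[OF L p _ _ that(1)] that(2) g0 is_lp_zero[OF L fc]
    by auto
  obtain N1 where "\<forall>m\<ge>N1. lp_le p X (\<lambda>x. f m x - g x) 1" using close[of 1] by auto
  then have "(\<lambda>x. f N1 x - g x) \<in> carr (lp p X)" using mem(1)[of N1 1] by simp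
  from add_closed[OF fc[of N1] scale_closed[OF this, of "-1"]]
  have gc: "g \<in> carr (lp p X)" by simp
  have "vtends (lp p X) f g" unfolding vtends_def
  proof (rule LIMSEQ_I)
    fix e :: real assume e: "e > 0"
    then obtain N where N: "\<forall>m\<ge>N. lp_le p X (\<lambda>x. f m x - g x) (e/2)" using close[of "e/2"] by auto
    have "norm (vdist (lp p X) (f m) g - 0) < e" if "m \<ge> N" for m
      using mem(2)[of m "e/2"] N that e dist_ge0[OF fc gc, of m] by (simp add: vdist_def)
    then show "\<exists>no. \<forall>n\<ge>no. norm (vdist (lp p X) (f n) g - 0) < e" by blast
  qed
  then show "\<exists>x\<in>carr (lp p X). vtends (lp p X) f x" using gc by blast
qed

lemma is_lp_cnormed: "is_lp p X V \<Longrightarrow> 1 \<le> p \<Longrightarrow> cnormed V"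
  by (rule cnormed_transfer[OF cnormed_lp]) (auto simp: is_lp_def)

lemma is_lp_vcomplete: "is_lp p X V \<Longrightarrow> 1 \<le> p \<Longrightarrow> vcomplete V"
  by (rule vcomplete_transfer[OF cnormed_lp _ _ _ _ vcomplete_lp]) (auto simp: is_lp_def)

text \<open>The \<open>p\<close>-th power of the norm on the union is the sum of the \<open>p\<close>-th powers of the norms on the pieces. Hence a
direct sum over the fibres of an anchor map is the space of summable functions on the total space, and the
fibres disappear from all later estimates.\<close>

lemma is_lp_lp_sum:
  assumes p: "1 \<le> p" and disj: "\<And>v w. \<lbrakk>v \<in> I; w \<in> I; v \<noteq> w\<rbrakk> \<Longrightarrow> X v \<inter> X w = {}"
  shows "is_lp p (\<Union>v\<in>I. X v) (lp_sum p I X)"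
proof -
  let ?X = "\<Union>v\<in>I. X v"
  let ?n = "lp_fibre_norms p I X"
  have iff: "f \<in> carr (lp_sum p I X) \<and> vnorm (lp_sum p I X) f \<le> C \<longleftrightarrow> (\<forall>x. x \<notin> ?X \<longrightarrow> f x = 0) \<and> lp_le p ?X f C"
    if C: "0 \<le> C" for f C
  proof -
    have n0: "?n f v = 0" if "v \<notin> I" for v using that by (simp add: lp_fibre_norms_def cut_def)
    have nv: "cmod (?n f v) = vnorm (lp p (X v)) (cut (X v) f)"
      if "v \<in> I" "cut (X v) f \<in> carr (lp p (X v))" for v
      using lp_norm_ge0[OF that(2)] that(1) by (simp add: lp_fibre_norms_def cut_def)
    have "f \<in> carr (lp_sum p I X) \<and> vnorm (lp_sum p I X) f \<le> C \<longleftrightarrow> (\<forall>x. x \<notin> ?X \<longrightarrow> f x = 0) \<and>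
       (\<forall>v\<in>I. cut (X v) f \<in> carr (lp p (X v))) \<and> lp_le p I (?n f) C"
      using lp_mem_iff[OF p C, of "?n f" I] n0 by (auto simp: lp_sum_def)
    moreover have "(\<forall>v\<in>I. cut (X v) f \<in> carr (lp p (X v))) \<and> lp_le p I (?n f) C \<longleftrightarrow> lp_le p ?X f C"
    proof (intro iffI conjI ballI)
      assume a: "(\<forall>v\<in>I. cut (X v) f \<in> carr (lp p (X v))) \<and> lp_le p I (?n f) C"
      have le: "lp_le p (X v) f (cmod (?n f v))" if "v \<in> I" for v
        using is_lp_le[OF is_lp_lp p, of "cut (X v) f" "X v"] a that nv by (simp add: lp_le_cut)
      show "lp_le p ?X f C"
      proof (cases "p = \<infinity>")
        case True
        then show ?thesis using a le unfolding lp_le_def by (simp, meson order_trans)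
      next
        case False
        let ?r = "enn2real p"
        have "(\<Sum>x\<in>F. cmod (f x) powr ?r) \<le> C powr ?r" if F: "finite F" "F \<subseteq> ?X" for F
        proof -
          define J where "J = {v \<in> I. F \<inter> X v \<noteq> {}}"
          \<comment> \<open>each point of \<open>F\<close> determines the piece that contains it\<close>
          have "finite J"
          proof (rule finite_surj[OF F(1)])
            show "J \<subseteq> (\<lambda>x. THE v. v \<in> I \<and> x \<in> X v) ` F"
            proof
              fix v assume "v \<in> J"
              then obtain x where x: "x \<in> F" "x \<in> X v" "v \<in> I" by (auto simp: J_def)
              then have "(THE v. v \<in> I \<and> x \<in> X v) = v" using disj by (intro the_equality) blast+
              then show "v \<in> (\<lambda>x. THE v. v \<in> I \<and> x \<in> X v) ` F" using x by force
            qed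
          qed
          have FU: "F = (\<Union>v\<in>J. F \<inter> X v)" using F(2) unfolding J_def by blast
          have "(\<Sum>x\<in>F. cmod (f x) powr ?r) = (\<Sum>v\<in>J. \<Sum>x\<in>F \<inter> X v. cmod (f x) powr ?r)"
            by (subst FU, rule sum.UNION_disjoint) (use F \<open>finite J\<close> disj J_def in auto)
          also have "\<dots> \<le> (\<Sum>v\<in>J. cmod (?n f v) powr ?r)"
            using le False F by (intro sum_mono) (auto simp: lp_le_def J_def)
          also have "\<dots> \<le> C powr ?r"
            using a False \<open>finite J\<close> by (auto simp: lp_le_def J_def)
          finally show ?thesis .
        qed
        then show ?thesis using False by (simp add: lp_le_def)
      qed
    next
      fix v assume a: "lp_le p ?X f C" "v \<in> I"
      have "lp_le p (X v) f C" by (rule lp_le_subset[OF a(1)]) (use a(2) in auto)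
      then show "cut (X v) f \<in> carr (lp p (X v))"
        by (intro is_lp_mem[OF is_lp_lp p C]) (simp_all add: lp_le_cut, simp add: cut_def)
    next
      assume a: "lp_le p ?X f C"
      have sub: "lp_le p (X v) (cut (X v) f) C" if "v \<in> I" for v
        unfolding lp_le_cut by (rule lp_le_subset[OF a(1)]) (use that in auto)
      have mem: "cut (X v) f \<in> carr (lp p (X v))" if "v \<in> I" for v
        using sub[OF that] by (intro is_lp_mem[OF is_lp_lp p C]) (auto simp: cut_def)
      show "lp_le p I (?n f) C"
      proof (cases "p = \<infinity>")
        case True
        have "cmod (?n f v) \<le> C" if "v \<in> I" for v
          unfolding nv[OF that mem[OF that]] by (rule is_lp_norm_le[OF is_lp_lp p C _ sub[OF that]]) (simp add: cut_def)
        then show ?thesis unfolding lp_le_def using True by simp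
      next
        case False
        let ?r = "enn2real p"
        have r: "1 \<le> ?r" by (rule enn2real_ge1[OF p False])
        have "(\<Sum>v\<in>J. cmod (?n f v) powr ?r) \<le> C powr ?r" if J: "finite J" "J \<subseteq> I" for J
        proof -
          have s: "(\<lambda>x. cmod (f x) powr ?r) summable_on X v" if "v \<in> J" for v
            using mem[of v] that J False by (auto simp: lp_def cut_def cong: summable_on_cong)
          have JI: "(\<Union>v\<in>J. X v) \<subseteq> ?X" using J by blast
          have sU: "(\<lambda>x. cmod (f x) powr ?r) summable_on (\<Union>v\<in>J. X v)"
            by (rule summable_on_finite_union_disjoint[OF J(1) s]) (use disj J in auto)
          have "(\<Sum>v\<in>J. cmod (?n f v) powr ?r) = (\<Sum>v\<in>J. \<Sum>\<^sub>\<infinity>x\<in>X v. cmod (f x) powr ?r)"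
          proof (rule sum.cong[OF refl])
            fix v assume v: "v \<in> J"
            have "(\<Sum>\<^sub>\<infinity>x\<in>X v. cmod (cut (X v) f x) powr ?r) = (\<Sum>\<^sub>\<infinity>x\<in>X v. cmod (f x) powr ?r)"
              by (rule infsum_cong) (simp add: cut_def)
            then have "cmod (?n f v) = (\<Sum>\<^sub>\<infinity>x\<in>X v. cmod (f x) powr ?r) powr (1 / ?r)"
              using nv mem v J False by (auto simp: lp_def)
            then show "cmod (?n f v) powr ?r = (\<Sum>\<^sub>\<infinity>x\<in>X v. cmod (f x) powr ?r)"
              using r by (simp add: powr_powr infsum_nonneg)
          qed
          also have "\<dots> = (\<Sum>\<^sub>\<infinity>x\<in>(\<Union>v\<in>J. X v). cmod (f x) powr ?r)"
            by (rule sum_infsum[OF J(1) s]) (use disj J in auto)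
          also have "\<dots> \<le> C powr ?r"
            by (rule infsum_le_finite_sums[OF sU]) (use a False subset_trans[OF _ JI] in \<open>simp add: lp_le_def\<close>)
          finally show ?thesis .
        qed
        then show ?thesis using False by (simp add: lp_le_def)
      qed
    qed
    ultimately show ?thesis by blast
  qed
  have ge0: "0 \<le> vnorm (lp_sum p I X) f" if "f \<in> carr (lp_sum p I X)" for f
    using that by (auto simp: lp_sum_def lp_norm_ge0)
  have eq: "f \<in> carr (lp_sum p I X) \<and> vnorm (lp_sum p I X) f \<le> C \<longleftrightarrow> f \<in> carr (lp p ?X) \<and> vnorm (lp p ?X) f \<le> C"
    if "0 \<le> C" for f C
    using iff[OF that] lp_mem_iff[OF p that] by metis
  have c: "carr (lp_sum p I X) = carr (lp p ?X)"
    using eq ge0 lp_norm_ge0 by (metis (no_types, opaque_lifting) order_refl subsetI subset_antisym)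
  have "vnorm (lp_sum p I X) f = vnorm (lp p ?X) f" if "f \<in> carr (lp p ?X)" for f
    using eq[of "vnorm (lp_sum p I X) f" f] eq[of "vnorm (lp p ?X) f" f] ge0[of f] lp_norm_ge0[OF that] that c
    by auto
  then show ?thesis unfolding is_lp_def using c by (simp add: lp_sum_def)
qed

lemma is_lp_bopsI:
  assumes V: "is_lp p Y V" and W: "is_lp p X W" and p: "1 \<le> p" and D: "0 \<le> D"
    and bound: "\<And>\<xi> C. \<lbrakk>\<xi> \<in> carr V; 0 \<le> C; lp_le p Y \<xi> C\<rbrakk> \<Longrightarrow> lp_le p X (K \<xi>) (D * C)"
    and add: "\<And>\<xi> \<eta> x. \<lbrakk>\<xi> \<in> carr V; \<eta> \<in> carr V; x \<in> X\<rbrakk> \<Longrightarrow> K (\<lambda>y. \<xi> y + \<eta> y) x = K \<xi> x + K \<eta> x"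
    and scale: "\<And>c \<xi> x. \<lbrakk>\<xi> \<in> carr V; x \<in> X\<rbrakk> \<Longrightarrow> K (\<lambda>y. c * \<xi> y) x = c * K \<xi> x"
  shows "(\<lambda>\<xi>\<in>carr V. cut X (K \<xi>)) \<in> carr (bops V W)"
    and "vnorm (bops V W) (\<lambda>\<xi>\<in>carr V. cut X (K \<xi>)) \<le> D"
proof -
  interpret V: cnormed V by (rule is_lp_cnormed[OF V p])
  interpret W: cnormed W by (rule is_lp_cnormed[OF W p])
  interpret cnormed_pair V W by unfold_locales
  let ?T = "\<lambda>\<xi>\<in>carr V. cut X (K \<xi>)"
  have *: "cut X (K \<xi>) \<in> carr W" "vnorm W (cut X (K \<xi>)) \<le> D * vnorm V \<xi>" if "\<xi> \<in> carr V" for \<xi>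
  proof -
    have b: "lp_le p X (cut X (K \<xi>)) (D * vnorm V \<xi>)"
      unfolding lp_le_cut by (rule bound[OF that V.norm_ge0[OF that] is_lp_le[OF V p that]])
    have 0: "0 \<le> D * vnorm V \<xi>" using D V.norm_ge0[OF that] by simp
    show "cut X (K \<xi>) \<in> carr W" "vnorm W (cut X (K \<xi>)) \<le> D * vnorm V \<xi>"
      using is_lp_mem[OF W p 0 _ b] is_lp_norm_le[OF W p 0 _ b] by (auto simp: cut_def)
  qed
  show "?T \<in> carr (bops V W)"
  proof (rule bopsI[where C = D])
    fix \<xi> \<eta> assume a: "\<xi> \<in> carr V" "\<eta> \<in> carr V"
    then show "?T (vadd V \<xi> \<eta>) = vadd W (?T \<xi>) (?T \<eta>)"
      using V.add_closed[OF a] add[OF a] unfolding is_lp_sel[OF V] is_lp_sel[OF W]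
      by (auto simp: cut_def fun_eq_iff)
  next
    fix c \<xi> assume a: "\<xi> \<in> carr V"
    then show "?T (vscale V c \<xi>) = vscale W c (?T \<xi>)"
      using V.scale_closed[OF a] scale[OF a] unfolding is_lp_sel[OF V] is_lp_sel[OF W]
      by (auto simp: cut_def fun_eq_iff)
  qed (use * in auto)
  show "vnorm (bops V W) ?T \<le> D" by (rule opnorm_le[OF D]) (use * in simp)
qed

lemma infsum_eq_sum:
  assumes "finite S" "S \<subseteq> Y" "\<And>y. y \<in> Y - S \<Longrightarrow> f y = (0 :: complex)"
  shows "infsum f Y = sum f S"
  using infsum_cong_neutral[of S Y f f] assms by auto

definition bounded_kernel :: "'x set \<Rightarrow> 'y set \<Rightarrow> ('x \<Rightarrow> 'y \<Rightarrow> complex) \<Rightarrow> nat \<Rightarrow> real \<Rightarrow> bool" where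
  "bounded_kernel X Y k N M \<longleftrightarrow>
    (\<forall>x\<in>X. finite {y \<in> Y. k x y \<noteq> 0} \<and> card {y \<in> Y. k x y \<noteq> 0} \<le> N) \<and>
    (\<forall>y\<in>Y. finite {x \<in> X. k x y \<noteq> 0} \<and> card {x \<in> X. k x y \<noteq> 0} \<le> N) \<and>
    (\<forall>x\<in>X. \<forall>y\<in>Y. cmod (k x y) \<le> M)"

text \<open>A row of the product is at most \<open>N M\<close> times the largest of at most \<open>N\<close> entries of \<open>\<xi>\<close>, so its \<open>p\<close>-th power
is controlled by the sum of their \<open>p\<close>-th powers. Each entry is used in at most \<open>N\<close> rows. The constant is
crude; that it depends on \<open>N\<close> and \<open>M\<close> alone is what matters.\<close>

lemma kernel_lp_le:
  assumes p: "1 \<le> p" and k: "bounded_kernel X Y k N M" and N: "1 \<le> N" and M: "0 \<le> M"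
    and C: "0 \<le> C" and \<xi>: "lp_le p Y \<xi> C"
  shows "lp_le p X (\<lambda>x. \<Sum>\<^sub>\<infinity>y\<in>Y. k x y * \<xi> y) (real N * M * real N * C)"
proof -
  define R where "R x = {y \<in> Y. k x y \<noteq> 0}" for x
  have R: "finite (R x)" "card (R x) \<le> N" "R x \<subseteq> Y" if "x \<in> X" for x
    using k that by (auto simp: bounded_kernel_def R_def)
  have sum: "(\<Sum>\<^sub>\<infinity>y\<in>Y. k x y * \<xi> y) = (\<Sum>y\<in>R x. k x y * \<xi> y)" if "x \<in> X" for x
    by (rule infsum_eq_sum) (use R[OF that] in \<open>auto simp: R_def\<close>)
  have pt: "cmod (\<Sum>\<^sub>\<infinity>y\<in>Y. k x y * \<xi> y) \<le> real N * M * m" if x: "x \<in> X" and m: "0 \<le> m" "\<And>y. y \<in> R x \<Longrightarrow> cmod (\<xi> y) \<le> m" for x m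
  proof -
    have "cmod (\<Sum>y\<in>R x. k x y * \<xi> y) \<le> (\<Sum>y\<in>R x. M * m)"
      using k x m M R[OF x] by (intro sum_norm_le) (auto simp: norm_mult bounded_kernel_def intro!: mult_mono)
    also have "\<dots> = real (card (R x)) * (M * m)" by simp
    also have "\<dots> \<le> real N * (M * m)" using R(2)[OF x] M m by (intro mult_right_mono) auto
    finally show ?thesis by (simp add: sum[OF x] mult.assoc)
  qed
  show ?thesis
  proof (cases "p = \<infinity>")
    case True
    have "cmod (\<Sum>\<^sub>\<infinity>y\<in>Y. k x y * \<xi> y) \<le> real N * M * real N * C" if x: "x \<in> X" for x
    proof -
      have "cmod (\<Sum>\<^sub>\<infinity>y\<in>Y. k x y * \<xi> y) \<le> real N * M * C"
        by (rule pt[OF x C]) (use \<xi> True R[OF x] in \<open>auto simp: lp_le_def\<close>)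
      also have "\<dots> \<le> real N * M * real N * C"
      proof -
        have "real N * M * C * 1 \<le> real N * M * C * real N" using N M C by (intro mult_left_mono) auto
        then show ?thesis by (simp add: mult_ac)
      qed
      finally show ?thesis .
    qed
    then show ?thesis using True by (simp add: lp_le_def)
  next
    case False
    define r where "r = enn2real p"
    have r: "1 \<le> r" using enn2real_ge1[OF p False] by (simp add: r_def)
    have pt2: "cmod (\<Sum>\<^sub>\<infinity>y\<in>Y. k x y * \<xi> y) powr r \<le> (real N * M) powr r * (\<Sum>y\<in>R x. cmod (\<xi> y) powr r)"
      if x: "x \<in> X" for x
    proof -
      \<comment> \<open>zero is inserted for the case of an empty row\<close>
      define m where "m = Max (insert 0 ((\<lambda>y. cmod (\<xi> y)) ` R x))"
      have fin: "finite (insert 0 ((\<lambda>y. cmod (\<xi> y)) ` R x))" using R[OF x] by simp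
      have m0: "0 \<le> m" unfolding m_def using fin by (intro Max_ge) auto
      have "m \<in> insert 0 ((\<lambda>y. cmod (\<xi> y)) ` R x)" unfolding m_def using fin by (intro Max_in) auto
      then have mr: "m powr r \<le> (\<Sum>y\<in>R x. cmod (\<xi> y) powr r)"
        using R[OF x] by (auto simp: sum_nonneg intro!: member_le_sum)
      have "cmod (\<Sum>\<^sub>\<infinity>y\<in>Y. k x y * \<xi> y) \<le> real N * M * m"
        by (rule pt[OF x m0]) (use fin in \<open>auto simp: m_def intro!: Max_ge\<close>)
      then have "cmod (\<Sum>\<^sub>\<infinity>y\<in>Y. k x y * \<xi> y) powr r \<le> (real N * M * m) powr r"
        using r by (intro powr_mono2) auto
      also have "\<dots> = (real N * M) powr r * m powr r" using M m0 by (simp add: powr_mult)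
      also have "\<dots> \<le> (real N * M) powr r * (\<Sum>y\<in>R x. cmod (\<xi> y) powr r)"
        using mr by (intro mult_left_mono) auto
      finally show ?thesis .
    qed
    have "(\<Sum>x\<in>F. cmod (\<Sum>\<^sub>\<infinity>y\<in>Y. k x y * \<xi> y) powr r) \<le> (real N * M * real N * C) powr r"
      if F: "finite F" "F \<subseteq> X" for F
    proof -
      let ?U = "\<Union>x\<in>F. R x"
      have U: "finite ?U" "?U \<subseteq> Y" using F R by (auto, blast)
      have "(\<Sum>x\<in>F. \<Sum>y\<in>R x. cmod (\<xi> y) powr r) = (\<Sum>x\<in>F. \<Sum>y\<in>{y \<in> ?U. k x y \<noteq> 0}. cmod (\<xi> y) powr r)"
        using F by (intro sum.cong) (auto simp: R_def)
      also have "\<dots> = (\<Sum>y\<in>?U. \<Sum>x\<in>{x \<in> F. k x y \<noteq> 0}. cmod (\<xi> y) powr r)"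
        by (rule sum.swap_restrict) (use F U in auto)
      also have "\<dots> \<le> (\<Sum>y\<in>?U. real N * cmod (\<xi> y) powr r)"
      proof (rule sum_mono)
        fix y assume y: "y \<in> ?U"
        have "card {x \<in> F. k x y \<noteq> 0} \<le> card {x \<in> X. k x y \<noteq> 0}"
          using F U y k by (intro card_mono) (auto simp: bounded_kernel_def)
        also have "\<dots> \<le> N" using k U y by (auto simp: bounded_kernel_def)
        finally show "(\<Sum>x\<in>{x \<in> F. k x y \<noteq> 0}. cmod (\<xi> y) powr r) \<le> real N * cmod (\<xi> y) powr r"
          by (simp add: mult_right_mono)
      qed
      also have "\<dots> = real N * (\<Sum>y\<in>?U. cmod (\<xi> y) powr r)" by (simp add: sum_distrib_left)
      also have "\<dots> \<le> real N powr r * C powr r"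
      proof (rule mult_mono)
        show "real N \<le> real N powr r" using powr_mono[of 1 r "real N"] r N by simp
        show "(\<Sum>y\<in>?U. cmod (\<xi> y) powr r) \<le> C powr r" using \<xi> U False by (simp add: lp_le_def r_def)
      qed (auto simp: sum_nonneg)
      finally have 1: "(\<Sum>x\<in>F. \<Sum>y\<in>R x. cmod (\<xi> y) powr r) \<le> real N powr r * C powr r" .
      have "(\<Sum>x\<in>F. cmod (\<Sum>\<^sub>\<infinity>y\<in>Y. k x y * \<xi> y) powr r)
         \<le> (\<Sum>x\<in>F. (real N * M) powr r * (\<Sum>y\<in>R x. cmod (\<xi> y) powr r))"
        using F pt2 by (intro sum_mono) auto
      also have "\<dots> = (real N * M) powr r * (\<Sum>x\<in>F. \<Sum>y\<in>R x. cmod (\<xi> y) powr r)" by (simp add: sum_distrib_left)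
      also have "\<dots> \<le> (real N * M) powr r * (real N powr r * C powr r)" using 1 by (intro mult_left_mono) auto
      also have "\<dots> = (real N * M * real N * C) powr r" using M C by (simp add: powr_mult mult.assoc)
      finally show ?thesis .
    qed
    then show ?thesis using False by (simp add: lp_le_def r_def)
  qed
qed

lemma kernel_bops:
  assumes V: "is_lp p Y V" and W: "is_lp p X W" and p: "1 \<le> p"
    and k: "bounded_kernel X Y k N M" and N: "1 \<le> N" and M: "0 \<le> M"
  shows "(\<lambda>\<xi>\<in>carr V. cut X (\<lambda>x. \<Sum>\<^sub>\<infinity>y\<in>Y. k x y * \<xi> y)) \<in> carr (bops V W)"
    and "vnorm (bops V W) (\<lambda>\<xi>\<in>carr V. cut X (\<lambda>x. \<Sum>\<^sub>\<infinity>y\<in>Y. k x y * \<xi> y)) \<le> real N * M * real N"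
proof -
  have fin: "finite {y \<in> Y. k x y \<noteq> 0}" if "x \<in> X" for x using k that by (simp add: bounded_kernel_def)
  have s: "(\<Sum>\<^sub>\<infinity>y\<in>Y. k x y * \<xi> y) = (\<Sum>y\<in>{y \<in> Y. k x y \<noteq> 0}. k x y * \<xi> y)" if "x \<in> X" for x \<xi>
    by (rule infsum_eq_sum) (use fin[OF that] in auto)
  have a: "(\<Sum>\<^sub>\<infinity>y\<in>Y. k x y * (\<xi> y + \<eta> y)) = (\<Sum>\<^sub>\<infinity>y\<in>Y. k x y * \<xi> y) + (\<Sum>\<^sub>\<infinity>y\<in>Y. k x y * \<eta> y)"
    if "x \<in> X" for x \<xi> \<eta>
    using s[OF that, of \<xi>] s[OF that, of \<eta>] s[OF that, of "\<lambda>y. \<xi> y + \<eta> y"]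
    by (simp add: distrib_left sum.distrib)
  have c: "(\<Sum>\<^sub>\<infinity>y\<in>Y. k x y * (c * \<xi> y)) = c * (\<Sum>\<^sub>\<infinity>y\<in>Y. k x y * \<xi> y)" if "x \<in> X" for x c \<xi>
    using s[OF that, of \<xi>] s[OF that, of "\<lambda>y. c * \<xi> y"] by (simp add: sum_distrib_left mult_ac)
  have D: "0 \<le> real N * M * real N" using M by simp
  show "(\<lambda>\<xi>\<in>carr V. cut X (\<lambda>x. \<Sum>\<^sub>\<infinity>y\<in>Y. k x y * \<xi> y)) \<in> carr (bops V W)"
    "vnorm (bops V W) (\<lambda>\<xi>\<in>carr V. cut X (\<lambda>x. \<Sum>\<^sub>\<infinity>y\<in>Y. k x y * \<xi> y)) \<le> real N * M * real N"
    by (rule is_lp_bopsI[OF V W p D kernel_lp_le[OF p k N M] a c]; assumption)+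
qed

section \<open>Compactly supported functions and local homeomorphisms\<close>

lemma Cc_cont: "f \<in> Cc X U \<Longrightarrow> continuous_map (subtopology X U) euclidean f"
  by (simp add: Cc_def)

lemma Cc_compact:
  assumes "f \<in> Cc X U" "openin X U"
  obtains K where "compactin X K" "K \<subseteq> U" "\<And>x. x \<notin> K \<Longrightarrow> f x = 0"
proof -
  let ?S = "{x \<in> U. f x \<noteq> 0}" and ?K = "subtopology X U closure_of {x \<in> U. f x \<noteq> 0}"
  have K: "compactin (subtopology X U) ?K" using assms by (simp add: Cc_def)
  have "?S \<subseteq> ?K" by (rule closure_of_subset) (use openin_subset[OF assms(2)] in auto)
  then have "f x = 0" if "x \<notin> ?K" for x
    using that assms by (auto simp: Cc_def)
  then show ?thesis using that[of ?K] K by (auto simp: compactin_subtopology)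
qed

text \<open>In a Hausdorff open set compact sets are closed, so any compact set off which the function vanishes contains
its support.\<close>

lemma CcI:
  assumes "openin X U" "Hausdorff_space (subtopology X U)" "continuous_map (subtopology X U) euclidean f"
    "compactin X K" "K \<subseteq> U" "\<And>x. x \<notin> K \<Longrightarrow> f x = 0"
  shows "f \<in> Cc X U"
proof -
  have K: "compactin (subtopology X U) K" using assms(4,5) by (simp add: compactin_subtopology)
  have cl: "closedin (subtopology X U) K" by (rule compactin_imp_closedin[OF assms(2) K])
  have "subtopology X U closure_of {x \<in> U. f x \<noteq> 0} \<subseteq> K"
    by (rule closure_of_minimal[OF _ cl]) (use assms(6) in auto)
  then have "compactin (subtopology X U) (subtopology X U closure_of {x \<in> U. f x \<noteq> 0})"
    by (rule closed_compactin[OF K]) simp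
  then show ?thesis using assms(3,5,6) by (auto simp: Cc_def)
qed

lemma CC_Cc:
  assumes "openin X U" "Hausdorff_space (subtopology X U)" "g \<in> Cc X U"
  shows "g \<in> CC X"
  unfolding CC_def
  by (rule CollectI, rule exI[of _ 1], rule exI[of _ "\<lambda>_. 1"], rule exI[of _ "\<lambda>_. g"]) (use assms in auto)

lemma CC_zero: "(\<lambda>x. 0) \<in> CC X"
  unfolding CC_def by (rule CollectI, rule exI[of _ 0]) auto

lemma CC_scale:
  assumes "f \<in> CC X" shows "(\<lambda>x. c * f x) \<in> CC X"
proof -
  obtain n d g where "\<forall>i<(n::nat). \<exists>U. openin X U \<and> Hausdorff_space (subtopology X U) \<and> g i \<in> Cc X U"
    "f = (\<lambda>x. \<Sum>i<n. d i * g i x)" using assms by (auto simp: CC_def)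
  then show ?thesis unfolding CC_def
    by (intro CollectI exI[of _ n] exI[of _ "\<lambda>i. c * d i"] exI[of _ g]) (auto simp: sum_distrib_left mult_ac)
qed

lemma CC_add:
  assumes "f \<in> CC X" "f' \<in> CC X" shows "(\<lambda>x. f x + f' x) \<in> CC X"
proof -
  obtain n d g where f: "\<forall>i<(n::nat). \<exists>U. openin X U \<and> Hausdorff_space (subtopology X U) \<and> g i \<in> Cc X U"
    "f = (\<lambda>x. \<Sum>i<n. d i * g i x)" using assms by (auto simp: CC_def)
  obtain m d' g' where f': "\<forall>i<(m::nat). \<exists>U. openin X U \<and> Hausdorff_space (subtopology X U) \<and> g' i \<in> Cc X U"
    "f' = (\<lambda>x. \<Sum>i<m. d' i * g' i x)" using assms by (auto simp: CC_def)
  let ?d = "\<lambda>i. if i < n then d i else d' (i - n)" and ?g = "\<lambda>i. if i < n then g i else g' (i - n)"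
  have "(\<Sum>i<n + m. ?d i * ?g i x) = f x + f' x" for x
  proof -
    have s: "{..<n + m} = {..<n} \<union> (\<lambda>i. i + n) ` {..<m}"
    proof (rule set_eqI)
      fix i show "i \<in> {..<n + m} \<longleftrightarrow> i \<in> {..<n} \<union> (\<lambda>i. i + n) ` {..<m}"
        by (cases "i < n") (auto simp: image_iff intro!: bexI[of _ "i - n"])
    qed
    have "(\<Sum>i\<in>(\<lambda>i. i + n) ` {..<m}. ?d i * ?g i x) = f' x"
      by (subst sum.reindex) (auto simp: f'(2))
    moreover have "(\<Sum>i<n. ?d i * ?g i x) = f x" by (simp add: f(2))
    ultimately show ?thesis unfolding s by (subst sum.union_disjoint) auto
  qed
  then show ?thesis unfolding CC_def using f(1) f'(1)
    by (intro CollectI exI[of _ "n + m"] exI[of _ ?d] exI[of _ ?g]) auto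
qed

lemma CC_induct [consumes 1, case_names zero add scale Cc]:
  assumes f: "f \<in> CC X" and z: "P (\<lambda>x. 0)"
    and a: "\<And>f g. \<lbrakk>P f; P g\<rbrakk> \<Longrightarrow> P (\<lambda>x. f x + g x)"
    and s: "\<And>c f. P f \<Longrightarrow> P (\<lambda>x. c * f x)"
    and c: "\<And>U g. \<lbrakk>openin X U; Hausdorff_space (subtopology X U); g \<in> Cc X U\<rbrakk> \<Longrightarrow> P g"
  shows "P f"
proof -
  obtain n d g where *: "\<forall>i<(n::nat). \<exists>U. openin X U \<and> Hausdorff_space (subtopology X U) \<and> g i \<in> Cc X U"
    and f: "f = (\<lambda>x. \<Sum>i<n. d i * g i x)" using f by (auto simp: CC_def)
  have "P (\<lambda>x. \<Sum>i<m. d i * g i x)" if "m \<le> n" for m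
    using that
  proof (induction m)
    case 0 then show ?case using z by simp
  next
    case (Suc m)
    have "P (g m)" using * Suc.prems c by (meson Suc_le_lessD)
    then show ?case using a[OF Suc.IH s[of "g m" "d m"]] Suc.prems by simp
  qed
  then show ?thesis using f by blast
qed

text \<open>In a space that is not Hausdorff the closure of a compact set need not be compact; some compact set containing
all the nonzero values is a sufficient substitute for the support.\<close>

lemma CC_support:
  assumes "f \<in> CC X"
  obtains K M where "compactin X K" "\<And>x. x \<notin> K \<Longrightarrow> f x = 0" "0 \<le> M" "\<And>x. cmod (f x) \<le> M"
proof -
  have "\<exists>K M. compactin X K \<and> (\<forall>x. x \<notin> K \<longrightarrow> f x = 0) \<and> 0 \<le> M \<and> (\<forall>x. cmod (f x) \<le> M)"
    using assms
  proof (induction rule: CC_induct)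
    case zero then show ?case by (intro exI[of _ "{}"] exI[of _ 0]) auto
  next
    case (add f g)
    then obtain K M K' M' where *: "compactin X K \<and> (\<forall>x. x \<notin> K \<longrightarrow> f x = 0) \<and> 0 \<le> M \<and> (\<forall>x. cmod (f x) \<le> M)"
      "compactin X K' \<and> (\<forall>x. x \<notin> K' \<longrightarrow> g x = 0) \<and> 0 \<le> M' \<and> (\<forall>x. cmod (g x) \<le> M')" by blast
    have "cmod (f x + g x) \<le> M + M'" for x
      using norm_triangle_ineq[of "f x" "g x"] * by (meson add_mono order_trans)
    then show ?case
      using * by (intro exI[of _ "K \<union> K'"] exI[of _ "M + M'"]) (simp add: compactin_Un)
  next
    case (scale c f)
    then obtain K M where "compactin X K \<and> (\<forall>x. x \<notin> K \<longrightarrow> f x = 0) \<and> 0 \<le> M \<and> (\<forall>x. cmod (f x) \<le> M)" by blast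
    then show ?case
      by (intro exI[of _ K] exI[of _ "cmod c * M"]) (auto simp: norm_mult intro: mult_left_mono)
  next
    case (Cc U g)
    obtain K where K: "compactin X K" "K \<subseteq> U" "\<And>x. x \<notin> K \<Longrightarrow> g x = 0" by (rule Cc_compact[OF Cc(3,1)]) blast
    have "compactin (subtopology X U) K" using K by (simp add: compactin_subtopology)
    then have "compact (g ` K)" using image_compactin[OF _ Cc_cont[OF Cc(3)]] by simp
    then have "bounded (g ` K)" by (rule compact_imp_bounded)
    then obtain M where "\<forall>w\<in>g ` K. cmod w \<le> M" unfolding bounded_iff by (elim exE)
    then have M: "cmod (g x) \<le> M" if "x \<in> K" for x using that by simp
    have "cmod (g x) \<le> max 0 M" for x using M[of x] K(3)[of x] by (cases "x \<in> K") auto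
    then show ?case using K by (intro exI[of _ K] exI[of _ "max 0 M"]) auto
  qed
  then show ?thesis using that by blast
qed

lemma continuous_map_mult_complex:
  assumes "continuous_map X euclidean (f :: 'a \<Rightarrow> complex)" "continuous_map X euclidean g"
  shows "continuous_map X euclidean (\<lambda>x. f x * g x)"
  using assms unfolding continuous_map_atin by (auto intro: tendsto_mult)

lemma bump_function:
  assumes lc: "locally_compact_space X" and H: "Hausdorff_space X" and W: "openin X W" "x \<in> W"
  obtains h K where "continuous_map X euclideanreal h" "h x = 1" "\<And>y. y \<in> topspace X \<Longrightarrow> 0 \<le> h y"
    "compactin X K" "K \<subseteq> W" "\<And>y. y \<in> topspace X - K \<Longrightarrow> h y = 0"
proof -
  obtain V K where VK: "openin X V" "compactin X K" "x \<in> V" "V \<subseteq> K" "K \<subseteq> W"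
    using locally_compact_space_neighbourhood_base[of X] lc H W unfolding neighbourhood_base_of by blast
  have "completely_regular_space X"
    using lc H by (intro locally_compact_regular_imp_completely_regular_space) auto
  moreover have "closedin X (topspace X - V)" "x \<in> topspace X - (topspace X - V)"
    using VK openin_subset[OF W(1)] W(2) by (auto simp: closedin_diff)
  ultimately obtain f :: "'a \<Rightarrow> real" where f: "continuous_map X (top_of_set {0..1}) f" "f x = 0"
    "f ` (topspace X - V) \<subseteq> {1}"
    unfolding completely_regular_space_def by metis
  have fc: "continuous_map X euclideanreal f" and fr: "\<And>y. y \<in> topspace X \<Longrightarrow> f y \<le> 1"
    using f(1) by (auto simp: continuous_map_in_subtopology)
  show ?thesis
  proof (rule that[of "\<lambda>y. 1 - f y" K])
    show "continuous_map X euclideanreal (\<lambda>y. 1 - f y)"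
      using fc unfolding continuous_map_atin by (auto intro: tendsto_diff)
    show "1 - f y = 0" if "y \<in> topspace X - K" for y using f(3) VK(4) that by auto
  qed (use f fr VK in auto)
qed

text \<open>A partition of unity: if the \<open>Q\<close>-sets cover the space and open subsets of \<open>Q\<close>-sets are \<open>Q\<close>-sets, then the
functions supported in open Hausdorff \<open>Q\<close>-sets span. The support of a function in \<open>Cc X U\<close> is covered
by finitely many sets on which a Urysohn bump exceeds one half, each bump being compactly supported in a
\<open>Q\<close>-set; multiplying with the normalized bumps splits the function.\<close>

lemma CC_induct_local [consumes 1, case_names loc zero add scale cover hereditary Cc]:
  assumes f: "f \<in> CC X"
    and lc: "\<And>U. \<lbrakk>openin X U; Hausdorff_space (subtopology X U)\<rbrakk> \<Longrightarrow> locally_compact_space (subtopology X U)"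
    and z: "P (\<lambda>x. 0)"
    and a: "\<And>f g. \<lbrakk>P f; P g\<rbrakk> \<Longrightarrow> P (\<lambda>x. f x + g x)"
    and s: "\<And>c f. P f \<Longrightarrow> P (\<lambda>x. c * f x)"
    and cov: "\<And>x. x \<in> topspace X \<Longrightarrow> \<exists>W. openin X W \<and> x \<in> W \<and> Q W"
    and her: "\<And>W W'. \<lbrakk>Q W; openin X W; openin X W'; W' \<subseteq> W\<rbrakk> \<Longrightarrow> Q W'"
    and c: "\<And>U g. \<lbrakk>openin X U; Hausdorff_space (subtopology X U); Q U; g \<in> Cc X U\<rbrakk> \<Longrightarrow> P g"
  shows "P f"
  using f
proof (induction rule: CC_induct)
  case (Cc U g)
  let ?S = "subtopology X U"
  have US: "U \<subseteq> topspace X" using Cc(1) by (rule openin_subset)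
  then have tS: "topspace ?S = U" by auto
  obtain K where K: "compactin X K" "K \<subseteq> U" "\<And>x. x \<notin> K \<Longrightarrow> g x = 0" by (rule Cc_compact[OF Cc(3,1)]) blast
  have lcS: "locally_compact_space ?S" by (rule lc[OF Cc(1,2)])
  have "\<exists>B h L. openin X B \<and> B \<subseteq> U \<and> Q B \<and> continuous_map ?S euclideanreal h \<and> h x = 1 \<and> (\<forall>y\<in>U. 0 \<le> h y) \<and>
      compactin X L \<and> L \<subseteq> B \<and> (\<forall>y\<in>U - L. h y = 0)" if x: "x \<in> K" for x
  proof -
    obtain W where W: "openin X W" "x \<in> W" "Q W" using cov[of x] x K(2) US by blast
    have o: "openin X (U \<inter> W)" using W Cc(1) by (simp add: openin_Int)
    have oS: "openin ?S (U \<inter> W)" using o Cc(1) by (simp add: openin_open_subtopology)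
    obtain h L where h: "continuous_map ?S euclideanreal h" "h x = 1" "\<And>y. y \<in> topspace ?S \<Longrightarrow> 0 \<le> h y"
        "compactin ?S L" "L \<subseteq> U \<inter> W" "\<And>y. y \<in> topspace ?S - L \<Longrightarrow> h y = 0"
      using bump_function[OF lcS Cc(2) oS, of x] x K(2) W(2) by blast
    have "Q (U \<inter> W)" using her[OF W(3,1) o] by blast
    then show ?thesis using h o tS by (intro exI[of _ "U \<inter> W"] exI[of _ h] exI[of _ L]) (auto simp: compactin_subtopology)
  qed
  then obtain B h L where BhL: "\<And>x. x \<in> K \<Longrightarrow> openin X (B x) \<and> B x \<subseteq> U \<and> Q (B x) \<and> continuous_map ?S euclideanreal (h x)
     \<and> h x x = 1 \<and> (\<forall>y\<in>U. 0 \<le> h x y) \<and> compactin X (L x) \<and> L x \<subseteq> B x \<and> (\<forall>y\<in>U - L x. h x y = (0::real))"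
    by metis
  define O' where "O' x = {y \<in> U. h x y > 1/2}" for x
  have Oo: "openin X (O' x)" if "x \<in> K" for x
  proof -
    have "openin ?S {y \<in> topspace ?S. h x y \<in> {1/2<..}}"
      by (rule openin_continuous_map_preimage) (use BhL[OF that] in auto)
    moreover have "{y \<in> topspace ?S. h x y \<in> {1/2<..}} = O' x" unfolding tS O'_def by auto
    ultimately show ?thesis using openin_trans_full[OF _ Cc(1)] by simp
  qed
  have "x \<in> O' x" if "x \<in> K" for x
    using BhL[OF that] subsetD[OF K(2) that] by (simp add: O'_def)
  then have "K \<subseteq> \<Union>(O' ` K)" by blast
  moreover have "\<forall>T\<in>O' ` K. openin X T" using Oo by blast
  ultimately obtain \<F> where "finite \<F>" "\<F> \<subseteq> O' ` K" "K \<subseteq> \<Union>\<F>"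
    using K(1) unfolding compactin_def by meson
  then obtain F where F: "finite F" "F \<subseteq> K" "K \<subseteq> \<Union>(O' ` F)"
    using finite_subset_image[of \<F> O' K] by blast
  define s where "s y = (\<Sum>x\<in>F. h x y)" for y
  \<comment> \<open>The bumps sum to at least one half on the support; cutting off below keeps the quotient continuous elsewhere.\<close>
  define D where "D y = max (1/2) (s y)" for y
  define gx where "gx x y = g y * complex_of_real (h x y / D y)" for x y
  have sK: "s y \<ge> 1/2" if yK: "y \<in> K" for y
  proof -
    obtain x where x: "x \<in> F" "y \<in> O' x" using F(3) yK by blast
    have "0 \<le> h x' y" if "x' \<in> F" for x'
      using BhL[of x'] that F(2) subsetD[OF K(2) yK] by blast
    then have "h x y \<le> s y" unfolding s_def
      by (intro member_le_sum) (use x F(1) in auto)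
    then show ?thesis using x by (simp add: O'_def)
  qed
  have sum: "g = (\<lambda>y. \<Sum>x\<in>F. gx x y)"
  proof
    fix y
    show "g y = (\<Sum>x\<in>F. gx x y)"
    proof (cases "y \<in> K")
      case True
      have "(\<Sum>x\<in>F. gx x y) = g y * complex_of_real (s y / D y)"
        by (simp add: gx_def s_def sum_distrib_left[symmetric] sum_divide_distrib[symmetric] of_real_sum[symmetric]
            del: of_real_sum)
      also have "s y / D y = 1" using sK[OF True] by (simp add: D_def max_def)
      finally show ?thesis by simp
    qed (simp add: K(3) gx_def)
  qed
  have gxCc: "gx x \<in> Cc X (B x)" if x: "x \<in> F" for x
  proof (rule CcI)
    have x': "x \<in> K" using x F by blast
    note b = BhL[OF x']
    show "openin X (B x)" "compactin X (L x)" "L x \<subseteq> B x" using b by auto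
    have "Hausdorff_space (subtopology ?S (B x))" by (rule Hausdorff_space_subtopology[OF Cc(2)])
    then show "Hausdorff_space (subtopology X (B x))" using b by (simp add: subtopology_subtopology Int_absorb1)
    have "continuous_map ?S euclideanreal s"
      unfolding s_def by (rule continuous_map_sum[OF F(1)]) (use BhL F in auto)
    then have "continuous_map ?S euclidean (\<lambda>y. complex_of_real (h x y / D y))"
      using b unfolding continuous_map_atin D_def by (auto intro!: tendsto_of_real tendsto_divide tendsto_max)
    then have "continuous_map ?S euclidean (gx x)"
      unfolding gx_def by (rule continuous_map_mult_complex[OF Cc_cont[OF Cc(3)]])
    then show "continuous_map (subtopology X (B x)) euclidean (gx x)"
      by (rule continuous_map_from_subtopology_mono) (use b in auto)
    show "gx x y = 0" if "y \<notin> L x" for y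
      using that b K by (cases "y \<in> U") (auto simp: gx_def)
  qed
  have "P (\<lambda>y. \<Sum>x\<in>F'. gx x y)" if "F' \<subseteq> F" for F'
    using finite_subset[OF that F(1)] that
  proof (induction F' rule: finite_induct)
    case empty then show ?case using z by simp
  next
    case (insert x F')
    have x': "x \<in> K" using insert F by blast
    note b = BhL[OF x']
    have "Hausdorff_space (subtopology ?S (B x))" by (rule Hausdorff_space_subtopology[OF Cc(2)])
    then have "Hausdorff_space (subtopology X (B x))" using b by (simp add: subtopology_subtopology Int_absorb1)
    then have "P (gx x)" using b insert by (intro c[of "B x"]) (auto intro!: gxCc)
    then show ?case using a[of "gx x" "\<lambda>y. \<Sum>x\<in>F'. gx x y"] insert by simp
  qed
  then show ?case using sum by (metis order_refl)
qed (use z a s in auto)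

definition chart :: "'a topology \<Rightarrow> 'b topology \<Rightarrow> ('a \<Rightarrow> 'b) \<Rightarrow> 'a set \<Rightarrow> bool" where
  "chart X Y f U \<longleftrightarrow> openin X U \<and> openin Y (f ` U) \<and>
     homeomorphic_map (subtopology X U) (subtopology Y (f ` U)) f"

lemma chart_inj: "chart X Y f U \<Longrightarrow> inj_on f U"
  unfolding chart_def homeomorphic_map_def using openin_subset[of X U] by (auto simp: Int_absorb1)

lemma chart_subset:
  assumes "chart X Y f U" "openin X U'" "U' \<subseteq> U"
  shows "chart X Y f U'"
proof -
  have h: "homeomorphic_map (subtopology X U) (subtopology Y (f ` U)) f" and o: "openin X U" "openin Y (f ` U)"
    using assms by (auto simp: chart_def)
  have "openin (subtopology X U) U'" using assms o by (simp add: openin_open_subtopology)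
  then have "openin (subtopology Y (f ` U)) (f ` U')"
    using homeomorphic_map_openness[OF h, of U'] openin_subset by blast
  then have o': "openin Y (f ` U')" using o(2) by (rule openin_trans_full)
  have "homeomorphic_map (subtopology (subtopology X U) U') (subtopology (subtopology Y (f ` U)) (f ` U')) f"
    by (rule homeomorphic_map_subtopologies[OF h])
      (use assms o o' openin_subset[OF assms(2)] openin_subset[OF o'] in auto)
  then show ?thesis using assms o' by (simp add: chart_def subtopology_subtopology Int_absorb1 image_mono)
qed

lemma local_homeo_chart:
  "local_homeomorphism X Y f \<Longrightarrow> x \<in> topspace X \<Longrightarrow> \<exists>U. chart X Y f U \<and> x \<in> U"
  unfolding local_homeomorphism_def chart_def by blast

lemma chart_section:
  assumes "chart X Y f U"
  obtains g where "continuous_map (subtopology Y (f ` U)) X g" "\<And>x. x \<in> U \<Longrightarrow> g (f x) = x"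
    "\<And>y. y \<in> f ` U \<Longrightarrow> g y \<in> U \<and> f (g y) = y"
proof -
  have h: "homeomorphic_map (subtopology X U) (subtopology Y (f ` U)) f" and o: "openin X U" "openin Y (f ` U)"
    using assms by (auto simp: chart_def)
  obtain g where g: "homeomorphic_maps (subtopology X U) (subtopology Y (f ` U)) f g"
    using h by (auto simp: homeomorphic_map_maps)
  have t: "topspace (subtopology X U) = U" "topspace (subtopology Y (f ` U)) = f ` U"
    using o openin_subset by fastforce+
  show ?thesis
  proof (rule that[of g])
    show "continuous_map (subtopology Y (f ` U)) X g"
      using g by (auto simp: homeomorphic_maps_def intro: continuous_map_into_fulltopology)
    show "g (f x) = x" if "x \<in> U" for x using g t that by (auto simp: homeomorphic_maps_def)
    then show "g y \<in> U \<and> f (g y) = y" if "y \<in> f ` U" for y using that by auto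
  qed
qed

lemma local_homeo_continuous:
  assumes "local_homeomorphism X Y f" shows "continuous_map X Y f"
proof (rule pasting_lemma[where I = "{U. chart X Y f U}" and T = id and f = "\<lambda>_. f"])
  fix U assume "U \<in> {U. chart X Y f U}"
  then show "openin X (id U)" "continuous_map (subtopology X (id U)) Y f"
    using homeomorphic_imp_continuous_map by (auto simp: chart_def intro: continuous_map_into_fulltopology)
qed (use local_homeo_chart[OF assms] in auto)

text \<open>Cover the compact set by finitely many charts; each of them meets a fibre in at most one point. All
uniform bounds on numbers of nonzero coefficients come from here.\<close>

lemma local_homeo_fibre_card:
  assumes lh: "local_homeomorphism X Y f" and K: "compactin X K"
  obtains N :: nat where "\<And>y. finite {x \<in> K. f x = y}" "\<And>y. card {x \<in> K. f x = y} \<le> N"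
proof -
  let ?\<U> = "{U. chart X Y f U}"
  have "K \<subseteq> \<Union>?\<U>" using local_homeo_chart[OF lh] compactin_subset_topspace[OF K] by blast
  moreover have "\<forall>U\<in>?\<U>. openin X U" by (auto simp: chart_def)
  ultimately obtain \<F> where F: "finite \<F>" "\<F> \<subseteq> ?\<U>" "K \<subseteq> \<Union>\<F>"
    using K unfolding compactin_def by meson
  have "finite {x \<in> K. f x = y} \<and> card {x \<in> K. f x = y} \<le> card \<F>" for y
  proof -
    define U where "U x = (SOME U. U \<in> \<F> \<and> x \<in> U)" for x
    have U: "U x \<in> \<F> \<and> x \<in> U x" if "x \<in> K" for x
      unfolding U_def by (rule someI_ex) (use that F in blast)
    have inj: "inj_on U {x \<in> K. f x = y}"
    proof (rule inj_onI)
      fix x x' assume a: "x \<in> {x \<in> K. f x = y}" "x' \<in> {x \<in> K. f x = y}" "U x = U x'"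
      have "inj_on f (U x)" using U[of x] a F(2) chart_inj by blast
      then show "x = x'" using U[of x] U[of x'] a by (auto dest: inj_onD)
    qed
    have sub: "U ` {x \<in> K. f x = y} \<subseteq> \<F>" using U by auto
    show ?thesis using inj_on_finite[OF inj sub F(1)] card_inj_on_le[OF inj sub F(1)] by simp
  qed
  then show ?thesis using that by blast
qed

text \<open>A single compact neighbourhood of each point need not be inherited by open subsets of a space that is not Hausdorff. Here it is, because
charts identify small open sets with open subsets of the locally compact Hausdorff base.\<close>

lemma local_homeo_locally_compact:
  assumes lh: "local_homeomorphism X Y f" and Y: "locally_compact_space Y" "Hausdorff_space Y"
    and U: "openin X U" "Hausdorff_space (subtopology X U)"
  shows "locally_compact_space (subtopology X U)"
  unfolding locally_compact_space_def
proof
  fix x assume "x \<in> topspace (subtopology X U)"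
  then have x: "x \<in> topspace X" "x \<in> U" by auto
  obtain W where W: "chart X Y f W" "x \<in> W" using local_homeo_chart[OF lh x(1)] by blast
  have W': "chart X Y f (W \<inter> U)" by (rule chart_subset[OF W(1)]) (use W U in \<open>auto simp: chart_def openin_Int\<close>)
  then have o: "openin X (W \<inter> U)" "openin Y (f ` (W \<inter> U))"
    "subtopology X (W \<inter> U) homeomorphic_space subtopology Y (f ` (W \<inter> U))"
    by (auto simp: chart_def homeomorphic_map_imp_homeomorphic_space)
  have "locally_compact_space (subtopology Y (f ` (W \<inter> U)))"
    using locally_compact_space_open_subset[OF _ Y(1) o(2)] Y(2) by blast
  then have "locally_compact_space (subtopology X (W \<inter> U))"
    using homeomorphic_locally_compact_space[OF o(3)] by simp
  moreover have "x \<in> topspace (subtopology X (W \<inter> U))" using x W by simp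
  ultimately obtain V K where VK: "openin (subtopology X (W \<inter> U)) V" "compactin (subtopology X (W \<inter> U)) K"
     "x \<in> V" "V \<subseteq> K" unfolding locally_compact_space_def by blast
  have "openin X V" using VK(1) o(1) by (rule openin_trans_full)
  moreover have "V \<subseteq> U" using VK by (auto simp: compactin_subtopology)
  ultimately have "openin (subtopology X U) V" using U(1) by (simp add: openin_open_subtopology)
  moreover have "compactin (subtopology X U) K" using VK(2) by (auto simp: compactin_subtopology)
  ultimately show "\<exists>U' K. openin (subtopology X U) U' \<and> compactin (subtopology X U) K \<and> x \<in> U' \<and> U' \<subseteq> K"
    using VK by blast
qed

section \<open>Convolution along a groupoid action\<close>

context topological_groupoid
begin

lemma unitsD: "u \<in> units G \<Longrightarrow> u \<in> arrows G" "u \<in> units G \<Longrightarrow> src G u = u" "u \<in> units G \<Longrightarrow> rng G u = u"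
  by (auto simp: units_def src_closed src_src rng_src)

lemma src_unitI: "\<gamma> \<in> arrows G \<Longrightarrow> src G \<gamma> \<in> units G"
  by (simp add: units_def)

lemma rng_unitI: "\<gamma> \<in> arrows G \<Longrightarrow> rng G \<gamma> \<in> units G"
  by (metis src_rng src_unitI rng_closed)

lemma topspace_unit_space: "topspace (unit_space G) = units G"
  using unitsD(1) by (auto simp: unit_space_def arrows_def)

lemma mult_inv_cancel:
  "\<lbrakk>\<gamma> \<in> arrows G; \<eta> \<in> arrows G; rng G \<gamma> = rng G \<eta>\<rbrakk> \<Longrightarrow> gmult G \<gamma> (gmult G (ginv G \<gamma>) \<eta>) = \<eta>"
  by (metis inv_closed inv_right mult_assoc rng_inv rng_unit src_inv)

lemma inv_mult_cancel:
  "\<lbrakk>\<gamma> \<in> arrows G; \<eta> \<in> arrows G; src G \<gamma> = rng G \<eta>\<rbrakk> \<Longrightarrow> gmult G (ginv G \<gamma>) (gmult G \<gamma> \<eta>) = \<eta>"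
  by (metis inv_closed inv_left mult_assoc rng_unit src_inv)

lemma inv_inv: "\<gamma> \<in> arrows G \<Longrightarrow> ginv G (ginv G \<gamma>) = \<gamma>"
  by (metis inv_closed inv_mult_cancel inv_left rng_inv src_inv src_unit)

lemma inv_mult:
  assumes "\<gamma> \<in> arrows G" "\<eta> \<in> arrows G" "src G \<gamma> = rng G \<eta>"
  shows "ginv G (gmult G \<gamma> \<eta>) = gmult G (ginv G \<eta>) (ginv G \<gamma>)"
proof -
  let ?x = "gmult G \<gamma> \<eta>" and ?y = "gmult G (ginv G \<eta>) (ginv G \<gamma>)"
  have c: "?x \<in> arrows G" "?y \<in> arrows G" "src G ?x = src G \<eta>" "rng G ?y = src G \<eta>" "rng G ?x = rng G \<gamma>"
    using assms by (auto simp: mult_closed inv_closed src_inv rng_inv src_mult rng_mult)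
  have "gmult G ?x ?y = gmult G \<gamma> (gmult G \<eta> ?y)"
    using assms c by (intro mult_assoc) auto
  also have "gmult G \<eta> ?y = ginv G \<gamma>"
    using assms by (intro mult_inv_cancel) (auto simp: inv_closed rng_inv)
  also have "gmult G \<gamma> (ginv G \<gamma>) = rng G \<gamma>" using assms by (intro inv_right)
  finally have xy: "gmult G ?x ?y = rng G \<gamma>" .
  have "ginv G ?x = gmult G (ginv G ?x) (gmult G ?x ?y)"
    unfolding xy using src_unit[OF inv_closed[OF c(1)]] src_inv[OF c(1)] c(5) by simp
  also have "\<dots> = ?y" using c by (intro inv_mult_cancel) auto
  finally show ?thesis .
qed

lemma inv_unit: "u \<in> units G \<Longrightarrow> ginv G u = u"
  by (metis inv_closed inv_left src_inv src_unit unitsD)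

lemma homeomorphic_inv: "homeomorphic_maps (gtop G) (gtop G) (ginv G) (ginv G)"
  unfolding homeomorphic_maps_def using continuous_inv inv_inv by (auto simp: arrows_def)

end

context lc_etale_groupoid
begin

lemma open_Hausdorff_locally_compact:
  "\<lbrakk>openin (gtop G) U; Hausdorff_space (subtopology (gtop G) U)\<rbrakk>
    \<Longrightarrow> locally_compact_space (subtopology (gtop G) U)"
  by (rule local_homeo_locally_compact[OF etale_src units_locally_compact units_Hausdorff])

lemma CC_fibres:
  assumes a: "a \<in> CC (gtop G)"
  obtains N :: nat and M where "1 \<le> N" "0 \<le> M" "\<And>\<gamma>. cmod (a \<gamma>) \<le> M"
    "\<And>u. finite {\<gamma> \<in> src_fibre G u. a \<gamma> \<noteq> 0}" "\<And>u. card {\<gamma> \<in> src_fibre G u. a \<gamma> \<noteq> 0} \<le> N"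
    "\<And>u. finite {\<gamma> \<in> rng_fibre G u. a \<gamma> \<noteq> 0}" "\<And>u. card {\<gamma> \<in> rng_fibre G u. a \<gamma> \<noteq> 0} \<le> N"
proof -
  obtain K M where K: "compactin (gtop G) K" "\<And>x. x \<notin> K \<Longrightarrow> a x = 0" "0 \<le> M" "\<And>x. cmod (a x) \<le> M"
    by (rule CC_support[OF a]) blast
  obtain N1 where N1: "\<And>y. finite {x \<in> K. src G x = y}" "\<And>y. card {x \<in> K. src G x = y} \<le> N1"
    by (rule local_homeo_fibre_card[OF etale_src K(1)]) blast
  obtain N2 where N2: "\<And>y. finite {x \<in> K. rng G x = y}" "\<And>y. card {x \<in> K. rng G x = y} \<le> N2"
    by (rule local_homeo_fibre_card[OF etale_rng K(1)]) blast
  have s: "{\<gamma> \<in> src_fibre G u. a \<gamma> \<noteq> 0} \<subseteq> {x \<in> K. src G x = u}" for u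
    using K(2) by (auto simp: src_fibre_def)
  have r: "{\<gamma> \<in> rng_fibre G u. a \<gamma> \<noteq> 0} \<subseteq> {x \<in> K. rng G x = u}" for u
    using K(2) by (auto simp: rng_fibre_def)
  show ?thesis
  proof (rule that[of "max 1 (max N1 N2)" M])
    show "card {\<gamma> \<in> src_fibre G u. a \<gamma> \<noteq> 0} \<le> max 1 (max N1 N2)" for u
      using card_mono[OF N1(1) s, of u] N1(2)[of u] by linarith
    show "card {\<gamma> \<in> rng_fibre G u. a \<gamma> \<noteq> 0} \<le> max 1 (max N1 N2)" for u
      using card_mono[OF N2(1) r, of u] N2(2)[of u] by linarith
  qed (use K finite_subset[OF s N1(1)] finite_subset[OF r N2(1)] in auto)
qed

lemma finite_rng_support: "a \<in> CC (gtop G) \<Longrightarrow> finite {\<gamma> \<in> rng_fibre G u. a \<gamma> \<noteq> 0}"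
  using CC_fibres by metis

text \<open>The inversion is a homeomorphism. The cut is needed because nothing is known about \<open>ginv G\<close> outside the
arrows.\<close>

lemma CC_inv: "a \<in> CC (gtop G) \<Longrightarrow> cut (arrows G) (a \<circ> ginv G) \<in> CC (gtop G)"
proof (induction rule: CC_induct)
  case zero
  have "cut (arrows G) ((\<lambda>x. 0) \<circ> ginv G) = (\<lambda>x. 0)" by (auto simp: cut_def)
  then show ?case by (simp only: CC_zero)
next
  case (add f g)
  have "cut (arrows G) ((\<lambda>x. f x + g x) \<circ> ginv G)
     = (\<lambda>\<gamma>. cut (arrows G) (f \<circ> ginv G) \<gamma> + cut (arrows G) (g \<circ> ginv G) \<gamma>)" by (auto simp: cut_def)
  then show ?case using CC_add[OF add] by (simp only:)
next
  case (scale c f)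
  have "cut (arrows G) ((\<lambda>x. c * f x) \<circ> ginv G) = (\<lambda>\<gamma>. c * cut (arrows G) (f \<circ> ginv G) \<gamma>)"
    by (auto simp: cut_def)
  then show ?case using CC_scale[OF scale, of c] by (simp only:)
next
  case (Cc U g)
  obtain K where K: "compactin (gtop G) K" "K \<subseteq> U" "\<And>x. x \<notin> K \<Longrightarrow> g x = 0" by (rule Cc_compact[OF Cc(3,1)]) blast
  have US: "U \<subseteq> arrows G" using openin_subset[OF Cc(1)] by (simp add: arrows_def)
  let ?V = "ginv G ` U"
  have hm: "homeomorphic_map (gtop G) (gtop G) (ginv G)" using homeomorphic_inv homeomorphic_maps_map by blast
  have VS: "?V \<subseteq> arrows G" using US inv_closed by blast
  have oV: "openin (gtop G) ?V" using homeomorphic_map_openness[OF hm, of U] Cc(1) US by (simp add: arrows_def)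
  have "homeomorphic_map (subtopology (gtop G) U) (subtopology (gtop G) ?V) (ginv G)"
    by (rule homeomorphic_map_subtopologies[OF hm]) (use US VS in \<open>auto simp: arrows_def\<close>)
  then have H: "Hausdorff_space (subtopology (gtop G) ?V)"
    using Cc(2) homeomorphic_Hausdorff_space homeomorphic_map_imp_homeomorphic_space by blast
  have "cut (arrows G) (g \<circ> ginv G) \<in> Cc (gtop G) ?V"
  proof (rule CcI[OF oV H])
    have "continuous_map (subtopology (gtop G) ?V) (subtopology (gtop G) U) (ginv G)"
      using continuous_map_from_subtopology[OF continuous_inv] US
      by (intro continuous_map_into_subtopology) (auto simp: inv_inv subset_iff)
    then have "continuous_map (subtopology (gtop G) ?V) euclidean (g \<circ> ginv G)"
      using Cc_cont[OF Cc(3)] continuous_map_compose by blast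
    then show "continuous_map (subtopology (gtop G) ?V) euclidean (cut (arrows G) (g \<circ> ginv G))"
      by (rule continuous_map_eq) (use VS in \<open>auto simp: cut_def\<close>)
    show "compactin (gtop G) (ginv G ` K)" by (rule image_compactin[OF K(1) continuous_inv])
    show "cut (arrows G) (g \<circ> ginv G) \<gamma> = 0" if "\<gamma> \<notin> ginv G ` K" for \<gamma>
    proof (cases "\<gamma> \<in> arrows G")
      case True
      then have "ginv G \<gamma> \<notin> K" using that inv_inv[OF True] by (metis imageI)
      then show ?thesis using K(3) by (simp add: cut_def)
    qed (simp add: cut_def)
  qed (use K in auto)
  then show ?case by (rule CC_Cc[OF oV H])
qed

end

text \<open>The operator \<open>\<Pi>(a)\<close>. It is the product \<open>conv G\<close> when \<open>G\<close> acts on itself and \<open>act_left\<close> when it acts on a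
correspondence.\<close>

definition act_conv :: "'g groupoid \<Rightarrow> 'x topology \<Rightarrow> ('x \<Rightarrow> 'g) \<Rightarrow> ('g \<Rightarrow> 'x \<Rightarrow> 'x)
    \<Rightarrow> ('g \<Rightarrow> complex) \<Rightarrow> ('x \<Rightarrow> complex) \<Rightarrow> 'x \<Rightarrow> complex" where
  "act_conv G X anc act a \<phi> = cut (topspace X)
     (\<lambda>z. \<Sum>\<^sub>\<infinity>\<gamma>\<in>rng_fibre G (anc z). a \<gamma> * \<phi> (act (ginv G \<gamma>) z))"

lemma infsum_Sigma_finite:
  fixes f :: "'a \<Rightarrow> 'b \<Rightarrow> complex"
  assumes "finite {(x, y) \<in> Sigma A B. f x y \<noteq> 0}"
  shows "(\<Sum>\<^sub>\<infinity>x\<in>A. \<Sum>\<^sub>\<infinity>y\<in>B x. f x y) = (\<Sum>\<^sub>\<infinity>(x, y)\<in>Sigma A B. f x y)"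
  by (rule infsum_Sigma'_banach, rule finite_nonzero_values_imp_summable_on)
    (rule finite_subset[OF _ assms], auto)

lemma infsum_swap_finite:
  fixes f :: "'a \<Rightarrow> 'b \<Rightarrow> complex"
  assumes "finite {(x, y) \<in> A \<times> B. f x y \<noteq> 0}"
  shows "(\<Sum>\<^sub>\<infinity>x\<in>A. \<Sum>\<^sub>\<infinity>y\<in>B. f x y) = (\<Sum>\<^sub>\<infinity>y\<in>B. \<Sum>\<^sub>\<infinity>x\<in>A. f x y)"
  by (rule infsum_swap_banach, rule finite_nonzero_values_imp_summable_on)
    (rule finite_subset[OF _ assms], auto)

locale left_action = lc_etale_groupoid G for G :: "'g groupoid" +
  fixes X :: "'x topology" and anc :: "'x \<Rightarrow> 'g" and act :: "'g \<Rightarrow> 'x \<Rightarrow> 'x"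
  assumes anc_cont: "continuous_map X (unit_space G) anc"
    and act_closed: "\<lbrakk>\<gamma> \<in> arrows G; z \<in> topspace X; src G \<gamma> = anc z\<rbrakk> \<Longrightarrow> act \<gamma> z \<in> topspace X"
    and anc_act: "\<lbrakk>\<gamma> \<in> arrows G; z \<in> topspace X; src G \<gamma> = anc z\<rbrakk> \<Longrightarrow> anc (act \<gamma> z) = rng G \<gamma>"
    and act_unit: "z \<in> topspace X \<Longrightarrow> act (anc z) z = z"
    and act_mult: "\<lbrakk>\<gamma> \<in> arrows G; \<eta> \<in> arrows G; z \<in> topspace X; src G \<gamma> = rng G \<eta>; src G \<eta> = anc z\<rbrakk>
          \<Longrightarrow> act (gmult G \<gamma> \<eta>) z = act \<gamma> (act \<eta> z)"
    and act_cont: "continuous_map (subtopology (prod_topology (gtop G) X) {(\<gamma>, z). src G \<gamma> = anc z}) X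
          (\<lambda>(\<gamma>, z). act \<gamma> z)"
begin

abbreviation convolve where "convolve \<equiv> act_conv G X anc act"

lemma anc_unit: "z \<in> topspace X \<Longrightarrow> anc z \<in> units G"
  using anc_cont topspace_unit_space by (auto simp: continuous_map_def)

lemma rng_fibreD: "\<gamma> \<in> rng_fibre G u \<Longrightarrow> \<gamma> \<in> arrows G" "\<gamma> \<in> rng_fibre G u \<Longrightarrow> rng G \<gamma> = u"
  by (auto simp: rng_fibre_def)

lemma inv_act_closed:
  assumes "z \<in> topspace X" "\<gamma> \<in> rng_fibre G (anc z)"
  shows "act (ginv G \<gamma>) z \<in> topspace X" "anc (act (ginv G \<gamma>) z) = src G \<gamma>"
  using assms by (auto simp: rng_fibre_def inv_closed src_inv rng_inv act_closed anc_act)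

lemma act_inv_act:
  assumes "z \<in> topspace X" "\<gamma> \<in> rng_fibre G (anc z)"
  shows "act \<gamma> (act (ginv G \<gamma>) z) = z"
proof -
  have g: "\<gamma> \<in> arrows G" "rng G \<gamma> = anc z" using assms(2) by (auto simp: rng_fibre_def)
  have "act \<gamma> (act (ginv G \<gamma>) z) = act (gmult G \<gamma> (ginv G \<gamma>)) z"
    using assms(1) g by (intro act_mult[symmetric]) (auto simp: inv_closed src_inv rng_inv)
  then show ?thesis using g assms(1) by (simp add: inv_right act_unit)
qed

lemma inv_act_act:
  assumes "z \<in> topspace X" "\<gamma> \<in> arrows G" "src G \<gamma> = anc z"
  shows "act (ginv G \<gamma>) (act \<gamma> z) = z"
proof -
  have "act (ginv G \<gamma>) (act \<gamma> z) = act (gmult G (ginv G \<gamma>) \<gamma>) z"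
    using assms by (intro act_mult[symmetric]) (auto simp: inv_closed src_inv rng_inv)
  then show ?thesis using assms by (simp add: inv_left act_unit)
qed

lemma convolve_eq_sum:
  assumes "z \<in> topspace X" "finite S" "S \<subseteq> rng_fibre G (anc z)" "\<And>\<gamma>. \<gamma> \<in> rng_fibre G (anc z) - S \<Longrightarrow> a \<gamma> = 0"
  shows "convolve a \<phi> z = (\<Sum>\<gamma>\<in>S. a \<gamma> * \<phi> (act (ginv G \<gamma>) z))"
  using infsum_eq_sum[OF assms(2,3), of "\<lambda>\<gamma>. a \<gamma> * \<phi> (act (ginv G \<gamma>) z)"] assms(1,4)
  by (simp add: act_conv_def cut_def)

lemma convolve_sum:
  assumes "a \<in> CC (gtop G)" "z \<in> topspace X"
  shows "convolve a \<phi> z = (\<Sum>\<gamma>\<in>{\<gamma> \<in> rng_fibre G (anc z). a \<gamma> \<noteq> 0}. a \<gamma> * \<phi> (act (ginv G \<gamma>) z))"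
  by (rule convolve_eq_sum[OF assms(2)]) (use finite_rng_support[OF assms(1)] in auto)

lemma convolve_outside: "z \<notin> topspace X \<Longrightarrow> convolve a \<phi> z = 0"
  by (simp add: act_conv_def cut_def)

lemma convolve_add_right:
  assumes "a \<in> CC (gtop G)" shows "convolve a (\<lambda>x. \<phi> x + \<psi> x) = (\<lambda>z. convolve a \<phi> z + convolve a \<psi> z)"
proof
  fix z show "convolve a (\<lambda>x. \<phi> x + \<psi> x) z = convolve a \<phi> z + convolve a \<psi> z"
    by (cases "z \<in> topspace X") (simp_all add: convolve_sum[OF assms] convolve_outside distrib_left sum.distrib)
qed

lemma convolve_scale_right:
  assumes "a \<in> CC (gtop G)" shows "convolve a (\<lambda>x. c * \<phi> x) = (\<lambda>z. c * convolve a \<phi> z)"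
proof
  fix z show "convolve a (\<lambda>x. c * \<phi> x) z = c * convolve a \<phi> z"
    by (cases "z \<in> topspace X") (simp_all add: convolve_sum[OF assms] convolve_outside sum_distrib_left mult_ac)
qed

lemma convolve_add_left:
  assumes "a \<in> CC (gtop G)" "b \<in> CC (gtop G)" shows "convolve (\<lambda>x. a x + b x) \<phi> = (\<lambda>z. convolve a \<phi> z + convolve b \<phi> z)"
proof
  fix z show "convolve (\<lambda>x. a x + b x) \<phi> z = convolve a \<phi> z + convolve b \<phi> z"
  proof (cases "z \<in> topspace X")
    case True
    let ?S = "{\<gamma> \<in> rng_fibre G (anc z). a \<gamma> \<noteq> 0} \<union> {\<gamma> \<in> rng_fibre G (anc z). b \<gamma> \<noteq> 0}"
    have S: "finite ?S" "?S \<subseteq> rng_fibre G (anc z)" using finite_rng_support assms by auto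
    show ?thesis
      using convolve_eq_sum[OF True S, of a] convolve_eq_sum[OF True S, of b] convolve_eq_sum[OF True S, of "\<lambda>x. a x + b x"]
      by (simp add: distrib_right sum.distrib)
  qed (simp add: convolve_outside)
qed

lemma convolve_scale_left:
  assumes "a \<in> CC (gtop G)" shows "convolve (\<lambda>x. c * a x) \<phi> = (\<lambda>z. c * convolve a \<phi> z)"
proof
  fix z show "convolve (\<lambda>x. c * a x) \<phi> z = c * convolve a \<phi> z"
  proof (cases "z \<in> topspace X")
    case True
    let ?S = "{\<gamma> \<in> rng_fibre G (anc z). a \<gamma> \<noteq> 0}"
    have S: "finite ?S" "?S \<subseteq> rng_fibre G (anc z)" using finite_rng_support assms by auto
    show ?thesis
      using convolve_eq_sum[OF True S, of a] convolve_eq_sum[OF True S, of "\<lambda>x. c * a x"]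
      by (simp add: sum_distrib_left mult_ac)
  qed (simp add: convolve_outside)
qed

text \<open>The transpose of \<open>\<Pi>(a)\<close> is \<open>\<Pi>\<close> of \<open>a\<close> composed with the inversion. The substitution is the involution
\<open>(z, \<gamma>) \<mapsto> (\<gamma>\<^sup>-\<^sup>1 z, \<gamma>\<^sup>-\<^sup>1)\<close> of the pairs with \<open>r(\<gamma>) = r(z)\<close>.\<close>

lemma convolve_adjoint:
  assumes a: "a \<in> CC (gtop G)" and Y: "Y \<subseteq> topspace X"
    and inv: "\<And>\<gamma> z. \<lbrakk>z \<in> Y; \<gamma> \<in> arrows G; src G \<gamma> = anc z\<rbrakk> \<Longrightarrow> act \<gamma> z \<in> Y"
    and c: "finite {z \<in> Y. c z \<noteq> 0}"
  shows "(\<Sum>\<^sub>\<infinity>z\<in>Y. c z * convolve a \<zeta> z) = (\<Sum>\<^sub>\<infinity>w\<in>Y. convolve (\<lambda>\<gamma>. a (ginv G \<gamma>)) c w * \<zeta> w)"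
proof -
  let ?R = "\<lambda>z. rng_fibre G (anc z)"
  let ?f = "\<lambda>z \<gamma>. c z * (a \<gamma> * \<zeta> (act (ginv G \<gamma>) z))"
  let ?g = "\<lambda>w \<eta>. a (ginv G \<eta>) * c (act (ginv G \<eta>) w) * \<zeta> w"
  let ?j = "\<lambda>(z, \<gamma>). (act (ginv G \<gamma>) z, ginv G \<gamma>)"
  have jj: "?j p \<in> Sigma Y ?R" "?j (?j p) = p" "(\<lambda>(w, \<eta>). ?g w \<eta>) (?j p) = (\<lambda>(z, \<gamma>). ?f z \<gamma>) p"
    if pS: "p \<in> Sigma Y ?R" for p
  proof -
    obtain z \<gamma> where p: "p = (z, \<gamma>)" "z \<in> Y" "\<gamma> \<in> ?R z" using pS by auto
    have g: "\<gamma> \<in> arrows G" "rng G \<gamma> = anc z" "z \<in> topspace X" using p Y by (auto simp: rng_fibre_def)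
    have ii: "ginv G (ginv G \<gamma>) = \<gamma>" by (rule inv_inv[OF g(1)])
    have aa: "act \<gamma> (act (ginv G \<gamma>) z) = z" by (rule act_inv_act[OF g(3) p(3)])
    have "act (ginv G \<gamma>) z \<in> Y" by (rule inv) (use p g in \<open>auto simp: inv_closed src_inv\<close>)
    moreover have "ginv G \<gamma> \<in> ?R (act (ginv G \<gamma>) z)"
      using inv_act_closed[OF g(3) p(3)] g by (simp add: rng_fibre_def inv_closed rng_inv)
    ultimately show "?j p \<in> Sigma Y ?R" using p by simp
    show "?j (?j p) = p" using p ii aa by simp
    show "(\<lambda>(w, \<eta>). ?g w \<eta>) (?j p) = (\<lambda>(z, \<gamma>). ?f z \<gamma>) p" using p ii aa by simp
  qed
  have finf: "finite {(z, \<gamma>) \<in> Sigma Y ?R. ?f z \<gamma> \<noteq> 0}"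
    by (rule finite_subset[of _ "Sigma {z \<in> Y. c z \<noteq> 0} (\<lambda>z. {\<gamma> \<in> ?R z. a \<gamma> \<noteq> 0})"])
      (use c finite_rng_support[OF a] in auto)
  have fing: "finite {(w, \<eta>) \<in> Sigma Y ?R. ?g w \<eta> \<noteq> 0}"
  proof (rule finite_subset[OF _ finite_imageI[OF finf, of ?j]])
    show "{(w, \<eta>) \<in> Sigma Y ?R. ?g w \<eta> \<noteq> 0} \<subseteq> ?j ` {(z, \<gamma>) \<in> Sigma Y ?R. ?f z \<gamma> \<noteq> 0}"
    proof
      fix q assume q: "q \<in> {(w, \<eta>) \<in> Sigma Y ?R. ?g w \<eta> \<noteq> 0}"
      then have qS: "q \<in> Sigma Y ?R" and qn: "(\<lambda>(w, \<eta>). ?g w \<eta>) q \<noteq> 0" by auto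
      have "(\<lambda>(z, \<gamma>). ?f z \<gamma>) (?j q) = (\<lambda>(w, \<eta>). ?g w \<eta>) q"
        using jj(3)[OF jj(1)[OF qS]] jj(2)[OF qS] by simp
      then have 1: "?j q \<in> {(z, \<gamma>) \<in> Sigma Y ?R. ?f z \<gamma> \<noteq> 0}" using jj(1)[OF qS] qn by auto
      show "q \<in> ?j ` {(z, \<gamma>) \<in> Sigma Y ?R. ?f z \<gamma> \<noteq> 0}"
        by (rule image_eqI[where f = ?j and x = "?j q", OF jj(2)[OF qS, symmetric] 1])
    qed
  qed
  have "(\<Sum>\<^sub>\<infinity>z\<in>Y. c z * convolve a \<zeta> z) = (\<Sum>\<^sub>\<infinity>z\<in>Y. \<Sum>\<^sub>\<infinity>\<gamma>\<in>?R z. ?f z \<gamma>)"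
    using Y by (intro infsum_cong) (auto simp: act_conv_def cut_def infsum_cmult_right' subset_iff)
  also have "\<dots> = (\<Sum>\<^sub>\<infinity>(z, \<gamma>)\<in>Sigma Y ?R. ?f z \<gamma>)" by (rule infsum_Sigma_finite[OF finf])
  also have "\<dots> = (\<Sum>\<^sub>\<infinity>(w, \<eta>)\<in>Sigma Y ?R. ?g w \<eta>)"
    by (rule infsum_reindex_bij_witness[of _ ?j ?j]; fact jj)
  also have "\<dots> = (\<Sum>\<^sub>\<infinity>w\<in>Y. \<Sum>\<^sub>\<infinity>\<eta>\<in>?R w. ?g w \<eta>)" by (rule infsum_Sigma_finite[OF fing, symmetric])
  also have "\<dots> = (\<Sum>\<^sub>\<infinity>w\<in>Y. convolve (\<lambda>\<gamma>. a (ginv G \<gamma>)) c w * \<zeta> w)"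
    using Y by (intro infsum_cong) (auto simp: act_conv_def cut_def infsum_cmult_left' subset_iff)
  finally show ?thesis .
qed

text \<open>Substitute \<open>\<kappa> = \<gamma> \<eta>\<close> in the double sum; only finitely many pairs contribute, so the order of summation
is irrelevant.\<close>

lemma convolve_conv:
  assumes a: "a \<in> CC (gtop G)" and b: "b \<in> CC (gtop G)"
  shows "convolve (conv G a b) \<zeta> = convolve a (convolve b \<zeta>)"
proof
  fix z
  show "convolve (conv G a b) \<zeta> z = convolve a (convolve b \<zeta>) z"
  proof (cases "z \<in> topspace X")
    case z: True
    let ?R = "rng_fibre G (anc z)"
    let ?f = "\<lambda>\<gamma> \<kappa>. a \<gamma> * b (gmult G (ginv G \<gamma>) \<kappa>) * \<zeta> (act (ginv G \<kappa>) z)"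
    have "{(\<gamma>, \<kappa>) \<in> ?R \<times> ?R. ?f \<gamma> \<kappa> \<noteq> 0} \<subseteq>
       (\<lambda>(\<gamma>, \<eta>). (\<gamma>, gmult G \<gamma> \<eta>)) ` (Sigma {\<gamma> \<in> ?R. a \<gamma> \<noteq> 0} (\<lambda>\<gamma>. {\<eta> \<in> rng_fibre G (src G \<gamma>). b \<eta> \<noteq> 0}))"
    proof
      fix p assume "p \<in> {(\<gamma>, \<kappa>) \<in> ?R \<times> ?R. ?f \<gamma> \<kappa> \<noteq> 0}"
      then obtain \<gamma> \<kappa> where p: "p = (\<gamma>, \<kappa>)" "\<gamma> \<in> ?R" "\<kappa> \<in> ?R" "a \<gamma> \<noteq> 0" "b (gmult G (ginv G \<gamma>) \<kappa>) \<noteq> 0" by auto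
      have g: "\<gamma> \<in> arrows G" "\<kappa> \<in> arrows G" "rng G \<gamma> = rng G \<kappa>" using p by (auto simp: rng_fibre_def)
      have "gmult G (ginv G \<gamma>) \<kappa> \<in> rng_fibre G (src G \<gamma>)"
        using g by (simp add: rng_fibre_def mult_closed inv_closed src_inv rng_mult rng_inv)
      then show "p \<in> (\<lambda>(\<gamma>, \<eta>). (\<gamma>, gmult G \<gamma> \<eta>)) ` (Sigma {\<gamma> \<in> ?R. a \<gamma> \<noteq> 0} (\<lambda>\<gamma>. {\<eta> \<in> rng_fibre G (src G \<gamma>). b \<eta> \<noteq> 0}))"
        using p mult_inv_cancel[OF g] by (intro image_eqI[of _ _ "(\<gamma>, gmult G (ginv G \<gamma>) \<kappa>)"]) auto
    qed
    then have fin: "finite {(\<gamma>, \<kappa>) \<in> ?R \<times> ?R. ?f \<gamma> \<kappa> \<noteq> 0}"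
      by (rule finite_subset) (use finite_rng_support a b in \<open>auto intro!: finite_imageI finite_SigmaI\<close>)
    have "convolve (conv G a b) \<zeta> z = (\<Sum>\<^sub>\<infinity>\<kappa>\<in>?R. \<Sum>\<^sub>\<infinity>\<gamma>\<in>?R. ?f \<gamma> \<kappa>)"
      using z by (auto simp: act_conv_def cut_def conv_def rng_fibreD infsum_cmult_left'[symmetric] intro!: infsum_cong)
    also have "\<dots> = (\<Sum>\<^sub>\<infinity>\<gamma>\<in>?R. \<Sum>\<^sub>\<infinity>\<kappa>\<in>?R. ?f \<gamma> \<kappa>)" by (rule infsum_swap_finite[OF fin, symmetric])
    also have "\<dots> = (\<Sum>\<^sub>\<infinity>\<gamma>\<in>?R. a \<gamma> * convolve b \<zeta> (act (ginv G \<gamma>) z))"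
    proof (rule infsum_cong)
      fix \<gamma> assume \<gamma>: "\<gamma> \<in> ?R"
      have g: "\<gamma> \<in> arrows G" "rng G \<gamma> = anc z" using \<gamma> by (auto simp: rng_fibre_def)
      have "(\<Sum>\<^sub>\<infinity>\<kappa>\<in>?R. ?f \<gamma> \<kappa>) = a \<gamma> * (\<Sum>\<^sub>\<infinity>\<kappa>\<in>?R. b (gmult G (ginv G \<gamma>) \<kappa>) * \<zeta> (act (ginv G \<kappa>) z))"
        by (simp add: infsum_cmult_right'[symmetric] mult.assoc)
      also have "(\<Sum>\<^sub>\<infinity>\<kappa>\<in>?R. b (gmult G (ginv G \<gamma>) \<kappa>) * \<zeta> (act (ginv G \<kappa>) z))
         = (\<Sum>\<^sub>\<infinity>\<eta>\<in>rng_fibre G (src G \<gamma>). b \<eta> * \<zeta> (act (ginv G \<eta>) (act (ginv G \<gamma>) z)))"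
      proof (rule infsum_reindex_bij_witness[of _ "gmult G \<gamma>" "gmult G (ginv G \<gamma>)"])
        fix \<kappa> assume "\<kappa> \<in> ?R"
        then have k: "\<kappa> \<in> arrows G" "rng G \<gamma> = rng G \<kappa>" "rng G \<kappa> = anc z" using g by (auto simp: rng_fibre_def)
        have m: "gmult G (ginv G \<gamma>) \<kappa> \<in> arrows G" "rng G (gmult G (ginv G \<gamma>) \<kappa>) = src G \<gamma>"
          using g k by (auto simp: mult_closed inv_closed src_inv rng_mult rng_inv)
        show "gmult G \<gamma> (gmult G (ginv G \<gamma>) \<kappa>) = \<kappa>" by (rule mult_inv_cancel[OF g(1) k(1,2)])
        show "gmult G (ginv G \<gamma>) \<kappa> \<in> rng_fibre G (src G \<gamma>)" using m by (simp add: rng_fibre_def)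
        have "ginv G (gmult G (ginv G \<gamma>) \<kappa>) = gmult G (ginv G \<kappa>) \<gamma>"
          using g k by (simp add: inv_mult inv_closed src_inv inv_inv)
        moreover have "act (gmult G (ginv G \<kappa>) \<gamma>) (act (ginv G \<gamma>) z) = act (ginv G \<kappa>) (act \<gamma> (act (ginv G \<gamma>) z))"
          using g k z \<gamma> by (intro act_mult) (auto simp: inv_closed src_inv inv_act_closed)
        ultimately show "b (gmult G (ginv G \<gamma>) \<kappa>) * \<zeta> (act (ginv G (gmult G (ginv G \<gamma>) \<kappa>)) (act (ginv G \<gamma>) z)) =
           b (gmult G (ginv G \<gamma>) \<kappa>) * \<zeta> (act (ginv G \<kappa>) z)"
          using act_inv_act[OF z \<gamma>] by simp
      next
        fix \<eta> assume "\<eta> \<in> rng_fibre G (src G \<gamma>)"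
        then have e: "\<eta> \<in> arrows G" "src G \<gamma> = rng G \<eta>" by (auto simp: rng_fibre_def)
        show "gmult G (ginv G \<gamma>) (gmult G \<gamma> \<eta>) = \<eta>" by (rule inv_mult_cancel[OF g(1) e])
        show "gmult G \<gamma> \<eta> \<in> ?R" using g e by (simp add: rng_fibre_def mult_closed rng_mult)
      qed
      also have "\<dots> = convolve b \<zeta> (act (ginv G \<gamma>) z)"
        using inv_act_closed[OF z \<gamma>] by (simp add: act_conv_def cut_def)
      finally show "(\<Sum>\<^sub>\<infinity>\<kappa>\<in>?R. ?f \<gamma> \<kappa>) = a \<gamma> * convolve b \<zeta> (act (ginv G \<gamma>) z)" .
    qed
    also have "\<dots> = convolve a (convolve b \<zeta>) z" using z by (simp add: act_conv_def[of G X anc act a] cut_def)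
    finally show ?thesis .
  qed (simp add: convolve_outside)
qed

text \<open>An open bisection \<open>U\<close> acts by a homeomorphism \<open>T\<close> from the part \<open>D1\<close> of \<open>X\<close> over \<open>s(U)\<close> to the part \<open>D2\<close> over
\<open>r(U)\<close>. At \<open>w\<close> in \<open>D2\<close> the sum has a single term, and \<open>\<Pi>(a) \<phi>\<close> is the product of \<open>\<phi>\<close>, transported by \<open>T\<close>,
with the values of \<open>a\<close> along \<open>U\<close>. It is therefore supported in the image under \<open>T\<close> of a piece of \<open>V\<close>, which is
again open and Hausdorff.\<close>

lemma Cc_convolve:
  assumes U: "openin (gtop G) U" "chart (gtop G) (unit_space G) (src G) U" "chart (gtop G) (unit_space G) (rng G) U"
    and H: "Hausdorff_space (subtopology (gtop G) U)" and a: "a \<in> Cc (gtop G) U"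
    and V: "openin X V" "Hausdorff_space (subtopology X V)" and \<phi>: "\<phi> \<in> Cc X V"
  shows "convolve a \<phi> \<in> CC X"
proof -
  obtain Ka where Ka: "compactin (gtop G) Ka" "Ka \<subseteq> U" "\<And>x. x \<notin> Ka \<Longrightarrow> a x = 0"
    by (rule Cc_compact[OF a U(1)]) blast
  obtain Kp where Kp: "compactin X Kp" "Kp \<subseteq> V" "\<And>x. x \<notin> Kp \<Longrightarrow> \<phi> x = 0"
    by (rule Cc_compact[OF \<phi> V(1)]) blast
  have UA: "U \<subseteq> arrows G" using openin_subset[OF U(1)] by (simp add: arrows_def)
  obtain \<sigma> where \<sigma>: "continuous_map (subtopology (unit_space G) (src G ` U)) (gtop G) \<sigma>"
    "\<And>x. x \<in> U \<Longrightarrow> \<sigma> (src G x) = x" "\<And>y. y \<in> src G ` U \<Longrightarrow> \<sigma> y \<in> U \<and> src G (\<sigma> y) = y"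
    by (rule chart_section[OF U(2)]) blast
  obtain \<tau> where \<tau>: "continuous_map (subtopology (unit_space G) (rng G ` U)) (gtop G) \<tau>"
    "\<And>x. x \<in> U \<Longrightarrow> \<tau> (rng G x) = x" "\<And>y. y \<in> rng G ` U \<Longrightarrow> \<tau> y \<in> U \<and> rng G (\<tau> y) = y"
    by (rule chart_section[OF U(3)]) blast
  define D1 where "D1 = {z \<in> topspace X. anc z \<in> src G ` U}"
  define D2 where "D2 = {z \<in> topspace X. anc z \<in> rng G ` U}"
  define T where "T z = act (\<sigma> (anc z)) z" for z
  define S where "S w = act (ginv G (\<tau> (anc w))) w" for w
  have oD: "openin X D1" "openin X D2"
    unfolding D1_def D2_def using U(2,3) by (auto intro!: openin_continuous_map_preimage[OF anc_cont] simp: chart_def)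
  have sU: "\<sigma> y \<in> arrows G" if "y \<in> src G ` U" for y using \<sigma>(3)[OF that] UA by auto
  have tU: "\<tau> y \<in> arrows G" if "y \<in> rng G ` U" for y using \<tau>(3)[OF that] UA by auto
  have T: "T z \<in> D2" "S (T z) = z" if "z \<in> D1" for z
  proof -
    have z: "z \<in> topspace X" "anc z \<in> src G ` U" using that by (auto simp: D1_def)
    note s = \<sigma>(3)[OF z(2)] sU[OF z(2)]
    have an: "anc (T z) = rng G (\<sigma> (anc z))" unfolding T_def using z s by (intro anc_act) auto
    show "T z \<in> D2" unfolding D2_def using an s z by (auto simp: T_def intro: act_closed)
    show "S (T z) = z" unfolding S_def an using \<tau>(2) s z by (simp add: T_def inv_act_act)
  qed
  have S: "S w \<in> D1" "T (S w) = w" "anc (S w) = src G (\<tau> (anc w))" if "w \<in> D2" for w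
  proof -
    have w: "w \<in> topspace X" "anc w \<in> rng G ` U" using that by (auto simp: D2_def)
    note t = \<tau>(3)[OF w(2)] tU[OF w(2)]
    have tr: "\<tau> (anc w) \<in> rng_fibre G (anc w)" using t by (simp add: rng_fibre_def)
    show an: "anc (S w) = src G (\<tau> (anc w))" unfolding S_def by (rule inv_act_closed(2)[OF w(1) tr])
    show "S w \<in> D1" unfolding D1_def using an t inv_act_closed(1)[OF w(1) tr] by (auto simp: S_def)
    show "T (S w) = w" unfolding T_def an using \<sigma>(2) t act_inv_act[OF w(1) tr] by (simp add: S_def)
  qed
  have ancD: "continuous_map (subtopology X D1) (subtopology (unit_space G) (src G ` U)) anc"
    "continuous_map (subtopology X D2) (subtopology (unit_space G) (rng G ` U)) anc"
    by (auto intro!: continuous_map_into_subtopology continuous_map_from_subtopology[OF anc_cont] simp: D1_def D2_def)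
  have contT: "continuous_map (subtopology X D1) X T"
  proof -
    have "continuous_map (subtopology X D1) (subtopology (prod_topology (gtop G) X) {(\<gamma>, z). src G \<gamma> = anc z})
      (\<lambda>z. ((\<sigma> \<circ> anc) z, z))"
      using \<sigma>(3) by (intro continuous_map_into_subtopology continuous_map_pairedI
          continuous_map_compose[OF ancD(1) \<sigma>(1)] continuous_map_from_subtopology[OF continuous_map_id[unfolded id_def]])
        (auto simp: D1_def)
    from continuous_map_compose[OF this act_cont] show ?thesis by (simp add: o_def T_def[abs_def])
  qed
  have cont\<tau>: "continuous_map (subtopology X D2) (gtop G) (\<tau> \<circ> anc)"
    by (rule continuous_map_compose[OF ancD(2) \<tau>(1)])
  have contS: "continuous_map (subtopology X D2) X S"
  proof -
    have "continuous_map (subtopology X D2) (subtopology (prod_topology (gtop G) X) {(\<gamma>, z). src G \<gamma> = anc z})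
      (\<lambda>z. ((ginv G \<circ> (\<tau> \<circ> anc)) z, z))"
      using \<tau>(3) tU by (intro continuous_map_into_subtopology continuous_map_pairedI
          continuous_map_compose[OF cont\<tau> continuous_inv] continuous_map_from_subtopology[OF continuous_map_id[unfolded id_def]])
        (auto simp: D2_def src_inv)
    from continuous_map_compose[OF this act_cont] show ?thesis by (simp add: o_def S_def[abs_def])
  qed
  have topD: "topspace (subtopology X D1) = D1" "topspace (subtopology X D2) = D2"
    by (auto simp: D1_def D2_def)
  have hm: "homeomorphic_maps (subtopology X D1) (subtopology X D2) T S"
    unfolding homeomorphic_maps_def topD using T S
    by (auto intro!: continuous_map_into_subtopology contT contS simp: topD)
  then have hT: "homeomorphic_map (subtopology X D1) (subtopology X D2) T" using homeomorphic_maps_map by blast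
  define V' where "V' = V \<inter> D1"
  define W where "W = T ` V'"
  have oV': "openin X V'" using V oD by (simp add: V'_def openin_Int)
  have WD: "W \<subseteq> D2" using T by (auto simp: W_def V'_def)
  have oW: "openin X W"
  proof -
    have "openin (subtopology X D1) V'" using oV' oD by (simp add: openin_open_subtopology V'_def)
    then have "openin (subtopology X D2) W"
      using homeomorphic_map_openness[OF hT, of V'] unfolding W_def topD by (simp add: V'_def)
    then show ?thesis using oD(2) by (rule openin_trans_full)
  qed
  have HW: "Hausdorff_space (subtopology X W)"
  proof -
    have "homeomorphic_map (subtopology (subtopology X D1) V') (subtopology (subtopology X D2) W) T"
      by (rule homeomorphic_map_subtopologies[OF hT], unfold topD) (use WD in \<open>auto simp: W_def V'_def\<close>)
    moreover have "Hausdorff_space (subtopology (subtopology X V) V')"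
      by (rule Hausdorff_space_subtopology[OF V(2)])
    then have "Hausdorff_space (subtopology (subtopology X D1) V')"
      by (simp add: subtopology_subtopology V'_def Int_absorb1 Int_commute Int_left_commute)
    ultimately have "Hausdorff_space (subtopology (subtopology X D2) W)"
      using homeomorphic_Hausdorff_space homeomorphic_map_imp_homeomorphic_space by blast
    then show ?thesis using WD by (simp add: subtopology_subtopology Int_absorb1)
  qed
  have form: "convolve a \<phi> w = a (\<tau> (anc w)) * \<phi> (S w)" if "w \<in> D2" for w
  proof -
    have w: "w \<in> topspace X" "anc w \<in> rng G ` U" using that by (auto simp: D2_def)
    have "convolve a \<phi> w = (\<Sum>\<gamma>\<in>{\<tau> (anc w)}. a \<gamma> * \<phi> (act (ginv G \<gamma>) w))"
    proof (rule convolve_eq_sum[OF w(1)])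
      show "{\<tau> (anc w)} \<subseteq> rng_fibre G (anc w)" using \<tau>(3)[OF w(2)] tU[OF w(2)] by (simp add: rng_fibre_def)
      fix \<gamma> assume g: "\<gamma> \<in> rng_fibre G (anc w) - {\<tau> (anc w)}"
      then have "\<gamma> \<notin> U" using \<tau>(2)[of \<gamma>] by (auto simp: rng_fibre_def)
      then show "a \<gamma> = 0" using Ka by blast
    qed simp
    then show ?thesis by (simp add: S_def)
  qed
  have form0: "convolve a \<phi> w = 0" if "w \<notin> D2" for w
  proof (cases "w \<in> topspace X")
    case True
    have "convolve a \<phi> w = (\<Sum>\<gamma>\<in>{}. a \<gamma> * \<phi> (act (ginv G \<gamma>) w))"
    proof (rule convolve_eq_sum[OF True])
      fix \<gamma> assume g: "\<gamma> \<in> rng_fibre G (anc w) - {}"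
      then have "rng G \<gamma> = anc w" by (simp add: rng_fibre_def)
      then have "\<gamma> \<notin> U" using that True unfolding D2_def by (metis (mono_tags) imageI mem_Collect_eq)
      then show "a \<gamma> = 0" using Ka by blast
    qed auto
    then show ?thesis by simp
  qed (simp add: convolve_outside)
  define K where "K = T ` (Kp \<inter> {z \<in> topspace X. anc z \<in> src G ` Ka})"
  have "convolve a \<phi> \<in> Cc X W"
  proof (rule CcI[OF oW HW])
    have c1: "continuous_map (subtopology X W) (subtopology (gtop G) U) (\<tau> \<circ> anc)"
      using continuous_map_from_subtopology_mono[OF cont\<tau> WD] \<tau>(3) WD
      by (intro continuous_map_into_subtopology) (auto simp: D2_def subset_iff)
    have SV: "S w \<in> V" if "w \<in> W" for w using that T(2) by (auto simp: W_def V'_def)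
    have c2: "continuous_map (subtopology X W) (subtopology X V) S"
      using continuous_map_from_subtopology_mono[OF contS WD] SV
      by (intro continuous_map_into_subtopology) auto
    have "continuous_map (subtopology X W) euclidean (\<lambda>w. (a \<circ> (\<tau> \<circ> anc)) w * (\<phi> \<circ> S) w)"
      by (intro continuous_map_mult_complex continuous_map_compose[OF c1 Cc_cont[OF a]]
          continuous_map_compose[OF c2 Cc_cont[OF \<phi>]])
    then show "continuous_map (subtopology X W) euclidean (convolve a \<phi>)"
      by (rule continuous_map_eq) (use form WD in auto)
    have "compactin (unit_space G) (src G ` Ka)"
      using image_compactin[OF Ka(1)] local_homeo_continuous[OF etale_src] by blast
    then have "closedin (unit_space G) (src G ` Ka)" by (rule compactin_imp_closedin[OF units_Hausdorff])
    then have "closedin X {z \<in> topspace X. anc z \<in> src G ` Ka}"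
      by (rule closedin_continuous_map_preimage[OF anc_cont])
    then have c: "compactin X (Kp \<inter> {z \<in> topspace X. anc z \<in> src G ` Ka})"
      using closed_Int_compactin[OF _ Kp(1)] by (subst Int_commute)
    have sub: "Kp \<inter> {z \<in> topspace X. anc z \<in> src G ` Ka} \<subseteq> V'"
      using Kp(2) Ka(2) by (auto simp: V'_def D1_def)
    then have "compactin (subtopology X D1) (Kp \<inter> {z \<in> topspace X. anc z \<in> src G ` Ka})"
      using c by (auto simp: compactin_subtopology V'_def)
    then show "compactin X K" unfolding K_def by (rule image_compactin[OF _ contT])
    show "K \<subseteq> W" using sub by (auto simp: K_def W_def)
    show "convolve a \<phi> w = 0" if w: "w \<notin> K" for w
    proof (cases "w \<in> D2")
      case True
      show ?thesis
      proof (rule ccontr)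
        assume "convolve a \<phi> w \<noteq> 0"
        then have "a (\<tau> (anc w)) \<noteq> 0" "\<phi> (S w) \<noteq> 0" using form[OF True] by auto
        then have "\<tau> (anc w) \<in> Ka" "S w \<in> Kp" using Ka Kp by blast+
        then have "w \<in> K" unfolding K_def using S[OF True] by (intro image_eqI[of _ _ "S w"]) (auto simp: D1_def)
        then show False using w by blast
      qed
    qed (rule form0)
  qed
  then show ?thesis by (rule CC_Cc[OF oW HW])
qed

lemma CC_convolve:
  assumes a: "a \<in> CC (gtop G)" and \<phi>: "\<phi> \<in> CC X"
  shows "convolve a \<phi> \<in> CC X"
proof -
  let ?Q = "\<lambda>U. chart (gtop G) (unit_space G) (src G) U \<and> chart (gtop G) (unit_space G) (rng G) U"
  have "a \<in> CC (gtop G) \<and> (\<forall>\<phi>\<in>CC X. convolve a \<phi> \<in> CC X)" using a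
  proof (induction rule: CC_induct_local[where Q = ?Q])
    case (loc U) then show ?case by (rule open_Hausdorff_locally_compact)
  next
    case zero
    have "convolve (\<lambda>x. 0) \<phi> = (\<lambda>x. 0)" for \<phi> by (auto simp: act_conv_def cut_def)
    then show ?case by (simp add: CC_zero)
  next
    case (add f g) then show ?case by (auto simp: convolve_add_left intro: CC_add)
  next
    case (scale c f) then show ?case by (auto simp: convolve_scale_left intro: CC_scale)
  next
    case (cover \<gamma>)
    obtain U1 U2 where U: "chart (gtop G) (unit_space G) (src G) U1" "\<gamma> \<in> U1"
      "chart (gtop G) (unit_space G) (rng G) U2" "\<gamma> \<in> U2"
      using local_homeo_chart[OF etale_src cover] local_homeo_chart[OF etale_rng cover] by blast
    have o: "openin (gtop G) (U1 \<inter> U2)" using U by (auto simp: chart_def openin_Int)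
    show ?case using chart_subset[OF U(1) o] chart_subset[OF U(3) o] U o by blast
  next
    case (hereditary W W') then show ?case using chart_subset by blast
  next
    case (Cc U g)
    have "convolve g \<phi> \<in> CC X" if "\<phi> \<in> CC X" for \<phi>
      using that
    proof (induction rule: CC_induct)
      case zero
      have "convolve g (\<lambda>x. 0) = (\<lambda>x. 0)" by (auto simp: act_conv_def cut_def)
      then show ?case by (simp add: CC_zero)
    next
      case (add f h) then show ?case using CC_Cc[OF Cc(1,2,4)] by (auto simp: convolve_add_right intro: CC_add)
    next
      case (scale c f) then show ?case using CC_Cc[OF Cc(1,2,4)] by (auto simp: convolve_scale_right intro: CC_scale)
    next
      case (Cc V f) then show ?case using Cc_convolve \<open>openin (gtop G) U\<close> \<open>?Q U\<close> \<open>Hausdorff_space (subtopology (gtop G) U)\<close> \<open>g \<in> Cc (gtop G) U\<close> by blast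
    qed
    then show ?case using CC_Cc[OF Cc(1,2,4)] by blast
  qed
  then show ?thesis using \<phi> by blast
qed

end

section \<open>Contractivity for the reduced norm\<close>

lemma CC_alg_sel [simp]:
  "carr (CC_alg p G) = CC (gtop G)" "vadd (CC_alg p G) = (\<lambda>f g x. f x + g x)"
  "vscale (CC_alg p G) = (\<lambda>c f x. c * f x)" "amult (CC_alg p G) = conv G"
  by (simp_all add: CC_alg_def)

lemma conv_eq_act_conv: "conv G = act_conv G (gtop G) (rng G) (gmult G)"
  by (simp add: conv_def act_conv_def fun_eq_iff arrows_def)

context lc_etale_groupoid
begin

lemma self_action: "left_action G (gtop G) (rng G) (gmult G)"
proof
  show "continuous_map (gtop G) (unit_space G) (rng G)"
    unfolding unit_space_def by (intro continuous_map_into_subtopology continuous_rng) (auto simp: rng_unitI arrows_def)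
  show "continuous_map (subtopology (prod_topology (gtop G) (gtop G)) {(\<gamma>, z). src G \<gamma> = rng G z}) (gtop G)
      (\<lambda>(\<gamma>, z). gmult G \<gamma> z)" by (rule continuous_mult)
qed (auto simp: arrows_def[symmetric] mult_closed rng_mult rng_unit mult_assoc)

sublocale S: left_action G "gtop G" "rng G" "gmult G" by (rule self_action)

text \<open>The regular representation has the matrix \<open>f(\<gamma> \<kappa>\<^sup>-\<^sup>1)\<close>; substitute \<open>\<kappa> = \<eta>\<^sup>-\<^sup>1 \<gamma>\<close>.\<close>

lemma conv_sum_src_fibre:
  assumes "\<gamma> \<in> src_fibre G u"
  shows "(\<Sum>\<^sub>\<infinity>\<eta>\<in>rng_fibre G (rng G \<gamma>). f \<eta> * \<xi> (gmult G (ginv G \<eta>) \<gamma>))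
     = (\<Sum>\<^sub>\<infinity>\<kappa>\<in>src_fibre G u. f (gmult G \<gamma> (ginv G \<kappa>)) * \<xi> \<kappa>)"
proof (rule infsum_reindex_bij_witness[of _ "\<lambda>\<kappa>. gmult G \<gamma> (ginv G \<kappa>)" "\<lambda>\<eta>. gmult G (ginv G \<eta>) \<gamma>"])
  have g: "\<gamma> \<in> arrows G" "src G \<gamma> = u" using assms by (auto simp: src_fibre_def)
  fix \<eta> assume "\<eta> \<in> rng_fibre G (rng G \<gamma>)"
  then have e: "\<eta> \<in> arrows G" "rng G \<eta> = rng G \<gamma>" by (auto simp: rng_fibre_def)
  have i: "ginv G (gmult G (ginv G \<eta>) \<gamma>) = gmult G (ginv G \<gamma>) \<eta>"
    using g e by (simp add: inv_mult inv_closed src_inv inv_inv)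
  show 1: "gmult G \<gamma> (ginv G (gmult G (ginv G \<eta>) \<gamma>)) = \<eta>"
    unfolding i using g e by (intro mult_inv_cancel) auto
  show "gmult G (ginv G \<eta>) \<gamma> \<in> src_fibre G u"
    using g e by (simp add: src_fibre_def mult_closed inv_closed src_inv src_mult)
  show "f (gmult G \<gamma> (ginv G (gmult G (ginv G \<eta>) \<gamma>))) * \<xi> (gmult G (ginv G \<eta>) \<gamma>) = f \<eta> * \<xi> (gmult G (ginv G \<eta>) \<gamma>)"
    unfolding 1 ..
next
  have g: "\<gamma> \<in> arrows G" "src G \<gamma> = u" using assms by (auto simp: src_fibre_def)
  fix \<kappa> assume "\<kappa> \<in> src_fibre G u"
  then have k: "\<kappa> \<in> arrows G" "src G \<kappa> = u" by (auto simp: src_fibre_def)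
  have i: "ginv G (gmult G \<gamma> (ginv G \<kappa>)) = gmult G \<kappa> (ginv G \<gamma>)"
    using g k by (simp add: inv_mult inv_closed rng_inv inv_inv)
  have "gmult G (gmult G \<kappa> (ginv G \<gamma>)) \<gamma> = gmult G \<kappa> (gmult G (ginv G \<gamma>) \<gamma>)"
    using g k by (intro mult_assoc) (auto simp: inv_closed rng_inv src_inv)
  then show "gmult G (ginv G (gmult G \<gamma> (ginv G \<kappa>))) \<gamma> = \<kappa>"
    unfolding i using g k by (simp add: inv_left) (metis src_unit)
  show "gmult G \<gamma> (ginv G \<kappa>) \<in> rng_fibre G (rng G \<gamma>)"
    using g k by (simp add: rng_fibre_def mult_closed inv_closed rng_inv rng_mult)
qed

lemma lreg_kernel:
  "lreg p G u f = (\<lambda>\<xi>\<in>carr (lp p (src_fibre G u)). cut (src_fibre G u)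
     (\<lambda>\<gamma>. \<Sum>\<^sub>\<infinity>\<kappa>\<in>src_fibre G u. f (gmult G \<gamma> (ginv G \<kappa>)) * \<xi> \<kappa>))"
  unfolding lreg_def by (intro restrict_ext ext) (simp add: cut_def conv_sum_src_fibre)

text \<open>The bounds do not depend on the unit \<open>u\<close>. This makes the reduced norm a supremum of a bounded set.\<close>

lemma lreg_bounded_kernel:
  assumes f: "f \<in> CC (gtop G)"
  obtains N M where "1 \<le> N" "0 \<le> M"
    "\<And>u. bounded_kernel (src_fibre G u) (src_fibre G u) (\<lambda>\<gamma> \<kappa>. f (gmult G \<gamma> (ginv G \<kappa>))) N M"
proof -
  obtain N M where N: "1 \<le> N" "0 \<le> M" "\<And>\<gamma>. cmod (f \<gamma>) \<le> M"
    "\<And>u. finite {\<gamma> \<in> src_fibre G u. f \<gamma> \<noteq> 0}" "\<And>u. card {\<gamma> \<in> src_fibre G u. f \<gamma> \<noteq> 0} \<le> N"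
    "\<And>u. finite {\<gamma> \<in> rng_fibre G u. f \<gamma> \<noteq> 0}" "\<And>u. card {\<gamma> \<in> rng_fibre G u. f \<gamma> \<noteq> 0} \<le> N"
    by (rule CC_fibres[OF f]) blast
  have "bounded_kernel (src_fibre G u) (src_fibre G u) (\<lambda>\<gamma> \<kappa>. f (gmult G \<gamma> (ginv G \<kappa>))) N M" for u
    unfolding bounded_kernel_def
  proof (intro conjI ballI)
    let ?k = "\<lambda>\<gamma> \<kappa>. gmult G \<gamma> (ginv G \<kappa>)"
    have canc: "gmult G (ginv G \<gamma>) (?k \<gamma> \<kappa>) = ginv G \<kappa>" "gmult G (?k \<gamma> \<kappa>) \<kappa> = \<gamma>"
       "?k \<gamma> \<kappa> \<in> rng_fibre G (rng G \<gamma>)" "?k \<gamma> \<kappa> \<in> src_fibre G (rng G \<kappa>)"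
      if "\<gamma> \<in> src_fibre G u" "\<kappa> \<in> src_fibre G u" for \<gamma> \<kappa>
    proof -
      have a: "\<gamma> \<in> arrows G" "src G \<gamma> = u" "\<kappa> \<in> arrows G" "src G \<kappa> = u" using that by (auto simp: src_fibre_def)
      show "gmult G (ginv G \<gamma>) (?k \<gamma> \<kappa>) = ginv G \<kappa>" using a by (intro inv_mult_cancel) (auto simp: inv_closed rng_inv)
      have "gmult G (?k \<gamma> \<kappa>) \<kappa> = gmult G \<gamma> (gmult G (ginv G \<kappa>) \<kappa>)"
        using a by (intro mult_assoc) (auto simp: inv_closed rng_inv src_inv)
      then show "gmult G (?k \<gamma> \<kappa>) \<kappa> = \<gamma>" using a by (simp add: inv_left) (metis src_unit)
      show "?k \<gamma> \<kappa> \<in> rng_fibre G (rng G \<gamma>)" "?k \<gamma> \<kappa> \<in> src_fibre G (rng G \<kappa>)"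
        using a by (auto simp: rng_fibre_def src_fibre_def mult_closed inv_closed rng_inv rng_mult src_mult src_inv)
    qed
    fix \<gamma> assume g: "\<gamma> \<in> src_fibre G u"
    have inj: "inj_on (?k \<gamma>) {\<kappa> \<in> src_fibre G u. f (?k \<gamma> \<kappa>) \<noteq> 0}"
    proof (rule inj_onI)
      fix \<kappa> \<kappa>' assume k: "\<kappa> \<in> {\<kappa> \<in> src_fibre G u. f (?k \<gamma> \<kappa>) \<noteq> 0}" "\<kappa>' \<in> {\<kappa> \<in> src_fibre G u. f (?k \<gamma> \<kappa>) \<noteq> 0}"
        "?k \<gamma> \<kappa> = ?k \<gamma> \<kappa>'"
      then have "ginv G \<kappa> = ginv G \<kappa>'" using canc(1)[OF g] by (metis (lifting) mem_Collect_eq)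
      then show "\<kappa> = \<kappa>'" using k by (metis (lifting) inv_inv mem_Collect_eq src_fibre_def)
    qed
    have sub: "?k \<gamma> ` {\<kappa> \<in> src_fibre G u. f (?k \<gamma> \<kappa>) \<noteq> 0} \<subseteq> {\<eta> \<in> rng_fibre G (rng G \<gamma>). f \<eta> \<noteq> 0}"
      using canc(3)[OF g] by auto
    show "finite {\<kappa> \<in> src_fibre G u. f (?k \<gamma> \<kappa>) \<noteq> 0}" by (rule inj_on_finite[OF inj sub N(6)])
    show "card {\<kappa> \<in> src_fibre G u. f (?k \<gamma> \<kappa>) \<noteq> 0} \<le> N"
      using card_inj_on_le[OF inj sub N(6)] N(7) le_trans by blast
    have inj: "inj_on (\<lambda>\<eta>. ?k \<eta> \<gamma>) {\<eta> \<in> src_fibre G u. f (?k \<eta> \<gamma>) \<noteq> 0}"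
      by (rule inj_onI) (metis (lifting) canc(2) g mem_Collect_eq)
    have sub: "(\<lambda>\<eta>. ?k \<eta> \<gamma>) ` {\<eta> \<in> src_fibre G u. f (?k \<eta> \<gamma>) \<noteq> 0} \<subseteq> {\<eta> \<in> src_fibre G (rng G \<gamma>). f \<eta> \<noteq> 0}"
      using canc(4)[OF _ g] by auto
    show "finite {\<eta> \<in> src_fibre G u. f (?k \<eta> \<gamma>) \<noteq> 0}" by (rule inj_on_finite[OF inj sub N(4)])
    show "card {\<eta> \<in> src_fibre G u. f (?k \<eta> \<gamma>) \<noteq> 0} \<le> N"
      using card_inj_on_le[OF inj sub N(4)] N(5) le_trans by blast
    fix \<kappa> show "cmod (f (?k \<gamma> \<kappa>)) \<le> M" by (rule N(3))
  qed
  then show ?thesis using that N(1,2) by blast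
qed

lemma lreg_closed:
  assumes f: "f \<in> CC (gtop G)" and p: "1 \<le> p"
  shows "lreg p G u f \<in> carr (bops (lp p (src_fibre G u)) (lp p (src_fibre G u)))"
proof -
  obtain N M where "1 \<le> N" "0 \<le> M"
    "\<And>u. bounded_kernel (src_fibre G u) (src_fibre G u) (\<lambda>\<gamma> \<kappa>. f (gmult G \<gamma> (ginv G \<kappa>))) N M"
    by (rule lreg_bounded_kernel[OF f]) blast
  then show ?thesis unfolding lreg_kernel by (intro kernel_bops(1)[OF is_lp_lp is_lp_lp p])
qed

lemma lreg_norms_bdd_above:
  assumes f: "f \<in> CC (gtop G)" and p: "1 \<le> p"
  shows "bdd_above (insert 0 ((\<lambda>u. vnorm (bops (lp p (src_fibre G u)) (lp p (src_fibre G u))) (lreg p G u f)) ` units G))"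
proof -
  obtain N M where N: "1 \<le> N" "0 \<le> M"
    "\<And>u. bounded_kernel (src_fibre G u) (src_fibre G u) (\<lambda>\<gamma> \<kappa>. f (gmult G \<gamma> (ginv G \<kappa>))) N M"
    by (rule lreg_bounded_kernel[OF f]) blast
  have "vnorm (bops (lp p (src_fibre G u)) (lp p (src_fibre G u))) (lreg p G u f) \<le> real N * M * real N" for u
    unfolding lreg_kernel by (rule kernel_bops(2)[OF is_lp_lp is_lp_lp p N(3,1,2)])
  then show ?thesis using N(2) by (intro bdd_aboveI[of _ "real N * M * real N"]) auto
qed

lemma lreg_norm_le:
  assumes f: "f \<in> CC (gtop G)" and p: "1 \<le> p" and u: "u \<in> units G"
  shows "vnorm (bops (lp p (src_fibre G u)) (lp p (src_fibre G u))) (lreg p G u f) \<le> vnorm (CC_alg p G) f"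
  using lreg_norms_bdd_above[OF f p] u by (auto simp: CC_alg_def intro!: cSup_upper)

lemma CC_norm_ge0:
  assumes f: "f \<in> CC (gtop G)" and p: "1 \<le> p" shows "0 \<le> vnorm (CC_alg p G) f"
  using lreg_norms_bdd_above[OF f p] by (auto simp: CC_alg_def intro!: cSup_upper)

lemma CC_norm_le:
  assumes "0 \<le> C" "\<And>u. u \<in> units G \<Longrightarrow> vnorm (bops (lp p (src_fibre G u)) (lp p (src_fibre G u))) (lreg p G u f) \<le> C"
  shows "vnorm (CC_alg p G) f \<le> C"
  using assms by (auto simp: CC_alg_def intro!: cSup_least)

lemma lreg_lp_le:
  assumes f: "f \<in> CC (gtop G)" and p: "1 \<le> p" and u: "u \<in> units G" and C: "0 \<le> C"
    and \<xi>: "lp_le p (src_fibre G u) \<xi> C"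
  shows "lp_le p (src_fibre G u)
     (\<lambda>\<gamma>. \<Sum>\<^sub>\<infinity>\<eta>\<in>rng_fibre G (rng G \<gamma>). f \<eta> * \<xi> (gmult G (ginv G \<eta>) \<gamma>)) (vnorm (CC_alg p G) f * C)"
proof -
  let ?L = "lp p (src_fibre G u)"
  interpret cnormed_pair ?L ?L by (intro cnormed_pair.intro cnormed_lp p)
  let ?x = "cut (src_fibre G u) \<xi>"
  have x: "?x \<in> carr ?L" "vnorm ?L ?x \<le> C"
    using lp_mem_iff[OF p C, of ?x "src_fibre G u"] \<xi> by (auto simp: lp_le_cut) (auto simp: cut_def)
  have l: "lreg p G u f ?x \<in> carr ?L" by (rule bops_closed[OF lreg_closed[OF f p] x(1)])
  have "vnorm ?L (lreg p G u f ?x) \<le> vnorm (bops ?L ?L) (lreg p G u f) * vnorm ?L ?x"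
    by (rule opnorm_bound[OF lreg_closed[OF f p] x(1)])
  also have "\<dots> \<le> vnorm (CC_alg p G) f * C"
    by (intro mult_mono lreg_norm_le f p u x CC_norm_ge0 lp_norm_ge0)
  finally have "lp_le p (src_fibre G u) (lreg p G u f ?x) (vnorm (CC_alg p G) f * C)"
    using lp_mem_iff[OF p, of "vnorm (CC_alg p G) f * C" "lreg p G u f ?x" "src_fibre G u"] l
      CC_norm_ge0[OF f p] C by simp
  moreover have "lreg p G u f ?x \<gamma> = (\<Sum>\<^sub>\<infinity>\<eta>\<in>rng_fibre G (rng G \<gamma>). f \<eta> * \<xi> (gmult G (ginv G \<eta>) \<gamma>))"
    if "\<gamma> \<in> src_fibre G u" for \<gamma>
    using x(1) that unfolding lreg_def by (auto simp: cut_def src_fibre_def rng_fibre_def mult_closed inv_closed src_inv src_mult intro!: infsum_cong)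
  ultimately show ?thesis by (subst lp_le_cong[where g = "lreg p G u f ?x"]) auto
qed

text \<open>The regular representation of \<open>f\<close> maps the point mass at \<open>u\<close> to the restriction of \<open>f\<close> to the source fibre.\<close>

lemma norm_column_sum:
  assumes f: "f \<in> CC (gtop G)" and u: "u \<in> units G" and B: "finite B" "B \<subseteq> src_fibre G u"
  shows "(\<Sum>\<gamma>\<in>B. cmod (f \<gamma>)) \<le> vnorm (CC_alg 1 G) f"
proof -
  \<comment> \<open>the point mass at the unit\<close>
  let ?d = "\<lambda>\<kappa>. if \<kappa> = u then 1 else 0 :: complex"
  have d: "lp_le 1 (src_fibre G u) ?d 1"
    unfolding lp_le_def by (auto simp: if_distrib[of cmod] if_distrib[of "\<lambda>x. x powr 1"] sum.delta cong: if_cong)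
  have "(\<Sum>\<^sub>\<infinity>\<eta>\<in>rng_fibre G (rng G \<gamma>). f \<eta> * ?d (gmult G (ginv G \<eta>) \<gamma>)) = f \<gamma>" if "\<gamma> \<in> src_fibre G u" for \<gamma>
  proof -
    have g: "\<gamma> \<in> arrows G" "src G \<gamma> = u" using that by (auto simp: src_fibre_def)
    have "(\<Sum>\<^sub>\<infinity>\<eta>\<in>rng_fibre G (rng G \<gamma>). f \<eta> * ?d (gmult G (ginv G \<eta>) \<gamma>))
      = (\<Sum>\<eta>\<in>{\<gamma>}. f \<eta> * ?d (gmult G (ginv G \<eta>) \<gamma>))"
    proof (rule infsum_eq_sum)
      show "{\<gamma>} \<subseteq> rng_fibre G (rng G \<gamma>)" using g by (simp add: rng_fibre_def)
      fix \<eta> assume "\<eta> \<in> rng_fibre G (rng G \<gamma>) - {\<gamma>}"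
      then have e: "\<eta> \<in> arrows G" "rng G \<eta> = rng G \<gamma>" "\<eta> \<noteq> \<gamma>" by (auto simp: rng_fibre_def)
      have "gmult G (ginv G \<eta>) \<gamma> \<noteq> u"
      proof
        assume a: "gmult G (ginv G \<eta>) \<gamma> = u"
        have "src G \<eta> = rng G (gmult G (ginv G \<eta>) \<gamma>)" using g e by (simp add: rng_mult inv_closed src_inv rng_inv)
        then have "src G \<eta> = u" using a unitsD(3)[OF u] by simp
        moreover have "gmult G \<eta> (gmult G (ginv G \<eta>) \<gamma>) = \<gamma>" using g e by (intro mult_inv_cancel)
        ultimately show False using a e src_unit[OF e(1)] by simp
      qed
      then show "f \<eta> * ?d (gmult G (ginv G \<eta>) \<gamma>) = 0" by simp
    qed simp
    then show ?thesis using g by (simp add: inv_left)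
  qed
  then have "lp_le 1 (src_fibre G u) f (vnorm (CC_alg 1 G) f * 1)"
    using lreg_lp_le[OF f order_refl u _ d] by (subst lp_le_cong[where g = "\<lambda>\<gamma>. \<Sum>\<^sub>\<infinity>\<eta>\<in>rng_fibre G (rng G \<gamma>). f \<eta> * ?d (gmult G (ginv G \<eta>) \<gamma>)"]) auto
  then show ?thesis using B CC_norm_ge0[OF f, of 1] unfolding lp_le_def by auto
qed

text \<open>Apply the regular representation to the function of norm at most one whose phases cancel those of \<open>f\<close>, and
evaluate at \<open>u\<close>.\<close>

lemma norm_row_sum:
  assumes f: "f \<in> CC (gtop G)" and u: "u \<in> units G"
  shows "(\<Sum>\<gamma>\<in>{\<gamma> \<in> rng_fibre G u. f \<gamma> \<noteq> 0}. cmod (f \<gamma>)) \<le> vnorm (CC_alg \<infinity> G) f"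
proof -
  \<comment> \<open>The value at the inverse of an arrow cancels the phase of \<open>f\<close> at the arrow.\<close>
  let ?x = "\<lambda>\<kappa>. cnj (sgn (f (ginv G \<kappa>)))"
  have x: "lp_le \<infinity> (src_fibre G u) ?x 1"
    unfolding lp_le_def by (auto simp: norm_sgn)
  have uu: "u \<in> src_fibre G u" "rng G u = u" using unitsD[OF u] by (auto simp: src_fibre_def)
  have p: "1 \<le> (\<infinity> :: ennreal)" by simp
  have "cmod (\<Sum>\<^sub>\<infinity>\<eta>\<in>rng_fibre G (rng G u). f \<eta> * ?x (gmult G (ginv G \<eta>) u)) \<le> vnorm (CC_alg \<infinity> G) f * 1"
    using lp_le_point[OF p _ lreg_lp_le[OF f p u _ x] uu(1)] CC_norm_ge0[OF f p] by simp
  also have "(\<Sum>\<^sub>\<infinity>\<eta>\<in>rng_fibre G (rng G u). f \<eta> * ?x (gmult G (ginv G \<eta>) u))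
     = (\<Sum>\<^sub>\<infinity>\<eta>\<in>rng_fibre G u. complex_of_real (cmod (f \<eta>)))"
    unfolding uu(2)
  proof (rule infsum_cong)
    fix \<eta> assume "\<eta> \<in> rng_fibre G u"
    then have e: "\<eta> \<in> arrows G" "rng G \<eta> = u" by (auto simp: rng_fibre_def)
    have "gmult G (ginv G \<eta>) u = ginv G \<eta>" using src_unit[OF inv_closed[OF e(1)]] e by (simp add: src_inv)
    then have "f \<eta> * ?x (gmult G (ginv G \<eta>) u) = f \<eta> * cnj (sgn (f \<eta>))" using e by (simp add: inv_inv)
    also have "\<dots> = complex_of_real (cmod (f \<eta>))"
      by (cases "f \<eta> = 0") (simp_all add: sgn_eq complex_norm_square[symmetric] power2_eq_square field_simps)
    finally show "f \<eta> * ?x (gmult G (ginv G \<eta>) u) = complex_of_real (cmod (f \<eta>))" .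
  qed
  also have "\<dots> = (\<Sum>\<eta>\<in>{\<gamma> \<in> rng_fibre G u. f \<gamma> \<noteq> 0}. complex_of_real (cmod (f \<eta>)))"
    by (rule infsum_eq_sum) (use finite_rng_support[OF f] in auto)
  also have "cmod \<dots> = (\<Sum>\<eta>\<in>{\<gamma> \<in> rng_fibre G u. f \<gamma> \<noteq> 0}. cmod (f \<eta>))"
    unfolding of_real_sum[symmetric] norm_of_real by (simp add: sum_nonneg)
  finally show ?thesis by simp
qed

end

context left_action
begin

lemma convolve_bound_infinity:
  assumes a: "a \<in> CC (gtop G)" and C: "0 \<le> C" and \<zeta>: "lp_le \<infinity> (topspace X) \<zeta> C"
  shows "lp_le \<infinity> (topspace X) (convolve a \<zeta>) (vnorm (CC_alg \<infinity> G) a * C)"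
proof -
  have "cmod (convolve a \<zeta> z) \<le> vnorm (CC_alg \<infinity> G) a * C" if z: "z \<in> topspace X" for z
  proof -
    let ?S = "{\<gamma> \<in> rng_fibre G (anc z). a \<gamma> \<noteq> 0}"
    have "cmod (convolve a \<zeta> z) \<le> (\<Sum>\<gamma>\<in>?S. cmod (a \<gamma>) * C)"
      unfolding convolve_sum[OF a z] using \<zeta> inv_act_closed(1)[OF z]
      by (intro sum_norm_le) (auto simp: norm_mult lp_le_def intro!: mult_left_mono)
    also have "\<dots> \<le> vnorm (CC_alg \<infinity> G) a * C"
      unfolding sum_distrib_right[symmetric] by (intro mult_right_mono norm_row_sum a anc_unit z C)
    finally show ?thesis .
  qed
  then show ?thesis by (simp add: lp_le_def)
qed

text \<open>An arrow \<open>\<gamma>\<close> with source \<open>r(w)\<close> moves the mass \<open>a(\<gamma>) \<zeta>(w)\<close> from \<open>w\<close> to \<open>\<gamma> w\<close>. Sorting the terms by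
\<open>w\<close> leaves a sum of \<open>\<bar>a\<bar>\<close> over a source fibre. Stabilizers can only cause cancellation.\<close>

lemma convolve_bound_one:
  assumes a: "a \<in> CC (gtop G)" and C: "0 \<le> C" and \<zeta>: "lp_le 1 (topspace X) \<zeta> C"
  shows "lp_le 1 (topspace X) (convolve a \<zeta>) (vnorm (CC_alg 1 G) a * C)"
proof -
  let ?n = "vnorm (CC_alg 1 G) a"
  have n: "0 \<le> ?n" by (rule CC_norm_ge0[OF a]) simp
  have "(\<Sum>z\<in>F. cmod (convolve a \<zeta> z)) \<le> ?n * C" if F: "finite F" "F \<subseteq> topspace X" for F
  proof -
    let ?S = "\<lambda>z. {\<gamma> \<in> rng_fibre G (anc z). a \<gamma> \<noteq> 0}"
    define P where "P = Sigma F ?S"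
    define t where "t = (\<lambda>(z, \<gamma>). act (ginv G \<gamma>) z)"
    have fP: "finite P" unfolding P_def using F finite_rng_support[OF a] by auto
    have tX: "t ` P \<subseteq> topspace X" unfolding P_def t_def using F inv_act_closed(1) by auto
    have "(\<Sum>z\<in>F. cmod (convolve a \<zeta> z)) \<le> (\<Sum>z\<in>F. \<Sum>\<gamma>\<in>?S z. cmod (a \<gamma>) * cmod (\<zeta> (act (ginv G \<gamma>) z)))"
    proof (rule sum_mono)
      fix z assume "z \<in> F"
      then have z: "z \<in> topspace X" using F by blast
      show "cmod (convolve a \<zeta> z) \<le> (\<Sum>\<gamma>\<in>?S z. cmod (a \<gamma>) * cmod (\<zeta> (act (ginv G \<gamma>) z)))"
        unfolding convolve_sum[OF a z] by (intro sum_norm_le) (simp add: norm_mult)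
    qed
    also have "\<dots> = (\<Sum>q\<in>P. cmod (a (snd q)) * cmod (\<zeta> (t q)))"
      unfolding P_def by (subst sum.Sigma) (use F finite_rng_support[OF a] in \<open>auto simp: t_def case_prod_unfold\<close>)
    also have "\<dots> = (\<Sum>w\<in>t ` P. \<Sum>q\<in>{q \<in> P. t q = w}. cmod (a (snd q)) * cmod (\<zeta> (t q)))"
      by (rule sum.image_gen[OF fP])
    also have "\<dots> \<le> (\<Sum>w\<in>t ` P. ?n * cmod (\<zeta> w))"
    proof (rule sum_mono)
      fix w assume "w \<in> t ` P"
      then have w: "w \<in> topspace X" using tX by blast
      have q: "snd q \<in> src_fibre G (anc w) \<and> fst q = act (snd q) w" if qP: "q \<in> P" "t q = w" for q
      proof -
        obtain z \<gamma> where zg: "q = (z, \<gamma>)" "z \<in> topspace X" "\<gamma> \<in> rng_fibre G (anc z)" using qP F by (auto simp: P_def)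
        then have "w = act (ginv G \<gamma>) z" using qP by (simp add: t_def)
        then show ?thesis using zg inv_act_closed[OF zg(2,3)] act_inv_act[OF zg(2,3)]
          by (auto simp: src_fibre_def rng_fibre_def)
      qed
      have inj: "inj_on snd {q \<in> P. t q = w}"
      proof (rule inj_onI)
        fix q1 q2 assume 1: "q1 \<in> {q \<in> P. t q = w}" "q2 \<in> {q \<in> P. t q = w}" "snd q1 = snd q2"
        then have "fst q1 = fst q2" using q[of q1] q[of q2] by simp
        then show "q1 = q2" using 1(3) by (rule prod_eqI)
      qed
      have "(\<Sum>q\<in>{q \<in> P. t q = w}. cmod (a (snd q)) * cmod (\<zeta> (t q)))
         = (\<Sum>q\<in>{q \<in> P. t q = w}. cmod (a (snd q))) * cmod (\<zeta> w)"
        by (simp add: sum_distrib_right)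
      also have "(\<Sum>q\<in>{q \<in> P. t q = w}. cmod (a (snd q))) = (\<Sum>\<gamma>\<in>snd ` {q \<in> P. t q = w}. cmod (a \<gamma>))"
        by (simp add: sum.reindex[OF inj])
      also have "\<dots> \<le> ?n"
        by (rule norm_column_sum[OF a anc_unit[OF w]]) (use fP q in auto)
      finally show "(\<Sum>q\<in>{q \<in> P. t q = w}. cmod (a (snd q)) * cmod (\<zeta> (t q))) \<le> ?n * cmod (\<zeta> w)"
        by (simp add: mult_right_mono)
    qed
    also have "\<dots> = ?n * (\<Sum>w\<in>t ` P. cmod (\<zeta> w))" by (simp add: sum_distrib_left)
    also have "\<dots> \<le> ?n * C"
      using \<zeta> tX fP C n by (intro mult_left_mono) (auto simp: lp_le_def)
    finally show ?thesis .
  qed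
  then show ?thesis using n C by (simp add: lp_le_def)
qed

definition orbit :: "'x \<Rightarrow> 'x set" where
  "orbit w = (\<lambda>\<gamma>. act \<gamma> w) ` src_fibre G (anc w)"

lemma orbit_subset: "w \<in> topspace X \<Longrightarrow> orbit w \<subseteq> topspace X"
  by (auto simp: orbit_def src_fibre_def act_closed)

lemma orbit_self: "w \<in> topspace X \<Longrightarrow> w \<in> orbit w"
  unfolding orbit_def by (rule image_eqI[of _ _ "anc w"]) (use unitsD anc_unit act_unit in \<open>auto simp: src_fibre_def\<close>)

lemma orbit_eq:
  assumes w: "w \<in> topspace X" and z: "z \<in> orbit w" shows "orbit z = orbit w"
proof -
  obtain g where g: "g \<in> arrows G" "src G g = anc w" "z = act g w" using z by (auto simp: orbit_def src_fibre_def)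
  have az: "anc z = rng G g" using g w by (simp add: anc_act)
  show ?thesis
  proof
    show "orbit z \<subseteq> orbit w"
    proof
      fix y assume "y \<in> orbit z"
      then obtain h where h: "h \<in> arrows G" "src G h = rng G g" "y = act h z" by (auto simp: orbit_def src_fibre_def az)
      then have "y = act (gmult G h g) w" using act_mult[of h g w] g w by simp
      then show "y \<in> orbit w" unfolding orbit_def using h g by (auto simp: src_fibre_def mult_closed src_mult)
    qed
    show "orbit w \<subseteq> orbit z"
    proof
      fix y assume "y \<in> orbit w"
      then obtain h where h: "h \<in> arrows G" "src G h = anc w" "y = act h w" by (auto simp: orbit_def src_fibre_def)
      have "act (gmult G h (ginv G g)) z = act h (act (ginv G g) z)"
        using h g w az by (intro act_mult) (auto simp: inv_closed rng_inv src_inv act_closed)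
      also have "\<dots> = y" using h g w by (simp add: inv_act_act)
      finally show "y \<in> orbit z" unfolding orbit_def
        using h g az by (intro image_eqI[of _ _ "gmult G h (ginv G g)"]) (auto simp: src_fibre_def mult_closed inv_closed rng_inv src_mult src_inv)
    qed
  qed
qed

text \<open>The map \<open>\<gamma> \<mapsto> \<gamma> w\<close> from a source fibre onto the orbit of \<open>w\<close> is \<open>n\<close>-to-one, where \<open>n\<close> is the order of the
stabilizer of \<open>w\<close>, since its fibres are cosets of the stabilizer. Pulling back along it intertwines \<open>\<Pi>(a)\<close>
with the regular representation and multiplies \<open>p\<close>-th powers of norms by \<open>n\<close>, and this factor cancels.\<close>

lemma convolve_bound_orbit:
  assumes a: "a \<in> CC (gtop G)" and p: "1 \<le> p" "p \<noteq> \<infinity>" and w: "w \<in> topspace X"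
    and fin: "finite {\<gamma> \<in> arrows G. src G \<gamma> = anc w \<and> act \<gamma> w = w}" (is "finite ?K")
    and D: "0 \<le> D" and \<zeta>: "lp_le p (orbit w) \<zeta> D"
  shows "lp_le p (orbit w) (convolve a \<zeta>) (vnorm (CC_alg p G) a * D)"
proof -
  define r where "r = enn2real p"
  have r: "1 \<le> r" using enn2real_ge1[OF p] by (simp add: r_def)
  define n where "n = card ?K"
  have nn: "0 \<le> vnorm (CC_alg p G) a" by (rule CC_norm_ge0[OF a p(1)])
  have u: "anc w \<in> units G" by (rule anc_unit[OF w])
  have "anc w \<in> ?K" using unitsD[OF u] act_unit[OF w] by simp
  then have n0: "0 < n" unfolding n_def using fin by (auto simp: card_gt_0_iff)
  let ?A = "src_fibre G (anc w)"
  let ?q = "\<lambda>\<gamma>. act \<gamma> w"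
  have fib: "finite {\<gamma> \<in> ?A. ?q \<gamma> = z} \<and> card {\<gamma> \<in> ?A. ?q \<gamma> = z} = n" if "z \<in> orbit w" for z
  proof -
    obtain g where g: "g \<in> arrows G" "src G g = anc w" "z = act g w" using \<open>z \<in> orbit w\<close> by (auto simp: orbit_def src_fibre_def)
    have "bij_betw (gmult G g) ?K {\<gamma> \<in> ?A. ?q \<gamma> = z}"
    proof (rule bij_betw_byWitness[where f' = "gmult G (ginv G g)"])
      have K: "k \<in> arrows G \<and> rng G k = anc w \<and> src G k = anc w \<and> act k w = w" if "k \<in> ?K" for k
        using that anc_act[of k w] w by auto
      show "\<forall>k\<in>?K. gmult G (ginv G g) (gmult G g k) = k" using K g by (auto intro!: inv_mult_cancel)
      have L: "\<gamma> \<in> arrows G \<and> src G \<gamma> = anc w \<and> act \<gamma> w = z \<and> rng G \<gamma> = rng G g" if "\<gamma> \<in> {\<gamma> \<in> ?A. ?q \<gamma> = z}" for \<gamma>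
        using that anc_act[of \<gamma> w] anc_act[of g w] w g by (auto simp: src_fibre_def)
      show "\<forall>\<gamma>\<in>{\<gamma> \<in> ?A. ?q \<gamma> = z}. gmult G g (gmult G (ginv G g) \<gamma>) = \<gamma>"
        using L g by (intro ballI mult_inv_cancel) auto
      show "gmult G g ` ?K \<subseteq> {\<gamma> \<in> ?A. ?q \<gamma> = z}"
        using K g w act_mult[of g _ w] by (auto simp: src_fibre_def mult_closed src_mult)
      show "gmult G (ginv G g) ` {\<gamma> \<in> ?A. ?q \<gamma> = z} \<subseteq> ?K"
      proof
        fix k assume "k \<in> gmult G (ginv G g) ` {\<gamma> \<in> ?A. ?q \<gamma> = z}"
        then obtain \<gamma> where k: "k = gmult G (ginv G g) \<gamma>" "\<gamma> \<in> {\<gamma> \<in> ?A. ?q \<gamma> = z}" by blast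
        note Lg = L[OF k(2)]
        have "act k w = act (ginv G g) (act \<gamma> w)" unfolding k(1)
          using Lg g w by (intro act_mult) (auto simp: inv_closed src_inv)
        also have "\<dots> = w" using Lg g w by (simp add: inv_act_act)
        finally show "k \<in> ?K" using Lg g k by (simp add: mult_closed inv_closed src_inv src_mult)
      qed
    qed
    then show ?thesis using bij_betw_same_card[of _ ?K] bij_betw_finite[of _ ?K] fin unfolding n_def by force
  qed
  \<comment> \<open>the factor by which pulling back to the source fibre changes the norm\<close>
  have nr: "(real n powr (1 / r) * E) powr r = real n * E powr r" if "0 \<le> E" for E
    using r that n0 by (simp add: powr_mult powr_powr)
  have "lp_le p ?A (\<lambda>\<gamma>. \<zeta> (?q \<gamma>)) (real n powr (1 / r) * D)"
  proof -
    have "(\<Sum>\<gamma>\<in>F. cmod (\<zeta> (?q \<gamma>)) powr r) \<le> (real n powr (1 / r) * D) powr r" if F: "finite F" "F \<subseteq> ?A" for F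
    proof -
      have "(\<Sum>\<gamma>\<in>F. cmod (\<zeta> (?q \<gamma>)) powr r) = (\<Sum>z\<in>?q ` F. \<Sum>\<gamma>\<in>{\<gamma> \<in> F. ?q \<gamma> = z}. cmod (\<zeta> (?q \<gamma>)) powr r)"
        by (rule sum.image_gen[OF F(1)])
      also have "\<dots> \<le> (\<Sum>z\<in>?q ` F. real n * cmod (\<zeta> z) powr r)"
      proof (rule sum_mono)
        fix z assume "z \<in> ?q ` F"
        then have "z \<in> orbit w" using F by (auto simp: orbit_def)
        then have "card {\<gamma> \<in> F. ?q \<gamma> = z} \<le> n"
          using fib[of z] card_mono[of "{\<gamma> \<in> ?A. ?q \<gamma> = z}" "{\<gamma> \<in> F. ?q \<gamma> = z}"] F by auto
        then show "(\<Sum>\<gamma>\<in>{\<gamma> \<in> F. ?q \<gamma> = z}. cmod (\<zeta> (?q \<gamma>)) powr r) \<le> real n * cmod (\<zeta> z) powr r"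
          by (simp add: mult_right_mono)
      qed
      also have "\<dots> = real n * (\<Sum>z\<in>?q ` F. cmod (\<zeta> z) powr r)" by (simp add: sum_distrib_left)
      also have "\<dots> \<le> real n * D powr r"
      proof (rule mult_left_mono)
        have "?q ` F \<subseteq> orbit w" using F(2) by (auto simp: orbit_def)
        then show "(\<Sum>z\<in>?q ` F. cmod (\<zeta> z) powr r) \<le> D powr r"
          unfolding r_def by (rule lp_le_sumD[OF \<zeta> p(2) finite_imageI[OF F(1)]])
      qed simp
      finally show ?thesis using nr[OF D] by simp
    qed
    then show ?thesis using p by (simp add: lp_le_def r_def)
  qed
  then have "lp_le p ?A (\<lambda>\<gamma>. \<Sum>\<^sub>\<infinity>\<eta>\<in>rng_fibre G (rng G \<gamma>). a \<eta> * \<zeta> (?q (gmult G (ginv G \<eta>) \<gamma>)))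
      (vnorm (CC_alg p G) a * (real n powr (1 / r) * D))"
    using D by (intro lreg_lp_le[OF a p(1) u]) auto
  moreover have "(\<Sum>\<^sub>\<infinity>\<eta>\<in>rng_fibre G (rng G \<gamma>). a \<eta> * \<zeta> (?q (gmult G (ginv G \<eta>) \<gamma>))) = convolve a \<zeta> (?q \<gamma>)" if "\<gamma> \<in> ?A" for \<gamma>
  proof -
    have g: "\<gamma> \<in> arrows G" "src G \<gamma> = anc w" using that by (auto simp: src_fibre_def)
    have m: "act (gmult G (ginv G \<eta>) \<gamma>) w = act (ginv G \<eta>) (act \<gamma> w)" if "\<eta> \<in> rng_fibre G (rng G \<gamma>)" for \<eta>
      using that g w by (intro act_mult) (auto simp: rng_fibre_def inv_closed src_inv)
    show ?thesis using g w m by (auto simp: act_conv_def cut_def act_closed anc_act intro!: infsum_cong)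
  qed
  ultimately have B: "lp_le p ?A (\<lambda>\<gamma>. convolve a \<zeta> (?q \<gamma>)) (vnorm (CC_alg p G) a * (real n powr (1 / r) * D))"
    by (subst lp_le_cong[where g = "\<lambda>\<gamma>. \<Sum>\<^sub>\<infinity>\<eta>\<in>rng_fibre G (rng G \<gamma>). a \<eta> * \<zeta> (?q (gmult G (ginv G \<eta>) \<gamma>))"]) auto
  have "(\<Sum>z\<in>F. cmod (convolve a \<zeta> z) powr r) \<le> (vnorm (CC_alg p G) a * D) powr r" if F: "finite F" "F \<subseteq> orbit w" for F
  proof -
    let ?F = "{\<gamma> \<in> ?A. ?q \<gamma> \<in> F}"
    have "?F = (\<Union>z\<in>F. {\<gamma> \<in> ?A. ?q \<gamma> = z})" by auto
    then have fF: "finite ?F" using F fib by auto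
    have im: "?q ` ?F = F" using F by (auto simp: orbit_def)
    have "real n * (\<Sum>z\<in>F. cmod (convolve a \<zeta> z) powr r) = (\<Sum>z\<in>F. \<Sum>\<gamma>\<in>{\<gamma> \<in> ?F. ?q \<gamma> = z}. cmod (convolve a \<zeta> (?q \<gamma>)) powr r)"
      unfolding sum_distrib_left
    proof (rule sum.cong[OF refl])
      fix z assume z: "z \<in> F"
      then have "{\<gamma> \<in> ?F. ?q \<gamma> = z} = {\<gamma> \<in> ?A. ?q \<gamma> = z}" by auto
      then have "card {\<gamma> \<in> ?F. ?q \<gamma> = z} = n" using fib z F by auto
      then show "real n * cmod (convolve a \<zeta> z) powr r = (\<Sum>\<gamma>\<in>{\<gamma> \<in> ?F. ?q \<gamma> = z}. cmod (convolve a \<zeta> (?q \<gamma>)) powr r)" by simp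
    qed
    also have "\<dots> = (\<Sum>\<gamma>\<in>?F. cmod (convolve a \<zeta> (?q \<gamma>)) powr r)"
      using sum.image_gen[OF fF, of "\<lambda>\<gamma>. cmod (convolve a \<zeta> (?q \<gamma>)) powr r" ?q] unfolding im by simp
    also have "\<dots> \<le> (vnorm (CC_alg p G) a * (real n powr (1 / r) * D)) powr r"
      using lp_le_sumD[OF B p(2) fF] unfolding r_def by simp
    also have "\<dots> = real n * (vnorm (CC_alg p G) a * D) powr r"
      using nr[of "vnorm (CC_alg p G) a * D"] nn D by (simp add: mult_ac)
    finally show ?thesis using n0 by simp
  qed
  then show ?thesis using p by (simp add: lp_le_def r_def)
qed

text \<open>The space is the disjoint union of the orbits, and \<open>\<Pi>(a)\<close> preserves the functions on each orbit.\<close>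

lemma convolve_bound_finite_stabilizers:
  assumes a: "a \<in> CC (gtop G)" and p: "1 \<le> p" "p \<noteq> \<infinity>"
    and fin: "\<And>w. w \<in> topspace X \<Longrightarrow> finite {\<gamma> \<in> arrows G. src G \<gamma> = anc w \<and> act \<gamma> w = w}"
    and C: "0 \<le> C" and \<zeta>: "lp_le p (topspace X) \<zeta> C"
  shows "lp_le p (topspace X) (convolve a \<zeta>) (vnorm (CC_alg p G) a * C)"
proof -
  define r where "r = enn2real p"
  have r: "1 \<le> r" using enn2real_ge1[OF p] by (simp add: r_def)
  let ?m = "vnorm (CC_alg p G) a"
  have nn: "0 \<le> ?m" by (rule CC_norm_ge0[OF a p(1)])
  let ?h = "\<lambda>z. cmod (\<zeta> z) powr r"
  have summ: "?h summable_on T" if "T \<subseteq> topspace X" for T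
  proof (rule nonneg_bdd_above_summable_on)
    show "bdd_above (sum ?h ` {F. F \<subseteq> T \<and> finite F})"
      using \<zeta> that p by (intro bdd_aboveI[of _ "C powr r"]) (auto simp: lp_le_def r_def)
  qed simp
  have "(\<Sum>z\<in>F. cmod (convolve a \<zeta> z) powr r) \<le> (?m * C) powr r" if F: "finite F" "F \<subseteq> topspace X" for F
  proof -
    have orb: "T \<subseteq> topspace X" if "T \<in> orbit ` F" for T using that F orbit_subset by blast
    have oy: "orbit y = T" if "T \<in> orbit ` F" "y \<in> T" for T y
    proof -
      obtain w where "w \<in> F" "T = orbit w" using \<open>T \<in> orbit ` F\<close> by blast
      then show ?thesis using orbit_eq[of w y] F(2) that(2) by blast
    qed
    have disj: "T \<inter> T' = {}" if T: "T \<in> orbit ` F" "T' \<in> orbit ` F" "T \<noteq> T'" for T T'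
    proof (rule ccontr)
      assume "T \<inter> T' \<noteq> {}"
      then obtain y where "y \<in> T" "y \<in> T'" by blast
      then show False using oy[OF T(1), of y] oy[OF T(2), of y] T(3) by simp
    qed
    have "(\<Sum>z\<in>F. cmod (convolve a \<zeta> z) powr r) = (\<Sum>T\<in>orbit ` F. \<Sum>z\<in>{z \<in> F. orbit z = T}. cmod (convolve a \<zeta> z) powr r)"
      by (rule sum.image_gen[OF F(1)])
    also have "\<dots> \<le> (\<Sum>T\<in>orbit ` F. ?m powr r * infsum ?h T)"
    proof (rule sum_mono)
      fix T assume T: "T \<in> orbit ` F"
      then obtain w where w: "w \<in> topspace X" "T = orbit w" using F by blast
      define D where "D = infsum ?h T powr (1 / r)"
      have I0: "0 \<le> infsum ?h T" by (rule infsum_nonneg) simp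
      have Dr: "D powr r = infsum ?h T" using I0 r by (simp add: D_def powr_powr)
      have "lp_le p (orbit w) \<zeta> D"
        using finite_sum_le_infsum[OF summ[OF orb[OF T]]] p w Dr by (auto simp: lp_le_def r_def)
      then have "lp_le p (orbit w) (convolve a \<zeta>) (?m * D)"
        by (intro convolve_bound_orbit[OF a p w(1) fin[OF w(1)]]) (simp add: D_def)
      then have "(\<Sum>z\<in>{z \<in> F. orbit z = T}. cmod (convolve a \<zeta> z) powr r) \<le> (?m * D) powr r"
        unfolding r_def by (rule lp_le_sumD[OF _ p(2)]) (use F w orbit_self in auto)
      then show "(\<Sum>z\<in>{z \<in> F. orbit z = T}. cmod (convolve a \<zeta> z) powr r) \<le> ?m powr r * infsum ?h T"
        using nn Dr by (simp add: powr_mult D_def)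
    qed
    also have "\<dots> = ?m powr r * (\<Sum>T\<in>orbit ` F. infsum ?h T)" by (simp add: sum_distrib_left)
    also have "(\<Sum>T\<in>orbit ` F. infsum ?h T) = infsum ?h (\<Union>T\<in>orbit ` F. T)"
      by (rule sum_infsum) (use F summ orb disj in auto)
    also have "\<dots> \<le> C powr r"
    proof (rule infsum_le_finite_sums)
      show "?h summable_on (\<Union>T\<in>orbit ` F. T)" by (rule summ) (use orb in blast)
      fix F' assume fF': "finite F'" and F': "F' \<subseteq> (\<Union>T\<in>orbit ` F. T)"
      have "(\<Union>T\<in>orbit ` F. T) \<subseteq> topspace X" using orb by blast
      then have "F' \<subseteq> topspace X" using F' by (rule subset_trans[rotated])
      then show "sum ?h F' \<le> C powr r" unfolding r_def by (rule lp_le_sumD[OF \<zeta> p(2) fF'])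
    qed
    finally show ?thesis using nn C by (simp add: powr_mult mult_left_mono)
  qed
  then show ?thesis using p by (simp add: lp_le_def r_def)
qed

lemma convolve_bound:
  assumes a: "a \<in> CC (gtop G)" and p: "1 \<le> p"
    and cases: "p = 1 \<or> p = \<infinity> \<or> (\<forall>w\<in>topspace X. finite {\<gamma> \<in> arrows G. src G \<gamma> = anc w \<and> act \<gamma> w = w})"
    and C: "0 \<le> C" and \<zeta>: "lp_le p (topspace X) \<zeta> C"
  shows "lp_le p (topspace X) (convolve a \<zeta>) (vnorm (CC_alg p G) a * C)"
proof (cases "p = \<infinity>")
  case True then show ?thesis using convolve_bound_infinity[OF a C] \<zeta> by simp
next
  case False
  show ?thesis
  proof (cases "p = 1")
    case True then show ?thesis using convolve_bound_one[OF a C] \<zeta> by simp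
  next
    case False
    then show ?thesis using convolve_bound_finite_stabilizers[OF a p \<open>p \<noteq> \<infinity>\<close> _ C \<zeta>] cases \<open>p \<noteq> \<infinity>\<close> by blast
  qed
qed

definition conv_op :: "('x \<Rightarrow> complex) cnspace \<Rightarrow> ('g \<Rightarrow> complex) \<Rightarrow> ('x \<Rightarrow> complex) \<Rightarrow> 'x \<Rightarrow> complex" where
  "conv_op V a = (\<lambda>\<zeta>\<in>carr V. convolve a \<zeta>)"

lemma conv_op_bounded:
  assumes V: "is_lp p (topspace X) V" and a: "a \<in> CC (gtop G)" and p: "1 \<le> p"
    and cases: "p = 1 \<or> p = \<infinity> \<or> (\<forall>w\<in>topspace X. finite {\<gamma> \<in> arrows G. src G \<gamma> = anc w \<and> act \<gamma> w = w})"
  shows "conv_op V a \<in> carr (bops V V)" "vnorm (bops V V) (conv_op V a) \<le> vnorm (CC_alg p G) a"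
proof -
  have c: "cut (topspace X) (convolve a \<zeta>) = convolve a \<zeta>" for \<zeta> by (auto simp: act_conv_def cut_def)
  have b: "lp_le p (topspace X) (convolve a \<xi>) (vnorm (CC_alg p G) a * C)" 
    if "\<xi> \<in> carr V" "0 \<le> C" "lp_le p (topspace X) \<xi> C" for \<xi> C
    by (rule convolve_bound[OF a p cases that(2,3)])
  have n: "0 \<le> vnorm (CC_alg p G) a" by (rule CC_norm_ge0[OF a p])
  have "(\<lambda>\<zeta>\<in>carr V. cut (topspace X) (convolve a \<zeta>)) \<in> carr (bops V V)"
    "vnorm (bops V V) (\<lambda>\<zeta>\<in>carr V. cut (topspace X) (convolve a \<zeta>)) \<le> vnorm (CC_alg p G) a"
    by (rule is_lp_bopsI[OF V V p n b]; simp add: convolve_add_right[OF a] convolve_scale_right[OF a])+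
  then show "conv_op V a \<in> carr (bops V V)" "vnorm (bops V V) (conv_op V a) \<le> vnorm (CC_alg p G) a"
    unfolding conv_op_def c by simp_all
qed

lemma conv_op_add:
  assumes V: "is_lp p (topspace X) V" and "a \<in> CC (gtop G)" "b \<in> CC (gtop G)"
  shows "conv_op V (\<lambda>x. a x + b x) = vadd (bops V V) (conv_op V a) (conv_op V b)"
  by (auto simp: conv_op_def convolve_add_left[OF assms(2,3)] is_lp_sel[OF V] intro!: restrict_ext)

lemma conv_op_scale:
  assumes V: "is_lp p (topspace X) V" and "a \<in> CC (gtop G)"
  shows "conv_op V (\<lambda>x. c * a x) = vscale (bops V V) c (conv_op V a)"
  by (auto simp: conv_op_def convolve_scale_left[OF assms(2)] is_lp_sel[OF V] intro!: restrict_ext)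

lemma conv_op_mult:
  assumes "a \<in> CC (gtop G)" "b \<in> CC (gtop G)" "conv_op V b \<in> carr (bops V V)"
  shows "conv_op V (conv G a b) = compose (carr V) (conv_op V a) (conv_op V b)"
  using bops_closed[OF assms(3)]
  by (auto simp: conv_op_def compose_def convolve_conv[OF assms(1,2)] intro!: restrict_ext)

lemma convolve_cong_left: "(\<And>\<gamma>. \<gamma> \<in> arrows G \<Longrightarrow> a \<gamma> = b \<gamma>) \<Longrightarrow> convolve a \<phi> = convolve b \<phi>"
  unfolding act_conv_def cut_def by (auto intro!: infsum_cong simp: rng_fibreD fun_eq_iff)

end

section \<open>The regular representation\<close>

context lc_etale_groupoid
begin

lemma is_lp_EH: "1 \<le> p \<Longrightarrow> is_lp p (arrows G) (EH p G)"
proof -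
  assume p: "1 \<le> p"
  have "(\<Union>v\<in>units G. src_fibre G v) = arrows G" by (auto simp: src_fibre_def units_def)
  then show ?thesis
    using is_lp_lp_sum[OF p, of "units G" "src_fibre G"] by (auto simp: EH_def src_fibre_def)
qed

text \<open>The action of a groupoid on itself is free, so the estimate is available for every exponent.\<close>

lemma self_stabilizer:
  assumes "w \<in> arrows G" shows "finite {\<gamma> \<in> arrows G. src G \<gamma> = rng G w \<and> gmult G \<gamma> w = w}"
proof (rule finite_subset[of _ "{rng G w}"])
  show "{\<gamma> \<in> arrows G. src G \<gamma> = rng G w \<and> gmult G \<gamma> w = w} \<subseteq> {rng G w}"
  proof
    fix \<gamma> assume "\<gamma> \<in> {\<gamma> \<in> arrows G. src G \<gamma> = rng G w \<and> gmult G \<gamma> w = w}"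
    then have g: "\<gamma> \<in> arrows G" "src G \<gamma> = rng G w" "gmult G \<gamma> w = w" by auto
    have "gmult G (gmult G \<gamma> w) (ginv G w) = gmult G \<gamma> (gmult G w (ginv G w))"
      using g assms by (intro mult_assoc) (auto simp: inv_closed rng_inv)
    then have "rng G w = \<gamma>" using g assms inv_right src_unit by metis
    then show "\<gamma> \<in> {rng G w}" by simp
  qed
qed simp

text \<open>The cuts to the source fibres have no effect, because \<open>\<eta>\<^sup>-\<^sup>1 h\<close> has the same source as \<open>h\<close>.\<close>

lemma lreg_sum_eq:
  assumes p: "1 \<le> p"
  shows "lreg_sum p G f = S.conv_op (EH p G) f"
  unfolding lreg_sum_def S.conv_op_def
proof (intro restrict_ext ext)
  fix \<xi> h assume \<xi>: "\<xi> \<in> carr (EH p G)"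
  let ?u = "src G h"
  let ?x = "cut (src_fibre G ?u) \<xi>"
  have sub: "src_fibre G ?u \<subseteq> arrows G" by (auto simp: src_fibre_def)
  have "lp_le p (src_fibre G ?u) ?x (vnorm (EH p G) \<xi>)"
    unfolding lp_le_cut by (rule lp_le_subset[OF is_lp_le[OF is_lp_EH[OF p] p \<xi>] sub])
  then have x: "?x \<in> carr (lp p (src_fibre G ?u))"
    using is_lp_ge0[OF is_lp_EH[OF p] \<xi>] by (intro is_lp_mem[OF is_lp_lp p]) (auto simp: cut_def)
  show "cut (arrows G) (\<lambda>h. lreg p G (src G h) f (cut (src_fibre G (src G h)) \<xi>) h) h =
     act_conv G (gtop G) (rng G) (gmult G) f \<xi> h"
  proof (cases "h \<in> arrows G")
    case True
    then have mem: "h \<in> src_fibre G ?u" by (simp add: src_fibre_def)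
    have "lreg p G ?u f ?x h = (\<Sum>\<^sub>\<infinity>\<eta>\<in>rng_fibre G (rng G h). f \<eta> * ?x (gmult G (ginv G \<eta>) h))"
      using x by (simp add: lreg_def cut_apply[OF mem])
    also have "\<dots> = (\<Sum>\<^sub>\<infinity>\<eta>\<in>rng_fibre G (rng G h). f \<eta> * \<xi> (gmult G (ginv G \<eta>) h))"
      using True by (intro infsum_cong) (auto simp: cut_def src_fibre_def rng_fibre_def mult_closed inv_closed src_inv src_mult)
    finally show ?thesis using True by (simp add: act_conv_def cut_def arrows_def[symmetric])
  qed (simp add: act_conv_def cut_def arrows_def[symmetric])
qed

lemma self_cases: "p = 1 \<or> p = \<infinity> \<or> (\<forall>w\<in>topspace (gtop G). finite {\<gamma> \<in> arrows G. src G \<gamma> = rng G w \<and> gmult G \<gamma> w = w})"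
  using self_stabilizer by (simp add: arrows_def)

lemma is_lp_EH_topspace: "1 \<le> p \<Longrightarrow> is_lp p (topspace (gtop G)) (EH p G)"
  using is_lp_EH by (simp add: arrows_def)

lemma lreg_sum_closed:
  assumes p: "1 \<le> p" and f: "f \<in> CC (gtop G)"
  shows "lreg_sum p G f \<in> carr (bops (EH p G) (EH p G))"
  unfolding lreg_sum_eq[OF p] by (rule S.conv_op_bounded[OF is_lp_EH_topspace[OF p] f p self_cases])

text \<open>One inequality is the contractivity of \<open>\<Pi>\<close>, the other holds because each source fibre carries a direct
summand.\<close>

lemma lreg_sum_norm:
  assumes p: "1 \<le> p" and f: "f \<in> CC (gtop G)"
  shows "vnorm (CC_alg p G) f = vnorm (bops (EH p G) (EH p G)) (lreg_sum p G f)"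
proof (rule antisym)
  let ?E = "EH p G"
  interpret E: cnormed ?E by (rule is_lp_cnormed[OF is_lp_EH[OF p] p])
  interpret EE: cnormed_pair ?E ?E by unfold_locales
  note L = lreg_sum_closed[OF p f]
  show "vnorm (bops ?E ?E) (lreg_sum p G f) \<le> vnorm (CC_alg p G) f"
    unfolding lreg_sum_eq[OF p] by (rule S.conv_op_bounded[OF is_lp_EH_topspace[OF p] f p self_cases])
  show "vnorm (CC_alg p G) f \<le> vnorm (bops ?E ?E) (lreg_sum p G f)"
  proof (rule CC_norm_le)
    show n0: "0 \<le> vnorm (bops ?E ?E) (lreg_sum p G f)" by (rule EE.opnorm_ge0[OF L])
    fix u assume u: "u \<in> units G"
    let ?F = "lp p (src_fibre G u)"
    interpret F: cnormed_pair ?F ?F by (intro cnormed_pair.intro cnormed_lp p)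
    show "vnorm (bops ?F ?F) (lreg p G u f) \<le> vnorm (bops ?E ?E) (lreg_sum p G f)"
    proof (rule F.opnorm_le[OF n0])
      fix \<xi> assume \<xi>: "\<xi> \<in> carr ?F"
      have sub: "src_fibre G u \<subseteq> arrows G" by (auto simp: src_fibre_def)
      have n: "0 \<le> vnorm ?F \<xi>" by (rule lp_norm_ge0[OF \<xi>])
      have z: "\<xi> x = 0" if "x \<notin> src_fibre G u" for x using is_lp_zero[OF is_lp_lp \<xi> that] .
      have z': "\<xi> x = 0" if "x \<notin> arrows G" for x using z that sub by blast
      have le: "lp_le p (arrows G) \<xi> (vnorm ?F \<xi>)"
        by (rule lp_le_extend[OF sub z n is_lp_le[OF is_lp_lp p \<xi>]])
      have \<xi>E: "\<xi> \<in> carr ?E" by (rule is_lp_mem[OF is_lp_EH[OF p] p n z' le])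
      have "vnorm ?E (lreg_sum p G f \<xi>) \<le> vnorm (bops ?E ?E) (lreg_sum p G f) * vnorm ?E \<xi>"
        by (rule EE.opnorm_bound[OF L \<xi>E])
      also have "\<dots> \<le> vnorm (bops ?E ?E) (lreg_sum p G f) * vnorm ?F \<xi>"
        by (rule mult_left_mono[OF is_lp_norm_le[OF is_lp_EH[OF p] p n z' le] n0])
      finally have "lp_le p (arrows G) (lreg_sum p G f \<xi>) (vnorm (bops ?E ?E) (lreg_sum p G f) * vnorm ?F \<xi>)"
        using is_lp_le[OF is_lp_EH[OF p] p bops_closed[OF L \<xi>E]] lp_le_mono[OF p] E.norm_ge0[OF bops_closed[OF L \<xi>E]] by blast
      then have "lp_le p (src_fibre G u) (lreg_sum p G f \<xi>) (vnorm (bops ?E ?E) (lreg_sum p G f) * vnorm ?F \<xi>)"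
        by (rule lp_le_subset[OF _ sub])
      moreover have "lreg p G u f \<xi> \<gamma> = lreg_sum p G f \<xi> \<gamma>" if "\<gamma> \<in> src_fibre G u" for \<gamma>
        using that \<xi> \<xi>E unfolding lreg_sum_eq[OF p] S.conv_op_def lreg_def
        by (simp add: cut_def act_conv_def src_fibre_def arrows_def)
      ultimately have l: "lp_le p (src_fibre G u) (lreg p G u f \<xi>) (vnorm (bops ?E ?E) (lreg_sum p G f) * vnorm ?F \<xi>)"
        by (subst lp_le_cong[where g = "lreg_sum p G f \<xi>"]) auto
      show "vnorm ?F (lreg p G u f \<xi>) \<le> vnorm (bops ?E ?E) (lreg_sum p G f) * vnorm ?F \<xi>"
        by (rule is_lp_norm_le[OF is_lp_lp p _ _ l]) (use n n0 \<xi> in \<open>auto simp: lreg_def cut_def\<close>)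
    qed
  qed
qed

lemma CC_conv: "a \<in> CC (gtop G) \<Longrightarrow> b \<in> CC (gtop G) \<Longrightarrow> conv G a b \<in> CC (gtop G)"
  unfolding conv_eq_act_conv by (rule S.CC_convolve)

lemma op_normed_alg_CC:
  assumes p: "1 \<le> p"
  shows "op_normed_alg (CC_alg p G) (EH p G) (lreg_sum p G)"
proof -
  interpret E: cnormed "EH p G" by (rule is_lp_cnormed[OF is_lp_EH[OF p] p])
  note V = is_lp_EH_topspace[OF p]
  show ?thesis
  proof
    fix a b assume a: "a \<in> carr (CC_alg p G)" and b: "b \<in> carr (CC_alg p G)"
    show "lreg_sum p G (vadd (CC_alg p G) a b) = vadd (bops (EH p G) (EH p G)) (lreg_sum p G a) (lreg_sum p G b)"
      using S.conv_op_add[OF V, of a b] a b by (simp add: lreg_sum_eq[OF p])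
    show "lreg_sum p G (amult (CC_alg p G) a b) = compose (carr (EH p G)) (lreg_sum p G a) (lreg_sum p G b)"
      using S.conv_op_mult[of a b "EH p G"] a b lreg_sum_closed[OF p, of b] by (simp add: lreg_sum_eq[OF p])
  next
    fix a c assume a: "a \<in> carr (CC_alg p G)"
    show "lreg_sum p G (vscale (CC_alg p G) c a) = vscale (bops (EH p G) (EH p G)) c (lreg_sum p G a)"
      using S.conv_op_scale[OF V, of a c] a by (simp add: lreg_sum_eq[OF p])
  qed (auto simp: CC_add CC_scale CC_conv lreg_sum_closed[OF p] lreg_sum_norm[OF p] simp del: bops_sel)
qed

end

section \<open>The operators of a correspondence\<close>

locale correspondence_setting = G: lc_etale_groupoid G + H: lc_etale_groupoid H + groupoid_correspondence G H Z
  for G :: "'g groupoid" and H :: "'h groupoid" and Z :: "('g, 'h, 'z) corr" +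
  fixes p :: ennreal
  assumes p: "1 \<le> p"
begin

abbreviation "X \<equiv> topspace (ztop Z)"
abbreviation "E \<equiv> EH p H"
abbreviation "F \<equiv> EZ p H Z"

lemma left_action_of_G: "left_action G (ztop Z) (ranchor Z) (lact Z)"
  by unfold_locales
    (auto simp: ranchor_continuous lact_closed ranchor_lact lact_unit lact_mult lact_continuous[unfolded left_pairs_def])

text \<open>Turning the right action into a left action makes \<open>T\<^sub>\<phi> \<lambda>(f)\<close> and \<open>\<lambda>(f) S\<^sub>\<psi>\<close> instances of the left theory.\<close>

lemma left_action_of_H: "left_action H (ztop Z) (sanchor Z) (\<lambda>h z. ract Z z (ginv H h))"
proof unfold_locales
  show "continuous_map (ztop Z) (unit_space H) (sanchor Z)" by (rule local_homeo_continuous[OF sanchor_local_homeo])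
  then have u: "sanchor Z z \<in> units H" if "z \<in> X" for z
    using that H.topspace_unit_space by (auto simp: continuous_map_def)
  show "ract Z z (ginv H (sanchor Z z)) = z" if "z \<in> X" for z
    using that ract_unit H.inv_unit[OF u[OF that]] by simp
  fix h k z assume a: "h \<in> arrows H" "k \<in> arrows H" "z \<in> X" "src H h = rng H k" "src H k = sanchor Z z"
  then show "ract Z z (ginv H (gmult H h k)) = ract Z (ract Z z (ginv H k)) (ginv H h)"
    by (simp add: H.inv_mult ract_mult H.inv_closed H.rng_inv H.src_inv)
next
  have "continuous_map (subtopology (prod_topology (gtop H) (ztop Z)) {(h, z). src H h = sanchor Z z}) (right_pairs H Z)
      (\<lambda>q. (snd q, (ginv H \<circ> fst) q))"
    unfolding right_pairs_def
    by (intro continuous_map_into_subtopology continuous_map_pairedI continuous_map_from_subtopology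
        continuous_map_snd continuous_map_compose[OF continuous_map_fst H.continuous_inv])
      (auto simp: H.rng_inv arrows_def)
  from continuous_map_compose[OF this ract_continuous]
  show "continuous_map (subtopology (prod_topology (gtop H) (ztop Z)) {(h, z). src H h = sanchor Z z}) (ztop Z)
      (\<lambda>(h, z). ract Z z (ginv H h))" by (simp add: o_def case_prod_unfold)
qed (auto simp: ract_closed sanchor_ract H.inv_closed H.rng_inv H.src_inv)

sublocale LA: left_action G "ztop Z" "ranchor Z" "lact Z" by (rule left_action_of_G)
sublocale RA: left_action H "ztop Z" "sanchor Z" "\<lambda>h z. ract Z z (ginv H h)" by (rule left_action_of_H)

lemma act_left_eq: "act_left G Z = LA.convolve"
  by (simp add: act_left_def act_conv_def fun_eq_iff)

lemma act_right_eq: "act_right G Z \<psi> a = LA.convolve (cut (arrows G) (a \<circ> ginv G)) \<psi>"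
proof -
  have "act_right G Z \<psi> a = LA.convolve (a \<circ> ginv G) \<psi>" by (simp add: act_right_def act_conv_def mult.commute)
  also have "\<dots> = LA.convolve (cut (arrows G) (a \<circ> ginv G)) \<psi>" by (rule LA.convolve_cong_left) (simp add: cut_def)
  finally show ?thesis .
qed

lemma act_left_CC: "a \<in> CC (gtop G) \<Longrightarrow> \<phi> \<in> CC (ztop Z) \<Longrightarrow> act_left G Z a \<phi> \<in> CC (ztop Z)"
  unfolding act_left_eq by (rule LA.CC_convolve)

lemma act_right_CC: "a \<in> CC (gtop G) \<Longrightarrow> \<psi> \<in> CC (ztop Z) \<Longrightarrow> act_right G Z \<psi> a \<in> CC (ztop Z)"
  unfolding act_right_eq by (rule LA.CC_convolve[OF G.CC_inv])

lemma is_lp_E: "is_lp p (arrows H) E" by (rule H.is_lp_EH[OF p])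

lemma is_lp_F: "is_lp p X F"
proof -
  have "(\<Union>v\<in>units H. zfibre Z v) = X" using RA.anc_unit by (auto simp: zfibre_def)
  then show ?thesis using is_lp_lp_sum[OF p, of "units H" "zfibre Z"] by (auto simp: EZ_def zfibre_def)
qed

text \<open>The matrix of \<open>Top\<close>, and up to transposition that of \<open>Sop\<close>, extended by zero to all pairs.\<close>

definition orbit_kernel :: "('z \<Rightarrow> complex) \<Rightarrow> 'z \<Rightarrow> 'h \<Rightarrow> complex" where
  "orbit_kernel \<phi> z h = (if src H h = sanchor Z z then \<phi> (ract Z z (ginv H h)) else 0)"

text \<open>Let \<open>K\<close> be compact with \<open>\<phi> = 0\<close> off \<open>K\<close>. In the column of \<open>h\<close> the points \<open>z h\<^sup>-\<^sup>1\<close> lie in \<open>K\<close> and in one fibre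
of the local homeomorphism \<open>s\<close>. In the row of \<open>z\<close> fix one admissible \<open>h\<^sub>0\<close> and put \<open>z\<^sub>0 = z h\<^sub>0\<^sup>-\<^sup>1\<close>; then
\<open>h\<^sub>0 h\<^sup>-\<^sup>1\<close> moves the point \<open>z\<^sub>0\<close> of \<open>K\<close> to another point of \<open>K\<close>. By properness such arrows
lie in a compact set \<open>L\<close>, and they share the range of \<open>h\<^sub>0\<close>.\<close>

lemma orbit_kernel_bounded:
  assumes "\<phi> \<in> CC (ztop Z)"
  obtains N M where "1 \<le> N" "0 \<le> M" "bounded_kernel X (arrows H) (orbit_kernel \<phi>) N M"
    "bounded_kernel (arrows H) X (\<lambda>h z. orbit_kernel \<phi> z h) N M"
proof -
  obtain K M where K: "compactin (ztop Z) K" "\<And>x. x \<notin> K \<Longrightarrow> \<phi> x = 0" "0 \<le> M" "\<And>x. cmod (\<phi> x) \<le> M"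
    by (rule CC_support[OF assms]) blast
  obtain N1 where N1: "\<And>y. finite {x \<in> K. sanchor Z x = y}" "\<And>y. card {x \<in> K. sanchor Z x = y} \<le> N1"
    by (rule local_homeo_fibre_card[OF sanchor_local_homeo K(1)]) blast
  \<comment> \<open>the pairs \<open>(z, k)\<close> with both \<open>z\<close> and \<open>z k\<close> in \<open>K\<close>\<close>
  let ?Q = "{q \<in> topspace (right_pairs H Z). (\<lambda>(z, h). (ract Z z h, z)) q \<in> K \<times> K}"
  define L where "L = snd ` ?Q"
  have "compactin (right_pairs H Z) ?Q"
    by (rule compactin_proper_map_preimage[OF ract_proper[unfolded right_action_proper_def]])
      (use K in \<open>simp add: compactin_Times\<close>)
  then have cL: "compactin (gtop H) L"
    unfolding L_def by (rule image_compactin)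
      (simp add: right_pairs_def continuous_map_from_subtopology continuous_map_snd)
  obtain N2 where N2: "\<And>y. finite {x \<in> L. rng H x = y}" "\<And>y. card {x \<in> L. rng H x = y} \<le> N2"
    by (rule local_homeo_fibre_card[OF H.etale_rng cL]) blast
  let ?N = "max 1 (max N1 N2)"
  have KX: "K \<subseteq> X" by (rule compactin_subset_topspace[OF K(1)])
  have row: "finite {h \<in> arrows H. orbit_kernel \<phi> z h \<noteq> 0} \<and> card {h \<in> arrows H. orbit_kernel \<phi> z h \<noteq> 0} \<le> ?N" if z: "z \<in> X" for z
  proof (cases "{h \<in> arrows H. orbit_kernel \<phi> z h \<noteq> 0} = {}")
    case False
    have D: "h \<in> arrows H \<and> src H h = sanchor Z z \<and> ract Z z (ginv H h) \<in> K" if "h \<in> {h \<in> arrows H. orbit_kernel \<phi> z h \<noteq> 0}" for h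
      using that K(2) by (auto simp: orbit_kernel_def split: if_splits)
    obtain h0 where h0: "h0 \<in> {h \<in> arrows H. orbit_kernel \<phi> z h \<noteq> 0}" using False by blast
    note D0 = D[OF h0]
    let ?j = "\<lambda>h. gmult H h0 (ginv H h)"
    have inj: "inj_on ?j {h \<in> arrows H. orbit_kernel \<phi> z h \<noteq> 0}"
    proof (rule inj_onI)
      fix h k assume a: "h \<in> {h \<in> arrows H. orbit_kernel \<phi> z h \<noteq> 0}" "k \<in> {h \<in> arrows H. orbit_kernel \<phi> z h \<noteq> 0}" "?j h = ?j k"
      have 1: "gmult H (ginv H h0) (?j h) = ginv H h" and 2: "gmult H (ginv H h0) (?j k) = ginv H k"
        using D0 D[OF a(1)] D[OF a(2)] by (auto intro!: H.inv_mult_cancel simp: H.inv_closed H.rng_inv)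
      have "ginv H h = ginv H k"
        by (rule trans[OF 1[symmetric] trans[OF arg_cong[OF a(3), of "gmult H (ginv H h0)"] 2]])
      then show "h = k" using D[OF a(1)] D[OF a(2)] H.inv_inv by metis
    qed
    have sub: "?j ` {h \<in> arrows H. orbit_kernel \<phi> z h \<noteq> 0} \<subseteq> {x \<in> L. rng H x = rng H h0}"
    proof
      fix x assume "x \<in> ?j ` {h \<in> arrows H. orbit_kernel \<phi> z h \<noteq> 0}"
      then obtain h where h: "h \<in> {h \<in> arrows H. orbit_kernel \<phi> z h \<noteq> 0}" "x = ?j h" by blast
      note Dh = D[OF h(1)]
      let ?z0 = "ract Z z (ginv H h0)"
      have x: "x \<in> arrows H" "rng H x = rng H h0"
        using D0 Dh by (auto simp: h(2) H.mult_closed H.inv_closed H.rng_inv H.rng_mult)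
      have s0: "sanchor Z ?z0 = rng H h0" using D0 z by (simp add: sanchor_ract H.inv_closed H.rng_inv H.src_inv)
      have "ract Z ?z0 x = ract Z (ract Z ?z0 h0) (ginv H h)"
        unfolding h(2) using D0 Dh KX s0 by (intro ract_mult) (auto simp: H.inv_closed H.rng_inv)
      also have "ract Z ?z0 h0 = ract Z z (gmult H (ginv H h0) h0)"
        using D0 z by (intro ract_mult[symmetric]) (auto simp: H.inv_closed H.rng_inv H.src_inv)
      also have "\<dots> = z" using D0 z by (simp add: H.inv_left ract_unit)
      finally have "(?z0, x) \<in> ?Q"
        using x s0 D0 Dh KX by (auto simp: right_pairs_def arrows_def)
      then show "x \<in> {x \<in> L. rng H x = rng H h0}" unfolding L_def using x by force
    qed
    show ?thesis using inj_on_finite[OF inj sub N2(1)] card_inj_on_le[OF inj sub N2(1)] N2(2)[of "rng H h0"] by linarith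
  next
    case True then show ?thesis unfolding True by simp
  qed
  have col: "finite {z \<in> X. orbit_kernel \<phi> z h \<noteq> 0} \<and> card {z \<in> X. orbit_kernel \<phi> z h \<noteq> 0} \<le> ?N" if h: "h \<in> arrows H" for h
  proof -
    let ?j = "\<lambda>z. ract Z z (ginv H h)"
    have D: "z \<in> X \<and> src H h = sanchor Z z \<and> ?j z \<in> K" if "z \<in> {z \<in> X. orbit_kernel \<phi> z h \<noteq> 0}" for z
      using that K(2) by (auto simp: orbit_kernel_def split: if_splits)
    have inj: "inj_on ?j {z \<in> X. orbit_kernel \<phi> z h \<noteq> 0}"
    proof (rule inj_onI)
      fix y z assume a: "y \<in> {z \<in> X. orbit_kernel \<phi> z h \<noteq> 0}" "z \<in> {z \<in> X. orbit_kernel \<phi> z h \<noteq> 0}" "?j y = ?j z"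
      have "ract Z (?j w) h = w" if "w \<in> {z \<in> X. orbit_kernel \<phi> z h \<noteq> 0}" for w
      proof -
        have "ract Z (?j w) h = ract Z w (gmult H (ginv H h) h)"
          using D[OF that] h by (intro ract_mult[symmetric]) (auto simp: H.inv_closed H.rng_inv H.src_inv)
        then show ?thesis using D[OF that] h by (simp add: H.inv_left ract_unit)
      qed
      then show "y = z" using a by metis
    qed
    have sub: "?j ` {z \<in> X. orbit_kernel \<phi> z h \<noteq> 0} \<subseteq> {x \<in> K. sanchor Z x = rng H h}"
      using D h by (auto simp: sanchor_ract H.inv_closed H.rng_inv H.src_inv)
    show ?thesis using inj_on_finite[OF inj sub N1(1)] card_inj_on_le[OF inj sub N1(1)] N1(2)[of "rng H h"] by linarith
  qed
  have "cmod (orbit_kernel \<phi> z h) \<le> M" for z h using K(3,4) by (simp add: orbit_kernel_def)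
  then show ?thesis using row col K(3) by (intro that[of ?N M]) (auto simp: bounded_kernel_def)
qed

lemma orbit_kernel_finite:
  assumes "\<phi> \<in> CC (ztop Z)"
  shows "z \<in> X \<Longrightarrow> finite {h \<in> arrows H. orbit_kernel \<phi> z h \<noteq> 0}" "h \<in> arrows H \<Longrightarrow> finite {z \<in> X. orbit_kernel \<phi> z h \<noteq> 0}"
proof -
  obtain N M where "bounded_kernel X (arrows H) (orbit_kernel \<phi>) N M" by (rule orbit_kernel_bounded[OF assms]) blast
  then show "z \<in> X \<Longrightarrow> finite {h \<in> arrows H. orbit_kernel \<phi> z h \<noteq> 0}" "h \<in> arrows H \<Longrightarrow> finite {z \<in> X. orbit_kernel \<phi> z h \<noteq> 0}"
    by (auto simp: bounded_kernel_def)
qed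

lemma orbit_kernel_finite_fibre:
  assumes "\<phi> \<in> CC (ztop Z)"
  shows "z \<in> X \<Longrightarrow> finite {h \<in> src_fibre H (sanchor Z z). \<phi> (ract Z z (ginv H h)) \<noteq> 0}"
    "h \<in> arrows H \<Longrightarrow> finite {z \<in> zfibre Z (src H h). \<phi> (ract Z z (ginv H h)) \<noteq> 0}"
  by (rule finite_subset[OF _ orbit_kernel_finite(1)[OF assms]]; auto simp: orbit_kernel_def src_fibre_def)
    (rule finite_subset[OF _ orbit_kernel_finite(2)[OF assms]]; auto simp: orbit_kernel_def zfibre_def)

lemma Top_orbit_kernel: "Top p H Z \<phi> = (\<lambda>\<xi>\<in>carr E. cut X (\<lambda>z. \<Sum>\<^sub>\<infinity>h\<in>arrows H. orbit_kernel \<phi> z h * \<xi> h))"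
  unfolding Top_def
proof (intro restrict_ext ext)
  fix \<xi> z
  have "(\<Sum>\<^sub>\<infinity>h\<in>src_fibre H (sanchor Z z). \<phi> (ract Z z (ginv H h)) * \<xi> h) = (\<Sum>\<^sub>\<infinity>h\<in>arrows H. orbit_kernel \<phi> z h * \<xi> h)"
    by (rule infsum_cong_neutral) (auto simp: src_fibre_def orbit_kernel_def)
  then show "cut X (\<lambda>z. \<Sum>\<^sub>\<infinity>h\<in>src_fibre H (sanchor Z z). \<phi> (ract Z z (ginv H h)) * \<xi> h) z =
      cut X (\<lambda>z. \<Sum>\<^sub>\<infinity>h\<in>arrows H. orbit_kernel \<phi> z h * \<xi> h) z" by (simp add: cut_def)
qed

lemma Sop_orbit_kernel: "Sop p H Z \<psi> = (\<lambda>\<zeta>\<in>carr F. cut (arrows H) (\<lambda>h. \<Sum>\<^sub>\<infinity>z\<in>X. orbit_kernel \<psi> z h * \<zeta> z))"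
  unfolding Sop_def
proof (intro restrict_ext ext)
  fix \<zeta> h
  have "(\<Sum>\<^sub>\<infinity>z\<in>zfibre Z (src H h). \<psi> (ract Z z (ginv H h)) * \<zeta> z) = (\<Sum>\<^sub>\<infinity>z\<in>X. orbit_kernel \<psi> z h * \<zeta> z)"
    by (rule infsum_cong_neutral) (auto simp: zfibre_def orbit_kernel_def)
  then show "cut (arrows H) (\<lambda>h. \<Sum>\<^sub>\<infinity>z\<in>zfibre Z (src H h). \<psi> (ract Z z (ginv H h)) * \<zeta> z) h =
      cut (arrows H) (\<lambda>h. \<Sum>\<^sub>\<infinity>z\<in>X. orbit_kernel \<psi> z h * \<zeta> z) h" by (simp add: cut_def)
qed

lemma Top_closed: "\<phi> \<in> CC (ztop Z) \<Longrightarrow> Top p H Z \<phi> \<in> carr (bops E F)"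
proof -
  assume "\<phi> \<in> CC (ztop Z)"
  then obtain N M where "1 \<le> N" "0 \<le> M" "bounded_kernel X (arrows H) (orbit_kernel \<phi>) N M"
    by (rule orbit_kernel_bounded) blast
  then show ?thesis unfolding Top_orbit_kernel by (intro kernel_bops(1)[OF is_lp_E is_lp_F p])
qed

lemma Sop_closed: "\<psi> \<in> CC (ztop Z) \<Longrightarrow> Sop p H Z \<psi> \<in> carr (bops F E)"
proof -
  assume "\<psi> \<in> CC (ztop Z)"
  then obtain N M where "1 \<le> N" "0 \<le> M" "bounded_kernel (arrows H) X (\<lambda>h z. orbit_kernel \<psi> z h) N M"
    by (rule orbit_kernel_bounded) blast
  then show ?thesis unfolding Sop_orbit_kernel by (intro kernel_bops(1)[OF is_lp_F is_lp_E p])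
qed

lemma orbit_kernel_infsum:
  assumes "\<phi> \<in> CC (ztop Z)" "\<psi> \<in> CC (ztop Z)"
  shows "z \<in> X \<Longrightarrow> (\<Sum>\<^sub>\<infinity>h\<in>arrows H. orbit_kernel (\<lambda>x. \<phi> x + \<psi> x) z h * \<xi> h)
      = (\<Sum>\<^sub>\<infinity>h\<in>arrows H. orbit_kernel \<phi> z h * \<xi> h) + (\<Sum>\<^sub>\<infinity>h\<in>arrows H. orbit_kernel \<psi> z h * \<xi> h)"
    and "h \<in> arrows H \<Longrightarrow> (\<Sum>\<^sub>\<infinity>z\<in>X. orbit_kernel (\<lambda>x. \<phi> x + \<psi> x) z h * \<zeta> z)
      = (\<Sum>\<^sub>\<infinity>z\<in>X. orbit_kernel \<phi> z h * \<zeta> z) + (\<Sum>\<^sub>\<infinity>z\<in>X. orbit_kernel \<psi> z h * \<zeta> z)"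
proof -
  have e: "orbit_kernel (\<lambda>x. \<phi> x + \<psi> x) z h = orbit_kernel \<phi> z h + orbit_kernel \<psi> z h" for z h by (simp add: orbit_kernel_def)
  show "(\<Sum>\<^sub>\<infinity>h\<in>arrows H. orbit_kernel (\<lambda>x. \<phi> x + \<psi> x) z h * \<xi> h)
      = (\<Sum>\<^sub>\<infinity>h\<in>arrows H. orbit_kernel \<phi> z h * \<xi> h) + (\<Sum>\<^sub>\<infinity>h\<in>arrows H. orbit_kernel \<psi> z h * \<xi> h)" if z: "z \<in> X"
    unfolding e distrib_right
    by (intro infsum_add finite_nonzero_values_imp_summable_on)
      (rule finite_subset[OF _ orbit_kernel_finite(1)[OF assms(1) z]] finite_subset[OF _ orbit_kernel_finite(1)[OF assms(2) z]]; auto)+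
  show "(\<Sum>\<^sub>\<infinity>z\<in>X. orbit_kernel (\<lambda>x. \<phi> x + \<psi> x) z h * \<zeta> z)
      = (\<Sum>\<^sub>\<infinity>z\<in>X. orbit_kernel \<phi> z h * \<zeta> z) + (\<Sum>\<^sub>\<infinity>z\<in>X. orbit_kernel \<psi> z h * \<zeta> z)" if h: "h \<in> arrows H"
    unfolding e distrib_right
    by (intro infsum_add finite_nonzero_values_imp_summable_on)
      (rule finite_subset[OF _ orbit_kernel_finite(2)[OF assms(1) h]] finite_subset[OF _ orbit_kernel_finite(2)[OF assms(2) h]]; auto)+
qed

lemma Top_add:
  assumes "\<phi> \<in> CC (ztop Z)" "\<psi> \<in> CC (ztop Z)"
  shows "Top p H Z (\<lambda>x. \<phi> x + \<psi> x) = vadd (bops E F) (Top p H Z \<phi>) (Top p H Z \<psi>)"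
  unfolding Top_orbit_kernel using orbit_kernel_infsum(1)[OF assms] by (auto simp: is_lp_sel[OF is_lp_F] cut_def intro!: restrict_ext)

lemma Sop_add:
  assumes "\<phi> \<in> CC (ztop Z)" "\<psi> \<in> CC (ztop Z)"
  shows "Sop p H Z (\<lambda>x. \<phi> x + \<psi> x) = vadd (bops F E) (Sop p H Z \<phi>) (Sop p H Z \<psi>)"
  unfolding Sop_orbit_kernel using orbit_kernel_infsum(2)[OF assms] by (auto simp: is_lp_sel[OF is_lp_E] cut_def intro!: restrict_ext)

lemma orbit_kernel_scale: "orbit_kernel (\<lambda>x. c * \<phi> x) z h = c * orbit_kernel \<phi> z h"
  by (simp add: orbit_kernel_def)

lemma Top_scale: "Top p H Z (\<lambda>x. c * \<phi> x) = vscale (bops E F) c (Top p H Z \<phi>)"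
  unfolding Top_orbit_kernel orbit_kernel_scale by (auto simp: is_lp_sel[OF is_lp_F] cut_def mult.assoc infsum_cmult_right' intro!: restrict_ext)

lemma Sop_scale: "Sop p H Z (\<lambda>x. c * \<phi> x) = vscale (bops F E) c (Sop p H Z \<phi>)"
  unfolding Sop_orbit_kernel orbit_kernel_scale by (auto simp: is_lp_sel[OF is_lp_E] cut_def mult.assoc infsum_cmult_right' intro!: restrict_ext)

end

section \<open>The extended action\<close>

context correspondence_setting
begin

lemma Top_apply:
  "\<xi> \<in> carr E \<Longrightarrow> z \<in> X \<Longrightarrow> Top p H Z \<phi> \<xi> z = (\<Sum>\<^sub>\<infinity>h\<in>src_fibre H (sanchor Z z). \<phi> (ract Z z (ginv H h)) * \<xi> h)"
  by (simp add: Top_def cut_def)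

lemma Top_outside: "\<xi> \<in> carr E \<Longrightarrow> z \<notin> X \<Longrightarrow> Top p H Z \<phi> \<xi> z = 0"
  by (simp add: Top_def cut_def)

lemma Sop_apply:
  "\<zeta> \<in> carr F \<Longrightarrow> h \<in> arrows H \<Longrightarrow> Sop p H Z \<psi> \<zeta> h = (\<Sum>\<^sub>\<infinity>z\<in>zfibre Z (src H h). \<psi> (ract Z z (ginv H h)) * \<zeta> z)"
  by (simp add: Sop_def cut_def)

lemma Sop_outside: "\<zeta> \<in> carr F \<Longrightarrow> h \<notin> arrows H \<Longrightarrow> Sop p H Z \<psi> \<zeta> h = 0"
  by (simp add: Sop_def cut_def)

text \<open>The two actions commute, so this is an exchange of two finite sums.\<close>

lemma convolve_Top:
  assumes a: "a \<in> CC (gtop G)" and \<phi>: "\<phi> \<in> CC (ztop Z)" and \<xi>: "\<xi> \<in> carr E"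
  shows "LA.convolve a (Top p H Z \<phi> \<xi>) = Top p H Z (act_left G Z a \<phi>) \<xi>"
proof
  fix z show "LA.convolve a (Top p H Z \<phi> \<xi>) z = Top p H Z (act_left G Z a \<phi>) \<xi> z"
  proof (cases "z \<in> X")
    case z: True
    let ?R = "rng_fibre G (ranchor Z z)" and ?S = "src_fibre H (sanchor Z z)"
    let ?f = "\<lambda>\<gamma> h. a \<gamma> * \<phi> (ract Z (lact Z (ginv G \<gamma>) z) (ginv H h)) * \<xi> h"
    have g: "lact Z (ginv G \<gamma>) z \<in> X" "sanchor Z (lact Z (ginv G \<gamma>) z) = sanchor Z z" if "\<gamma> \<in> ?R" for \<gamma>
      using that z LA.inv_act_closed[OF z that] by (auto simp: rng_fibre_def sanchor_lact G.inv_closed G.src_inv)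
    have "finite {(\<gamma>, h) \<in> ?R \<times> ?S. ?f \<gamma> h \<noteq> 0}"
    proof (rule finite_subset)
      show "{(\<gamma>, h) \<in> ?R \<times> ?S. ?f \<gamma> h \<noteq> 0} \<subseteq> Sigma {\<gamma> \<in> ?R. a \<gamma> \<noteq> 0}
          (\<lambda>\<gamma>. {h \<in> src_fibre H (sanchor Z (lact Z (ginv G \<gamma>) z)). \<phi> (ract Z (lact Z (ginv G \<gamma>) z) (ginv H h)) \<noteq> 0})"
        using g by auto
      show "finite (Sigma {\<gamma> \<in> ?R. a \<gamma> \<noteq> 0}
          (\<lambda>\<gamma>. {h \<in> src_fibre H (sanchor Z (lact Z (ginv G \<gamma>) z)). \<phi> (ract Z (lact Z (ginv G \<gamma>) z) (ginv H h)) \<noteq> 0}))"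
        using G.finite_rng_support[OF a] g(1) by (intro finite_SigmaI orbit_kernel_finite_fibre(1)[OF \<phi>]) auto
    qed
    note swap = infsum_swap_finite[OF this]
    have "LA.convolve a (Top p H Z \<phi> \<xi>) z = (\<Sum>\<^sub>\<infinity>\<gamma>\<in>?R. a \<gamma> * Top p H Z \<phi> \<xi> (lact Z (ginv G \<gamma>) z))"
      using z by (simp add: act_conv_def cut_def)
    also have "\<dots> = (\<Sum>\<^sub>\<infinity>\<gamma>\<in>?R. \<Sum>\<^sub>\<infinity>h\<in>?S. ?f \<gamma> h)"
      using g \<xi> by (intro infsum_cong) (simp add: Top_apply infsum_cmult_right'[symmetric] mult.assoc)
    also have "\<dots> = (\<Sum>\<^sub>\<infinity>h\<in>?S. \<Sum>\<^sub>\<infinity>\<gamma>\<in>?R. ?f \<gamma> h)" by (rule swap)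
    also have "\<dots> = (\<Sum>\<^sub>\<infinity>h\<in>?S. act_left G Z a \<phi> (ract Z z (ginv H h)) * \<xi> h)"
    proof (rule infsum_cong)
      fix h assume "h \<in> ?S"
      then have h: "ginv H h \<in> arrows H" "sanchor Z z = rng H (ginv H h)" by (auto simp: src_fibre_def H.inv_closed H.rng_inv)
      have zh: "ract Z z (ginv H h) \<in> X" "ranchor Z (ract Z z (ginv H h)) = ranchor Z z"
        using z h by (auto simp: ract_closed ranchor_ract)
      have "lact Z (ginv G \<gamma>) (ract Z z (ginv H h)) = ract Z (lact Z (ginv G \<gamma>) z) (ginv H h)" if "\<gamma> \<in> ?R" for \<gamma>
        using that z h by (intro actions_commute[symmetric]) (auto simp: rng_fibre_def G.inv_closed G.src_inv)
      then have "act_left G Z a \<phi> (ract Z z (ginv H h)) = (\<Sum>\<^sub>\<infinity>\<gamma>\<in>?R. a \<gamma> * \<phi> (ract Z (lact Z (ginv G \<gamma>) z) (ginv H h)))"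
        using zh by (auto simp: act_left_def cut_def intro!: infsum_cong)
      then show "(\<Sum>\<^sub>\<infinity>\<gamma>\<in>?R. ?f \<gamma> h) = act_left G Z a \<phi> (ract Z z (ginv H h)) * \<xi> h"
        by (simp add: infsum_cmult_left')
    qed
    also have "\<dots> = Top p H Z (act_left G Z a \<phi>) \<xi> z" by (rule Top_apply[OF \<xi> z, symmetric])
    finally show ?thesis .
  qed (simp add: Top_outside \<xi> LA.convolve_outside)
qed

text \<open>The row of \<open>h\<close> of \<open>S\<^sub>\<psi>\<close> is a finitely supported function on a fibre of \<open>s\<close>, which is invariant under \<open>G\<close>, and
\<open>\<Pi>(a)\<close> is moved over to it.\<close>

lemma Sop_convolve:
  assumes a: "a \<in> CC (gtop G)" and \<psi>: "\<psi> \<in> CC (ztop Z)" and \<zeta>: "\<zeta> \<in> carr F" "LA.convolve a \<zeta> \<in> carr F"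
  shows "Sop p H Z \<psi> (LA.convolve a \<zeta>) = Sop p H Z (act_right G Z \<psi> a) \<zeta>"
proof
  fix h show "Sop p H Z \<psi> (LA.convolve a \<zeta>) h = Sop p H Z (act_right G Z \<psi> a) \<zeta> h"
  proof (cases "h \<in> arrows H")
    case h: True
    let ?Y = "zfibre Z (src H h)" and ?c = "\<lambda>z. \<psi> (ract Z z (ginv H h))"
    have "Sop p H Z \<psi> (LA.convolve a \<zeta>) h = (\<Sum>\<^sub>\<infinity>z\<in>?Y. ?c z * LA.convolve a \<zeta> z)" by (rule Sop_apply[OF \<zeta>(2) h])
    also have "\<dots> = (\<Sum>\<^sub>\<infinity>w\<in>?Y. LA.convolve (\<lambda>\<gamma>. a (ginv G \<gamma>)) ?c w * \<zeta> w)"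
    proof (rule LA.convolve_adjoint[OF a])
      show "finite {z \<in> ?Y. ?c z \<noteq> 0}" by (rule orbit_kernel_finite_fibre(2)[OF \<psi> h])
    qed (auto simp: zfibre_def lact_closed sanchor_lact)
    also have "\<dots> = (\<Sum>\<^sub>\<infinity>w\<in>?Y. act_right G Z \<psi> a (ract Z w (ginv H h)) * \<zeta> w)"
    proof (rule infsum_cong)
      fix w assume "w \<in> ?Y"
      then have w: "w \<in> X" "sanchor Z w = rng H (ginv H h)" using h by (auto simp: zfibre_def H.rng_inv)
      have h': "ginv H h \<in> arrows H" using h by (rule H.inv_closed)
      have wh: "ract Z w (ginv H h) \<in> X" "ranchor Z (ract Z w (ginv H h)) = ranchor Z w"
        using w h' by (auto simp: ract_closed ranchor_ract)
      have "lact Z (ginv G \<gamma>) (ract Z w (ginv H h)) = ract Z (lact Z (ginv G \<gamma>) w) (ginv H h)"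
        if "\<gamma> \<in> rng_fibre G (ranchor Z w)" for \<gamma>
        using that w h' by (intro actions_commute[symmetric]) (auto simp: rng_fibre_def G.inv_closed G.src_inv)
      then have "act_right G Z \<psi> a (ract Z w (ginv H h)) = LA.convolve (\<lambda>\<gamma>. a (ginv G \<gamma>)) ?c w"
        using wh w by (auto simp: act_right_def act_conv_def cut_def mult.commute intro!: infsum_cong)
      then show "LA.convolve (\<lambda>\<gamma>. a (ginv G \<gamma>)) ?c w * \<zeta> w = act_right G Z \<psi> a (ract Z w (ginv H h)) * \<zeta> w" by simp
    qed
    also have "\<dots> = Sop p H Z (act_right G Z \<psi> a) \<zeta> h" by (rule Sop_apply[OF \<zeta>(1) h, symmetric])
    finally show ?thesis .
  qed (simp add: Sop_outside \<zeta>)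
qed

text \<open>The row of \<open>z\<close> of \<open>T\<^sub>\<phi>\<close> is a finitely supported function on a source fibre of \<open>H\<close>, and the regular
representation is moved over to it. The resulting symbol is the convolution of \<open>\<phi>\<close> by \<open>f\<close> composed with
inversion.\<close>

lemma Top_conv:
  assumes f: "f \<in> CC (gtop H)" and \<phi>: "\<phi> \<in> CC (ztop Z)" and \<xi>: "\<xi> \<in> carr E" "H.S.convolve f \<xi> \<in> carr E"
  shows "Top p H Z \<phi> (H.S.convolve f \<xi>) = Top p H Z (RA.convolve (cut (arrows H) (f \<circ> ginv H)) \<phi>) \<xi>"
proof
  fix z show "Top p H Z \<phi> (H.S.convolve f \<xi>) z = Top p H Z (RA.convolve (cut (arrows H) (f \<circ> ginv H)) \<phi>) \<xi> z"
  proof (cases "z \<in> X")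
    case z: True
    let ?Y = "src_fibre H (sanchor Z z)" and ?c = "\<lambda>h. \<phi> (ract Z z (ginv H h))"
    have "Top p H Z \<phi> (H.S.convolve f \<xi>) z = (\<Sum>\<^sub>\<infinity>h\<in>?Y. ?c h * H.S.convolve f \<xi> h)" by (rule Top_apply[OF \<xi>(2) z])
    also have "\<dots> = (\<Sum>\<^sub>\<infinity>k\<in>?Y. H.S.convolve (\<lambda>h. f (ginv H h)) ?c k * \<xi> k)"
    proof (rule H.S.convolve_adjoint[OF f])
      show "finite {h \<in> ?Y. ?c h \<noteq> 0}" by (rule orbit_kernel_finite_fibre(1)[OF \<phi> z])
    qed (auto simp: src_fibre_def arrows_def[symmetric] H.mult_closed H.src_mult)
    also have "\<dots> = (\<Sum>\<^sub>\<infinity>k\<in>?Y. RA.convolve (cut (arrows H) (f \<circ> ginv H)) \<phi> (ract Z z (ginv H k)) * \<xi> k)"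
    proof (rule infsum_cong)
      fix k assume "k \<in> ?Y"
      then have k: "k \<in> arrows H" "src H k = sanchor Z z" by (auto simp: src_fibre_def)
      have zk: "ract Z z (ginv H k) \<in> X" "sanchor Z (ract Z z (ginv H k)) = rng H k"
        using z k by (auto simp: ract_closed sanchor_ract H.inv_closed H.rng_inv H.src_inv)
      have eq: "ract Z z (ginv H (gmult H (ginv H \<eta>) k)) = ract Z (ract Z z (ginv H k)) (ginv H (ginv H \<eta>))"
        if "\<eta> \<in> rng_fibre H (rng H k)" for \<eta>
        using that z k by (simp add: rng_fibre_def H.inv_mult H.inv_closed H.src_inv H.inv_inv H.rng_inv ract_mult)
      have "RA.convolve (cut (arrows H) (f \<circ> ginv H)) \<phi> (ract Z z (ginv H k)) = RA.convolve (\<lambda>h. f (ginv H h)) \<phi> (ract Z z (ginv H k))"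
        by (rule arg_cong[where f = "\<lambda>F. F _"], rule RA.convolve_cong_left) (simp add: cut_def)
      also have "\<dots> = H.S.convolve (\<lambda>h. f (ginv H h)) ?c k"
        using zk k by (auto simp: act_conv_def cut_def eq arrows_def[symmetric] intro!: infsum_cong)
      finally show "H.S.convolve (\<lambda>h. f (ginv H h)) ?c k * \<xi> k
         = RA.convolve (cut (arrows H) (f \<circ> ginv H)) \<phi> (ract Z z (ginv H k)) * \<xi> k" by simp
    qed
    also have "\<dots> = Top p H Z (RA.convolve (cut (arrows H) (f \<circ> ginv H)) \<phi>) \<xi> z" by (rule Top_apply[OF \<xi>(1) z, symmetric])
    finally show ?thesis .
  qed (simp add: Top_outside \<xi>)
qed

text \<open>Since \<open>(\<eta>\<^sup>-\<^sup>1 h)\<^sup>-\<^sup>1 = h\<^sup>-\<^sup>1 \<eta>\<close>, translating the variable of \<open>S\<^sub>\<psi>\<close> amounts to translating its symbol.\<close>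

lemma conv_Sop:
  assumes f: "f \<in> CC (gtop H)" and \<psi>: "\<psi> \<in> CC (ztop Z)" and \<zeta>: "\<zeta> \<in> carr F"
  shows "H.S.convolve f (Sop p H Z \<psi> \<zeta>) = Sop p H Z (RA.convolve f \<psi>) \<zeta>"
proof
  fix h show "H.S.convolve f (Sop p H Z \<psi> \<zeta>) h = Sop p H Z (RA.convolve f \<psi>) \<zeta> h"
  proof (cases "h \<in> arrows H")
    case h: True
    let ?R = "rng_fibre H (rng H h)" and ?Y = "zfibre Z (src H h)"
    let ?f = "\<lambda>\<eta> z. f \<eta> * \<psi> (ract Z z (ginv H (gmult H (ginv H \<eta>) h))) * \<zeta> z"
    have g: "gmult H (ginv H \<eta>) h \<in> arrows H" "src H (gmult H (ginv H \<eta>) h) = src H h" if "\<eta> \<in> ?R" for \<eta>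
      using that h by (auto simp: rng_fibre_def H.mult_closed H.inv_closed H.src_inv H.src_mult)
    have "finite {(\<eta>, z) \<in> ?R \<times> ?Y. ?f \<eta> z \<noteq> 0}"
    proof (rule finite_subset)
      show "{(\<eta>, z) \<in> ?R \<times> ?Y. ?f \<eta> z \<noteq> 0} \<subseteq> Sigma {\<eta> \<in> ?R. f \<eta> \<noteq> 0}
          (\<lambda>\<eta>. {z \<in> zfibre Z (src H (gmult H (ginv H \<eta>) h)). \<psi> (ract Z z (ginv H (gmult H (ginv H \<eta>) h))) \<noteq> 0})"
        using g by auto
      show "finite (Sigma {\<eta> \<in> ?R. f \<eta> \<noteq> 0}
          (\<lambda>\<eta>. {z \<in> zfibre Z (src H (gmult H (ginv H \<eta>) h)). \<psi> (ract Z z (ginv H (gmult H (ginv H \<eta>) h))) \<noteq> 0}))"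
        using H.finite_rng_support[OF f] g(1) by (intro finite_SigmaI orbit_kernel_finite_fibre(2)[OF \<psi>]) auto
    qed
    note swap = infsum_swap_finite[OF this]
    have "H.S.convolve f (Sop p H Z \<psi> \<zeta>) h = (\<Sum>\<^sub>\<infinity>\<eta>\<in>?R. f \<eta> * Sop p H Z \<psi> \<zeta> (gmult H (ginv H \<eta>) h))"
      using h by (simp add: act_conv_def cut_def arrows_def[symmetric])
    also have "\<dots> = (\<Sum>\<^sub>\<infinity>\<eta>\<in>?R. \<Sum>\<^sub>\<infinity>z\<in>?Y. ?f \<eta> z)"
      using g \<zeta> by (intro infsum_cong) (simp add: Sop_apply infsum_cmult_right'[symmetric] mult.assoc)
    also have "\<dots> = (\<Sum>\<^sub>\<infinity>z\<in>?Y. \<Sum>\<^sub>\<infinity>\<eta>\<in>?R. ?f \<eta> z)" by (rule swap)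
    also have "\<dots> = (\<Sum>\<^sub>\<infinity>z\<in>?Y. RA.convolve f \<psi> (ract Z z (ginv H h)) * \<zeta> z)"
    proof (rule infsum_cong)
      fix z assume "z \<in> ?Y"
      then have z: "z \<in> X" "sanchor Z z = src H h" by (auto simp: zfibre_def)
      have zh: "ract Z z (ginv H h) \<in> X" "sanchor Z (ract Z z (ginv H h)) = rng H h"
        using z h by (auto simp: ract_closed sanchor_ract H.inv_closed H.rng_inv H.src_inv)
      have eq: "ract Z z (ginv H (gmult H (ginv H \<eta>) h)) = ract Z (ract Z z (ginv H h)) (ginv H (ginv H \<eta>))"
        if "\<eta> \<in> ?R" for \<eta>
        using that z h by (simp add: rng_fibre_def H.inv_mult H.inv_closed H.src_inv H.inv_inv H.rng_inv ract_mult)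
      have "RA.convolve f \<psi> (ract Z z (ginv H h)) = (\<Sum>\<^sub>\<infinity>\<eta>\<in>?R. f \<eta> * \<psi> (ract Z z (ginv H (gmult H (ginv H \<eta>) h))))"
        using zh by (auto simp: act_conv_def cut_def eq intro!: infsum_cong)
      then show "(\<Sum>\<^sub>\<infinity>\<eta>\<in>?R. ?f \<eta> z) = RA.convolve f \<psi> (ract Z z (ginv H h)) * \<zeta> z"
        by (simp add: infsum_cmult_left')
    qed
    also have "\<dots> = Sop p H Z (RA.convolve f \<psi>) \<zeta> h" by (rule Sop_apply[OF \<zeta> h, symmetric])
    finally show ?thesis .
  qed (simp add: Sop_outside \<zeta> H.S.convolve_outside arrows_def[symmetric])
qed

end

text \<open>The cases in which \<open>\<Pi>\<close> is contractive; a proper action falls under the third.\<close>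

locale extendable_correspondence = correspondence_setting +
  assumes cases: "p = 1 \<or> p = \<infinity> \<or> (\<forall>w\<in>X. finite {\<gamma> \<in> arrows G. src G \<gamma> = ranchor Z w \<and> lact Z \<gamma> w = w})"
begin

lemma cnormed_E: "cnormed E" by (rule is_lp_cnormed[OF is_lp_E p])
lemma cnormed_F: "cnormed F" by (rule is_lp_cnormed[OF is_lp_F p])

sublocale E: cnormed E by (rule cnormed_E)
sublocale F: cnormed F by (rule cnormed_F)
sublocale EF: cnormed_pair E F by unfold_locales
sublocale FE: cnormed_pair F E by unfold_locales
sublocale EEF: cnormed_triple E E F by unfold_locales
sublocale EFF: cnormed_triple E F F by unfold_locales
sublocale FFE: cnormed_triple F F E by unfold_locales
sublocale FEE: cnormed_triple F E E by unfold_locales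

lemma conv_op_closed: "a \<in> CC (gtop G) \<Longrightarrow> LA.conv_op F a \<in> carr (bops F F)"
  by (rule LA.conv_op_bounded(1)[OF is_lp_F _ p cases])

lemma rep_G: "rep_extension (CC_alg p G) (EH p G) (lreg_sum p G) F (LA.conv_op F)"
proof -
  interpret A: op_normed_alg "CC_alg p G" "EH p G" "lreg_sum p G" by (rule G.op_normed_alg_CC[OF p])
  show ?thesis
  proof
    show "vcomplete F" by (rule is_lp_vcomplete[OF is_lp_F p])
    fix a assume a: "a \<in> carr (CC_alg p G)"
    then show "LA.conv_op F a \<in> carr (bops F F)" by (simp add: conv_op_closed)
    show "vnorm (bops F F) (LA.conv_op F a) \<le> vnorm (CC_alg p G) a"
      using a by (intro LA.conv_op_bounded(2)[OF is_lp_F _ p cases]) simp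
    show "LA.conv_op F (vscale (CC_alg p G) c a) = vscale (bops F F) c (LA.conv_op F a)" for c
      using LA.conv_op_scale[OF is_lp_F, of a c] a by simp
    fix b assume b: "b \<in> carr (CC_alg p G)"
    show "LA.conv_op F (vadd (CC_alg p G) a b) = vadd (bops F F) (LA.conv_op F a) (LA.conv_op F b)"
      using LA.conv_op_add[OF is_lp_F, of a b] a b by simp
    show "LA.conv_op F (amult (CC_alg p G) a b) = compose (carr F) (LA.conv_op F a) (LA.conv_op F b)"
      using LA.conv_op_mult[of a b F] a b conv_op_closed[of b] by simp
  qed
qed

lemma rep_H: "rep_extension (CC_alg p H) E (lreg_sum p H) E (lreg_sum p H)"
proof -
  interpret A: op_normed_alg "CC_alg p H" E "lreg_sum p H" by (rule H.op_normed_alg_CC[OF p])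
  show ?thesis
  proof
    show "vcomplete E" by (rule is_lp_vcomplete[OF is_lp_E p])
  qed (auto simp: A.rho0_closed A.rho0_add A.rho0_scale A.rho0_mult A.rho0_norm simp del: bops_sel CC_alg_sel)
qed

sublocale GR: rep_extension "CC_alg p G" "EH p G" "lreg_sum p G" F "LA.conv_op F" by (rule rep_G)
sublocale HR: rep_extension "CC_alg p H" E "lreg_sum p H" E "lreg_sum p H" by (rule rep_H)

lemma Fred_rep_eq: "Fred_rep p H b = HR.extension b"
  unfolding Fred_rep_def HR.extension_def vtends_def ..

abbreviation "CX \<equiv> vclosure (bops F E) (Sop p H Z ` CC (ztop Z))"
abbreviation "CY \<equiv> vclosure (bops E F) (Top p H Z ` CC (ztop Z))"

lemma subX: "Sop p H Z ` CC (ztop Z) \<subseteq> carr (bops F E)" using Sop_closed by blast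
lemma subY: "Top p H Z ` CC (ztop Z) \<subseteq> carr (bops E F)" using Top_closed by blast

lemma CX_carr: "CX \<subseteq> carr (bops F E)" by (auto simp: vclosure_def)
lemma CY_carr: "CY \<subseteq> carr (bops E F)" by (auto simp: vclosure_def)

lemma CX_ne: "CX \<noteq> {}" using FE.B.vclosure_superset[OF subX] CC_zero by blast
lemma CY_ne: "CY \<noteq> {}" using EF.B.vclosure_superset[OF subY] CC_zero by blast

lemma CX_add: "x \<in> CX \<Longrightarrow> y \<in> CX \<Longrightarrow> vadd (bops F E) x y \<in> CX"
proof (rule FE.B.vclosure_add[OF subX])
  fix x y assume "x \<in> Sop p H Z ` CC (ztop Z)" "y \<in> Sop p H Z ` CC (ztop Z)"
  then obtain \<phi> \<psi> where "\<phi> \<in> CC (ztop Z)" "\<psi> \<in> CC (ztop Z)" "x = Sop p H Z \<phi>" "y = Sop p H Z \<psi>" by blast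
  then show "vadd (bops F E) x y \<in> Sop p H Z ` CC (ztop Z)"
    using imageI[OF CC_add[of \<phi> "ztop Z" \<psi>], of "Sop p H Z"] Sop_add[of \<phi> \<psi>] by (simp del: bops_sel)
qed

lemma CY_add: "x \<in> CY \<Longrightarrow> y \<in> CY \<Longrightarrow> vadd (bops E F) x y \<in> CY"
proof (rule EF.B.vclosure_add[OF subY])
  fix x y assume "x \<in> Top p H Z ` CC (ztop Z)" "y \<in> Top p H Z ` CC (ztop Z)"
  then obtain \<phi> \<psi> where "\<phi> \<in> CC (ztop Z)" "\<psi> \<in> CC (ztop Z)" "x = Top p H Z \<phi>" "y = Top p H Z \<psi>" by blast
  then show "vadd (bops E F) x y \<in> Top p H Z ` CC (ztop Z)"
    using imageI[OF CC_add[of \<phi> "ztop Z" \<psi>], of "Top p H Z"] Top_add[of \<phi> \<psi>] by (simp del: bops_sel)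
qed

lemma CX_scale: "x \<in> CX \<Longrightarrow> vscale (bops F E) c x \<in> CX"
proof (rule FE.B.vclosure_scale[OF subX])
  fix x assume "x \<in> Sop p H Z ` CC (ztop Z)"
  then obtain \<phi> where "\<phi> \<in> CC (ztop Z)" "x = Sop p H Z \<phi>" by blast
  then show "vscale (bops F E) c x \<in> Sop p H Z ` CC (ztop Z)"
    using imageI[OF CC_scale[of \<phi> "ztop Z" c], of "Sop p H Z"] by (simp add: Sop_scale del: bops_sel)
qed

lemma CY_scale: "x \<in> CY \<Longrightarrow> vscale (bops E F) c x \<in> CY"
proof (rule EF.B.vclosure_scale[OF subY])
  fix x assume "x \<in> Top p H Z ` CC (ztop Z)"
  then obtain \<phi> where "\<phi> \<in> CC (ztop Z)" "x = Top p H Z \<phi>" by blast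
  then show "vscale (bops E F) c x \<in> Top p H Z ` CC (ztop Z)"
    using imageI[OF CC_scale[of \<phi> "ztop Z" c], of "Top p H Z"] by (simp add: Top_scale del: bops_sel)
qed

lemma conv_op_Top:
  assumes "a \<in> CC (gtop G)" "\<phi> \<in> CC (ztop Z)"
  shows "compose (carr E) (LA.conv_op F a) (Top p H Z \<phi>) = Top p H Z (act_left G Z a \<phi>)"
  by (rule bops_eqI[OF EFF.compose_closed[OF conv_op_closed[OF assms(1)] Top_closed[OF assms(2)]] Top_closed[OF act_left_CC[OF assms]]])
    (simp add: compose_def LA.conv_op_def bops_closed[OF Top_closed[OF assms(2)]] convolve_Top[OF assms])

lemma Sop_conv_op:
  assumes "a \<in> CC (gtop G)" "\<psi> \<in> CC (ztop Z)"
  shows "compose (carr F) (Sop p H Z \<psi>) (LA.conv_op F a) = Sop p H Z (act_right G Z \<psi> a)"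
proof (rule bops_eqI[OF FFE.compose_closed[OF Sop_closed[OF assms(2)] conv_op_closed[OF assms(1)]] Sop_closed[OF act_right_CC[OF assms]]])
  fix \<zeta> assume \<zeta>: "\<zeta> \<in> carr F"
  have "LA.convolve a \<zeta> \<in> carr F" using bops_closed[OF conv_op_closed[OF assms(1)] \<zeta>] \<zeta> by (simp add: LA.conv_op_def)
  then show "compose (carr F) (Sop p H Z \<psi>) (LA.conv_op F a) \<zeta> = Sop p H Z (act_right G Z \<psi> a) \<zeta>"
    using \<zeta> Sop_convolve[OF assms \<zeta>] by (simp add: compose_def LA.conv_op_def)
qed

lemma lreg_sum_apply: "\<xi> \<in> carr E \<Longrightarrow> lreg_sum p H f \<xi> = H.S.convolve f \<xi>"
  by (simp add: H.lreg_sum_eq[OF p] H.S.conv_op_def)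

lemma Top_lreg_sum:
  assumes "f \<in> CC (gtop H)" "\<phi> \<in> CC (ztop Z)"
  shows "compose (carr E) (Top p H Z \<phi>) (lreg_sum p H f) \<in> Top p H Z ` CC (ztop Z)"
proof (rule image_eqI)
  show c: "RA.convolve (cut (arrows H) (f \<circ> ginv H)) \<phi> \<in> CC (ztop Z)" by (rule RA.CC_convolve[OF H.CC_inv[OF assms(1)] assms(2)])
  note L = H.lreg_sum_closed[OF p assms(1)]
  show "compose (carr E) (Top p H Z \<phi>) (lreg_sum p H f) = Top p H Z (RA.convolve (cut (arrows H) (f \<circ> ginv H)) \<phi>)"
  proof (rule bops_eqI[OF EEF.compose_closed[OF Top_closed[OF assms(2)] L] Top_closed[OF c]])
    fix \<xi> assume \<xi>: "\<xi> \<in> carr E"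
    have "H.S.convolve f \<xi> \<in> carr E" using bops_closed[OF L \<xi>] \<xi> by (simp add: lreg_sum_apply)
    then show "compose (carr E) (Top p H Z \<phi>) (lreg_sum p H f) \<xi> = Top p H Z (RA.convolve (cut (arrows H) (f \<circ> ginv H)) \<phi>) \<xi>"
      using \<xi> Top_conv[OF assms \<xi>] by (simp add: compose_def lreg_sum_apply)
  qed
qed

lemma lreg_sum_Sop:
  assumes "f \<in> CC (gtop H)" "\<psi> \<in> CC (ztop Z)"
  shows "compose (carr F) (lreg_sum p H f) (Sop p H Z \<psi>) \<in> Sop p H Z ` CC (ztop Z)"
proof (rule image_eqI)
  show c: "RA.convolve f \<psi> \<in> CC (ztop Z)" by (rule RA.CC_convolve[OF assms])
  note L = H.lreg_sum_closed[OF p assms(1)]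
  show "compose (carr F) (lreg_sum p H f) (Sop p H Z \<psi>) = Sop p H Z (RA.convolve f \<psi>)"
    by (rule bops_eqI[OF FEE.compose_closed[OF L Sop_closed[OF assms(2)]] Sop_closed[OF c]])
      (simp add: compose_def lreg_sum_apply bops_closed[OF Sop_closed[OF assms(2)]] conv_Sop[OF assms])
qed

text \<open>The dense subspaces are related by the formulas for \<open>\<Pi>(a) T\<^sub>\<phi>\<close>, \<open>S\<^sub>\<psi> \<Pi>(a)\<close>, \<open>T\<^sub>\<phi> \<lambda>(f)\<close> and \<open>\<lambda>(f) S\<^sub>\<psi>\<close>, and
\<open>compose_vclosure\<close> passes from them to the modules and the completed algebras.\<close>

lemma CY_left: "P \<in> carr (Fred p G) \<Longrightarrow> y \<in> CY \<Longrightarrow> compose (carr E) (GR.extension P) y \<in> CY"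
  unfolding Fred_def
  by (rule EFF.compose_vclosure[OF _ subY subY _ GR.extension_in_vclosure])
    (use conv_op_closed conv_op_Top act_left_CC in auto)

lemma CX_right: "P \<in> carr (Fred p G) \<Longrightarrow> x \<in> CX \<Longrightarrow> compose (carr F) x (GR.extension P) \<in> CX"
  unfolding Fred_def
  by (rule FFE.compose_vclosure[OF subX _ subX _ _ GR.extension_in_vclosure])
    (use conv_op_closed Sop_conv_op act_right_CC in auto)

lemma CY_right: "b \<in> carr (Fred p H) \<Longrightarrow> y \<in> CY \<Longrightarrow> compose (carr E) y (HR.extension b) \<in> CY"
  unfolding Fred_def
  by (rule EEF.compose_vclosure[OF subY _ subY _ _ HR.extension_in_vclosure])
    (use H.lreg_sum_closed[OF p] Top_lreg_sum in auto)

lemma CX_left: "b \<in> carr (Fred p H) \<Longrightarrow> x \<in> CX \<Longrightarrow> compose (carr F) (HR.extension b) x \<in> CX"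
  unfolding Fred_def
  by (rule FEE.compose_vclosure[OF _ subX subX _ HR.extension_in_vclosure])
    (use H.lreg_sum_closed[OF p] lreg_sum_Sop in auto)

definition \<pi> where
  "\<pi> P = (\<lambda>x\<in>CX. compose (carr F) x (GR.extension P), \<lambda>y\<in>CY. compose (carr E) (GR.extension P) y)"

abbreviation "pair_alg \<equiv> pair_ops (Fred p H) (corr_pair p H Z)"
abbreviation "XX \<equiv> XZ p H Z"
abbreviation "YY \<equiv> YZ p H Z"

lemma XY_carr [simp]: "carr XX = CX" "carr YY = CY"
  by (simp_all add: XZ_def YZ_def)

lemma XY_ops [simp]: "vadd XX = vadd (bops F E)" "vadd YY = vadd (bops E F)"
   "vscale XX = vscale (bops F E)" "vscale YY = vscale (bops E F)"
  by (simp_all add: XZ_def YZ_def)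

lemma extension_closed: "P \<in> carr (Fred p G) \<Longrightarrow> GR.extension P \<in> carr (bops F F)"
  unfolding Fred_def by (rule GR.extension_closed)

lemma \<pi>_bops:
  assumes P: "P \<in> carr (Fred p G)"
  shows "fst (\<pi> P) \<in> carr (bops XX XX)" "snd (\<pi> P) \<in> carr (bops YY YY)"
    "vnorm (bops XX XX) (fst (\<pi> P)) \<le> vnorm (bops F F) (GR.extension P)"
    "vnorm (bops YY YY) (snd (\<pi> P)) \<le> vnorm (bops F F) (GR.extension P)"
  unfolding \<pi>_def fst_conv snd_conv XZ_def YZ_def
  by (rule right_mult_op[OF cnormed_F cnormed_E CX_carr CX_ne CX_add CX_scale extension_closed[OF P] CX_right[OF P]]
        left_mult_op[OF cnormed_E cnormed_F CY_carr CY_ne CY_add CY_scale extension_closed[OF P] CY_left[OF P]]; assumption)+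

lemma pair_alg_sel:
  "carr pair_alg = {(Tl, Tr). Tl \<in> carr (bops XX XX) \<and> Tr \<in> carr (bops YY YY) \<and>
        (\<forall>b\<in>carr (Fred p H). \<forall>x\<in>CX. Tl (compose (carr F) (HR.extension b) x) = compose (carr F) (HR.extension b) (Tl x)) \<and>
        (\<forall>b\<in>carr (Fred p H). \<forall>y\<in>CY. Tr (compose (carr E) y (HR.extension b)) = compose (carr E) (Tr y) (HR.extension b)) \<and>
        (\<forall>x\<in>CX. \<forall>y\<in>CY. pairing (corr_pair p H Z) (Tl x) y = pairing (corr_pair p H Z) x (Tr y))}"
  "vadd pair_alg = (\<lambda>S T. (vadd (bops XX XX) (fst S) (fst T), vadd (bops YY YY) (snd S) (snd T)))"
  "vscale pair_alg = (\<lambda>c T. (vscale (bops XX XX) c (fst T), vscale (bops YY YY) c (snd T)))"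
  "vnorm pair_alg = (\<lambda>T. max (vnorm (bops XX XX) (fst T)) (vnorm (bops YY YY) (snd T)))"
  "amult pair_alg = (\<lambda>T S. (compose CX (fst S) (fst T), compose CY (snd T) (snd S)))"
  unfolding pair_ops_def Let_def corr_pair_def Fred_rep_eq by (simp_all del: bops_sel)

text \<open>Both sides of each compatibility condition are built from the same triple composition. For the pairing,
\<open>(x L) y = x (L y)\<close> means that the two sides are the preimage of one operator.\<close>

lemma \<pi>_closed:
  assumes P: "P \<in> carr (Fred p G)" shows "\<pi> P \<in> carr pair_alg"
proof -
  let ?L = "GR.extension P"
  have 1: "fst (\<pi> P) (compose (carr F) (HR.extension b) x) = compose (carr F) (HR.extension b) (fst (\<pi> P) x)"
    if "b \<in> carr (Fred p H)" "x \<in> CX" for b x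
    using that CX_left[OF that] by (simp add: \<pi>_def compose_compose[OF extension_closed[OF P]])
  have 2: "snd (\<pi> P) (compose (carr E) y (HR.extension b)) = compose (carr E) (snd (\<pi> P) y) (HR.extension b)"
    if b: "b \<in> carr (Fred p H)" and y: "y \<in> CY" for b y
  proof -
    have "HR.extension b \<in> carr (bops E E)" using b unfolding Fred_def by (rule HR.extension_closed)
    then show ?thesis using y CY_right[OF b y] by (simp add: \<pi>_def compose_compose)
  qed
  have 3: "pairing (corr_pair p H Z) (fst (\<pi> P) x) y = pairing (corr_pair p H Z) x (snd (\<pi> P) y)"
    if x: "x \<in> CX" and y: "y \<in> CY" for x y
    using x y compose_compose[OF subsetD[OF CY_carr y], of x ?L] by (simp add: \<pi>_def corr_pair_def)
  show ?thesis unfolding pair_alg_sel using \<pi>_bops[OF P] 1 2 3 by (simp add: case_prod_unfold)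
qed

lemma \<pi>_add:
  assumes P: "P \<in> carr (Fred p G)" and Q: "Q \<in> carr (Fred p G)"
  shows "vadd (Fred p G) P Q \<in> carr (Fred p G)" "\<pi> (vadd (Fred p G) P Q) = vadd pair_alg (\<pi> P) (\<pi> Q)"
proof -
  note PQ = P[unfolded Fred_def] Q[unfolded Fred_def]
  show "vadd (Fred p G) P Q \<in> carr (Fred p G)" unfolding Fred_def by (rule GR.extension_add(1)[OF PQ])
  have e: "GR.extension (vadd (Fred p G) P Q) = vadd (bops F F) (GR.extension P) (GR.extension Q)"
    unfolding Fred_def by (rule GR.extension_add(2)[OF PQ])
  note L = extension_closed[OF P] extension_closed[OF Q]
  have "compose (carr F) x (vadd (bops F F) (GR.extension P) (GR.extension Q))
      = vadd (bops F E) (compose (carr F) x (GR.extension P)) (compose (carr F) x (GR.extension Q))" if "x \<in> CX" for x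
    by (rule FFE.compose_add_right[OF subsetD[OF CX_carr that] L])
  moreover have "compose (carr E) (vadd (bops F F) (GR.extension P) (GR.extension Q)) y
      = vadd (bops E F) (compose (carr E) (GR.extension P) y) (compose (carr E) (GR.extension Q) y)" if "y \<in> CY" for y
    by (rule EFF.compose_add_left[OF subsetD[OF CY_carr that]])
  ultimately show "\<pi> (vadd (Fred p G) P Q) = vadd pair_alg (\<pi> P) (\<pi> Q)"
    unfolding \<pi>_def e pair_alg_sel bops_sel(1)[of XX XX] bops_sel(1)[of YY YY] fst_conv snd_conv XY_carr XY_ops
    by (auto simp del: bops_sel intro!: restrict_ext)
qed

lemma \<pi>_scale:
  assumes P: "P \<in> carr (Fred p G)"
  shows "vscale (Fred p G) c P \<in> carr (Fred p G)" "\<pi> (vscale (Fred p G) c P) = vscale pair_alg c (\<pi> P)"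
proof -
  note P' = P[unfolded Fred_def]
  show "vscale (Fred p G) c P \<in> carr (Fred p G)" unfolding Fred_def by (rule GR.extension_scale(1)[OF P'])
  have e: "GR.extension (vscale (Fred p G) c P) = vscale (bops F F) c (GR.extension P)"
    unfolding Fred_def by (rule GR.extension_scale(2)[OF P'])
  note L = extension_closed[OF P]
  have "compose (carr F) x (vscale (bops F F) c (GR.extension P)) = vscale (bops F E) c (compose (carr F) x (GR.extension P))"
    if "x \<in> CX" for x by (rule FFE.compose_scale_right[OF subsetD[OF CX_carr that] L])
  moreover have "compose (carr E) (vscale (bops F F) c (GR.extension P)) y = vscale (bops E F) c (compose (carr E) (GR.extension P) y)"
    if "y \<in> CY" for y by (rule EFF.compose_scale_left[OF subsetD[OF CY_carr that]])
  ultimately show "\<pi> (vscale (Fred p G) c P) = vscale pair_alg c (\<pi> P)"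
    unfolding \<pi>_def e pair_alg_sel bops_sel(2)[of XX XX] bops_sel(2)[of YY YY] fst_conv snd_conv XY_carr XY_ops
    by (auto simp del: bops_sel intro!: restrict_ext)
qed

lemma \<pi>_mult:
  assumes P: "P \<in> carr (Fred p G)" and Q: "Q \<in> carr (Fred p G)"
  shows "\<pi> (amult (Fred p G) P Q) = amult pair_alg (\<pi> P) (\<pi> Q)"
proof -
  note PQ = P[unfolded Fred_def] Q[unfolded Fred_def]
  have e: "GR.extension (amult (Fred p G) P Q) = compose (carr F) (GR.extension P) (GR.extension Q)"
    unfolding Fred_def by (rule GR.extension_mult[OF PQ])
  have "compose (carr F) x (compose (carr F) (GR.extension P) (GR.extension Q)) = fst (\<pi> Q) (fst (\<pi> P) x)" if "x \<in> CX" for x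
    using that CX_right[OF P that] by (simp add: \<pi>_def compose_compose[OF extension_closed[OF Q]])
  moreover have "compose (carr E) (compose (carr F) (GR.extension P) (GR.extension Q)) y = snd (\<pi> P) (snd (\<pi> Q) y)" if "y \<in> CY" for y
    using that CY_left[OF Q that] by (simp add: \<pi>_def compose_compose[OF subsetD[OF CY_carr that]])
  ultimately show ?thesis
    unfolding \<pi>_def[of "amult (Fred p G) P Q"] e pair_alg_sel compose_def[of CX] compose_def[of CY]
    by (auto intro!: restrict_ext)
qed

lemma \<pi>_dist:
  assumes P: "P \<in> carr (Fred p G)" and Q: "Q \<in> carr (Fred p G)"
  shows "vdist pair_alg (\<pi> P) (\<pi> Q) \<le> vdist (Fred p G) P Q"
proof -
  let ?D = "vadd (Fred p G) P (vscale (Fred p G) (-1) Q)"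
  note D = \<pi>_add(1)[OF P \<pi>_scale(1)[OF Q]]
  have "vdist pair_alg (\<pi> P) (\<pi> Q) = vnorm pair_alg (\<pi> ?D)"
    unfolding vdist_def \<pi>_add(2)[OF P \<pi>_scale(1)[OF Q]] \<pi>_scale(2)[OF Q] ..
  also have "\<dots> \<le> vnorm (bops F F) (GR.extension ?D)"
    unfolding pair_alg_sel using \<pi>_bops(3,4)[OF D] by simp
  also have "\<dots> \<le> vdist (Fred p G) P Q"
    unfolding vdist_def using D GR.extension_norm[of ?D] by (simp add: Fred_def)
  finally show ?thesis .
qed

theorem algebraic_action_extends: "action_extends p G H Z"
  unfolding action_extends_def
proof (intro exI conjI ballI)
  show "continuous_alg_hom (Fred p G) pair_alg \<pi>"
    unfolding continuous_alg_hom_def linear_between_def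
  proof (intro conjI ballI allI impI)
    show "\<pi> \<in> carr (Fred p G) \<rightarrow> carr pair_alg" using \<pi>_closed by blast
    fix P and e :: real assume "P \<in> carr (Fred p G)" "0 < e"
    then show "\<exists>d>0. \<forall>b\<in>carr (Fred p G). vdist (Fred p G) b P < d \<longrightarrow> vdist pair_alg (\<pi> b) (\<pi> P) < e"
      using \<pi>_dist by (intro exI[of _ e]) (meson le_less_trans)
  qed (rule \<pi>_add(2) \<pi>_scale(2) \<pi>_mult; assumption)+
next
  fix a \<psi> assume a: "a \<in> CC (gtop G)" and \<psi>: "\<psi> \<in> CC (ztop Z)"
  have e: "GR.extension (Fred_embed p G a) = LA.conv_op F a"
    unfolding Fred_embed_def by (rule GR.extension_embed) (simp add: a)
  have "Sop p H Z \<psi> \<in> CX" using FE.B.vclosure_superset[OF subX] \<psi> by blast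
  then show "fst (\<pi> (Fred_embed p G a)) (Sop p H Z \<psi>) = Sop p H Z (act_right G Z \<psi> a)"
    by (simp add: \<pi>_def e Sop_conv_op[OF a \<psi>])
next
  fix a \<phi> assume a: "a \<in> CC (gtop G)" and \<phi>: "\<phi> \<in> CC (ztop Z)"
  have e: "GR.extension (Fred_embed p G a) = LA.conv_op F a"
    unfolding Fred_embed_def by (rule GR.extension_embed) (simp add: a)
  have "Top p H Z \<phi> \<in> CY" using EF.B.vclosure_superset[OF subY] \<phi> by blast
  then show "snd (\<pi> (Fred_embed p G a)) (Top p H Z \<phi>) = Top p H Z (act_left G Z a \<phi>)"
    by (simp add: \<pi>_def e conv_op_Top[OF a \<phi>])
qed

end

text \<open>The stabilizer of \<open>w\<close> is the image of the preimage of \<open>(w, w)\<close> under the proper map, hence compact, and it lies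
in a source fibre, which is discrete.\<close>

lemma (in correspondence_setting) proper_finite_stabilizer:
  assumes "left_action_proper G Z" "w \<in> X"
  shows "finite {\<gamma> \<in> arrows G. src G \<gamma> = ranchor Z w \<and> lact Z \<gamma> w = w}"
proof -
  let ?Q = "{q \<in> topspace (left_pairs G Z). (\<lambda>(\<gamma>, z). (lact Z \<gamma> z, z)) q \<in> {(w, w)}}"
  let ?K = "{\<gamma> \<in> arrows G. src G \<gamma> = ranchor Z w \<and> lact Z \<gamma> w = w}"
  have "compactin (left_pairs G Z) ?Q"
    by (rule compactin_proper_map_preimage[OF assms(1)[unfolded left_action_proper_def]]) (use assms(2) in simp)
  then have "compactin (gtop G) (fst ` ?Q)"
    by (rule image_compactin) (simp add: left_pairs_def continuous_map_from_subtopology continuous_map_fst)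
  moreover have "fst ` ?Q = ?K" using assms(2) by (force simp: left_pairs_def arrows_def)
  ultimately have "compactin (gtop G) ?K" by simp
  then obtain N where "\<And>y. finite {\<gamma> \<in> ?K. src G \<gamma> = y}" "\<And>y. card {\<gamma> \<in> ?K. src G \<gamma> = y} \<le> (N::nat)"
    by (rule local_homeo_fibre_card[OF G.etale_src]) blast
  from this(1)[of "ranchor Z w"] show ?thesis by (rule finite_subset[rotated]) auto
qed

theorem proposition7p13:
  fixes G :: "'g groupoid" and H :: "'h groupoid" and Z :: "('g, 'h, 'z) corr"
    and p :: ennreal
  assumes "lc_etale_groupoid G" and "lc_etale_groupoid H"
    and "groupoid_correspondence G H Z"
    and "1 \<le> p"
    and "p = 1 \<or> p = \<infinity> \<or> (1 < p \<and> p < \<infinity> \<and> left_action_proper G Z)"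
  shows "action_extends p G H Z"
proof -
  interpret correspondence_setting G H Z p
    using assms by (simp add: correspondence_setting_def correspondence_setting_axioms_def)
  have "extendable_correspondence G H Z p"
    by unfold_locales (use assms(5) proper_finite_stabilizer in blast)
  then show ?thesis by (rule extendable_correspondence.algebraic_action_extends)
qed

end
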